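(* Let $(M,J,h)$ be a Hermitian surface, let $\lambda>0$, and let $(\mathbb{J}_i^L,\mathbb{K}_i^L(\lambda))$, $i=1,2,3,4$, be the almost Hermitian structures on the twistor space $Z=\mathbb{P}(T^{1,0}M)$ induced by the Lichnerowicz connection on $Q=U(M)$. Then: (i) $d\mathbb{K}_1^L(\lambda)=0$ if and only if $(M,J,h)$ is self-dual and Einstein with scalar curvature $s=\frac{24}{\lambda^2}$; (ii) $d\mathbb{K}_2^L(\lambda)=0$ if and only if $(M,J,h)$ is self-dual and Einstein with scalar curvature $s=-\frac{24}{\lambda^2}$; (iii) the following are equivalent: $d\mathbb{K}_3^L(\lambda)=0$; $d\mathbb{K}_4^L(\lambda)=0$; $(M,J,h)$ is a flat K\"ahler surface.
   Context: A Hermitian surface $(M,J,h)$ is a complex manifold of real dimension $4$ with (integrable) complex structure $J$ and a $J$-compatible Riemannian metric $h$. Its fundamental form is $F(X,Y)=h(JX,Y)$ and $M$ is oriented by $\frac{F^2}{2}$; it is K\"ahler if $dF=0$. The Hodge star of $h$ splits $\wedge^2T^*M=\wedge^+\oplus\wedge^-$ into its $\pm1$ eigenbundles; $W^{\pm}$ denote the corresponding parts of the Weyl curvature operator. $(M,J,h)$ is self-dual if $W^-=0$, and Einstein if its trace-free Ricci tensor (of the Levi-Civita connection) vanishes; $s$ is the Riemannian scalar curvature (positive on round spheres). "Flat" means that the Riemannian curvature of $h$ vanishes. Unitary frames. Let $\pi:Q=U(M)\to M$ be the principal $U(2)$-bundle of unitary frames; its points are pairs $(u_1,u_2)$ with $u_1=\frac{1}{\sqrt2}(e_1-\sqrt{-1}e_2)$,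 $u_2=\frac{1}{\sqrt2}(e_3-\sqrt{-1}e_4)$, where $(e_1,e_2=Je_1,e_3,e_4=Je_3)$ is an $h$-orthonormal frame of $T_xM$. The canonical $\mathbb{C}^2$-valued $1$-form $(\varphi^1,\varphi^2)^t$ on $Q$ is defined by $\pi_*X=\sum_a\varphi^a(X)u_a+\sum_a\overline{\varphi^a(X)}\,\overline{u_a}$ for $X\in T_{(u_1,u_2)}Q$. A Hermitian connection $D$ (i.e. $Dh=0$, $DJ=0$) is given by a $\mathfrak{u}(2)$-valued connection form $(\phi^a_b)$ on $Q$, where $Du_b=\sum_a\phi^a_b\,u_a$ for local unitary frames. Twistor space. Let $Z=\mathbb{P}(T^{1,0}M)$ be the bundle of complex lines in $T^{1,0}M$, and let $\pi_1:Q\to Z$, $\pi_1((u_1,u_2))=\mathrm{Span}_{\mathbb{C}}\{u_1\}$. Given a Hermitian connection with form $(\phi^a_b)$, put $\varphi^3=\phi^1_2$. For a local section $u$ of $\pi_1:Q\to Z$, the forms $u^*\varphi^1,u^*\varphi^2,u^*\varphi^3$ and their conjugates form a local basis of complex $1$-forms on $Z$ (the pull-back $u^*$ is omitted from the notation). Changing the section multiplies each of $\varphi^1,\varphi^2,\varphi^3$ by a unit-modulus function, so the following almost complex structures on $Z$ are well defined by their local bases of $(1,0)$-forms: $\mathbb{J}_1:\{\varphi^1,\overline{\varphi^2},\varphi^3\}$; $\mathbb{J}_2:\{\varphi^1,\overline{\varphi^2},\overline{\varphi^3}\}$; $\mathbb{J}_3:\{\varphi^1,\varphi^2,\varphi^3\}$;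 $\mathbb{J}_4:\{\varphi^1,\varphi^2,\overline{\varphi^3}\}$. For $\lambda>0$ the Riemannian metric $h_\lambda=\varphi^1\cdot\overline{\varphi^1}+\varphi^2\cdot\overline{\varphi^2}+\lambda^2\varphi^3\cdot\overline{\varphi^3}$ on $Z$ is compatible with each $\mathbb{J}_i$, and the associated (globally defined) fundamental $2$-forms are $\mathbb{K}_1(\lambda)=\sqrt{-1}(\varphi^1\wedge\overline{\varphi^1}+\overline{\varphi^2}\wedge\varphi^2+\lambda^2\varphi^3\wedge\overline{\varphi^3})$, $\mathbb{K}_2(\lambda)=\sqrt{-1}(\varphi^1\wedge\overline{\varphi^1}+\overline{\varphi^2}\wedge\varphi^2+\lambda^2\overline{\varphi^3}\wedge\varphi^3)$, $\mathbb{K}_3(\lambda)=\sqrt{-1}(\varphi^1\wedge\overline{\varphi^1}+\varphi^2\wedge\overline{\varphi^2}+\lambda^2\varphi^3\wedge\overline{\varphi^3})$, $\mathbb{K}_4(\lambda)=\sqrt{-1}(\varphi^1\wedge\overline{\varphi^1}+\varphi^2\wedge\overline{\varphi^2}+\lambda^2\overline{\varphi^3}\wedge\varphi^3)$. The Lichnerowicz connection is the Hermitian connection whose connection form on $Q$ is the $\mathfrak{u}(2)$-component, with respect to $\mathfrak{so}(4)=\mathfrak{u}(2)\oplus\mathfrak{m}$, of the restriction to $Q$ of the Levi-Civita connection form; equivalently $D_XY=\frac12(\nabla_XY-J\nabla_X(JY))$ with $\nabla$ the Levi-Civita connection. The structures obtained from it are denoted $\mathbb{J}_i^L$, $\mathbb{K}_i^L(\lambda)$.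 *)

theory Defs
  imports "HOL-Analysis.Analysis"
begin

section \<open>Calculus on open subsets of Euclidean spaces\<close>

abbreviation dir_deriv :: "('a::real_normed_vector \<Rightarrow> 'b::real_normed_vector) \<Rightarrow> 'a \<Rightarrow> 'a \<Rightarrow> 'b"
  where "dir_deriv f p v \<equiv> frechet_derivative f (at p) v"

primrec Ck_on :: "nat \<Rightarrow> ('a::real_normed_vector \<Rightarrow> 'b::real_normed_vector) \<Rightarrow> 'a set \<Rightarrow> bool"
  where
    "Ck_on 0 f S \<longleftrightarrow> continuous_on S f"
  | "Ck_on (Suc k) f S \<longleftrightarrow>
       (\<forall>p\<in>S. f differentiable (at p)) \<and> (\<forall>v. Ck_on k (\<lambda>p. dir_deriv f p v) S)"

text \<open>Only used for open \<open>S\<close>.\<close>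

definition smooth_on :: "'a::real_normed_vector set \<Rightarrow> ('a \<Rightarrow> 'b::real_normed_vector) \<Rightarrow> bool"
  where "smooth_on S f \<longleftrightarrow> (\<forall>k. Ck_on k f S)"

text \<open>Exterior derivative of a 2-form \<open>\<omega>\<close> on constant vector fields (which commute).\<close>

definition ext_deriv2 ::
  "('a::real_normed_vector \<Rightarrow> 'a \<Rightarrow> 'a \<Rightarrow> 'b::real_normed_vector) \<Rightarrow> 'a \<Rightarrow> 'a \<Rightarrow> 'a \<Rightarrow> 'a \<Rightarrow> 'b"
  where "ext_deriv2 \<omega> p X Y Z =
    dir_deriv (\<lambda>q. \<omega> q Y Z) p X - dir_deriv (\<lambda>q. \<omega> q X Z) p Y + dir_deriv (\<lambda>q. \<omega> q X Y) p Z"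

definition wedge :: "('a \<Rightarrow> complex) \<Rightarrow> ('a \<Rightarrow> complex) \<Rightarrow> 'a \<Rightarrow> 'a \<Rightarrow> complex"
  where "wedge \<alpha> \<beta> X Y = \<alpha> X * \<beta> Y - \<alpha> Y * \<beta> X"

definition conj_form :: "('a \<Rightarrow> complex) \<Rightarrow> 'a \<Rightarrow> complex"
  where "conj_form \<alpha> X = cnj (\<alpha> X)"


section \<open>Riemannian geometry in coordinates\<close>

text \<open>A metric on an open subset of \<open>'a\<close> is a function \<open>g\<close> with \<open>g p X Y\<close> the inner product
  of the vectors \<open>X\<close>, \<open>Y\<close> at the point \<open>p\<close>.\<close>

text \<open>The vector dual to the covector \<open>\<alpha>\<close> with respect to the inner product \<open>b\<close>.\<close>

definition sharp :: "('a \<Rightarrow> 'a \<Rightarrow> real) \<Rightarrow> ('a \<Rightarrow> real) \<Rightarrow> 'a"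
  where "sharp b \<alpha> = (THE V. \<forall>W. b V W = \<alpha> W)"

definition endo_trace :: "('a::euclidean_space \<Rightarrow> 'a) \<Rightarrow> real"
  where "endo_trace L = (\<Sum>b\<in>Basis. L b \<bullet> b)"

text \<open>The Koszul formula for constant vector fields: the Levi-Civita connection is
  \<open>\<nabla>\<^sub>X Y = dir_deriv Y p X + christoffel g p X (Y p)\<close>.\<close>

definition christoffel ::
  "('a::euclidean_space \<Rightarrow> 'a \<Rightarrow> 'a \<Rightarrow> real) \<Rightarrow> 'a \<Rightarrow> 'a \<Rightarrow> 'a \<Rightarrow> 'a"
  where "christoffel g p X Y = sharp (g p) (\<lambda>Z.
    (dir_deriv (\<lambda>q. g q Y Z) p X + dir_deriv (\<lambda>q. g q X Z) p Y - dir_deriv (\<lambda>q. g q X Y) p Z) / 2)"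

text \<open>\<open>R(X,Y)Z = \<nabla>\<^sub>X\<nabla>\<^sub>Y Z - \<nabla>\<^sub>Y\<nabla>\<^sub>X Z\<close> for constant vector fields.\<close>

definition curvature ::
  "('a::euclidean_space \<Rightarrow> 'a \<Rightarrow> 'a \<Rightarrow> real) \<Rightarrow> 'a \<Rightarrow> 'a \<Rightarrow> 'a \<Rightarrow> 'a \<Rightarrow> 'a"
  where "curvature g p X Y Z =
    dir_deriv (\<lambda>q. christoffel g q Y Z) p X - dir_deriv (\<lambda>q. christoffel g q X Z) p Y
    + christoffel g p X (christoffel g p Y Z) - christoffel g p Y (christoffel g p X Z)"

definition ricci :: "('a::euclidean_space \<Rightarrow> 'a \<Rightarrow> 'a \<Rightarrow> real) \<Rightarrow> 'a \<Rightarrow> 'a \<Rightarrow> 'a \<Rightarrow> real"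
  where "ricci g p Y Z = endo_trace (\<lambda>X. curvature g p X Y Z)"

definition scalar_curv :: "('a::euclidean_space \<Rightarrow> 'a \<Rightarrow> 'a \<Rightarrow> real) \<Rightarrow> 'a \<Rightarrow> real"
  where "scalar_curv g p = endo_trace (\<lambda>Y. sharp (g p) (ricci g p Y))"

definition tracefree_ricci :: "('a::euclidean_space \<Rightarrow> 'a \<Rightarrow> 'a \<Rightarrow> real) \<Rightarrow> 'a \<Rightarrow> 'a \<Rightarrow> 'a \<Rightarrow> real"
  where "tracefree_ricci g p Y Z = ricci g p Y Z - scalar_curv g p / real DIM('a) * g p Y Z"

text \<open>The Schouten and Weyl tensors below have the coefficients of dimension 4. The Weyl tensor
  is the totally trace-free part of \<open>(X,Y,Z,V) \<mapsto> g(R(X,Y)Z,V)\<close>.\<close>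

definition schouten4 :: "('a::euclidean_space \<Rightarrow> 'a \<Rightarrow> 'a \<Rightarrow> real) \<Rightarrow> 'a \<Rightarrow> 'a \<Rightarrow> 'a \<Rightarrow> real"
  where "schouten4 g p Y Z = (ricci g p Y Z - scalar_curv g p / 6 * g p Y Z) / 2"

definition weyl4 :: "('a::euclidean_space \<Rightarrow> 'a \<Rightarrow> 'a \<Rightarrow> real) \<Rightarrow> 'a \<Rightarrow> 'a \<Rightarrow> 'a \<Rightarrow> 'a \<Rightarrow> 'a \<Rightarrow> real"
  where "weyl4 g p X Y Z V = g p (curvature g p X Y Z) V
    - (schouten4 g p Y Z * g p X V - schouten4 g p X Z * g p Y V
       + g p Y Z * schouten4 g p X V - g p X Z * schouten4 g p Y V)"

definition orthonormal4 :: "('a \<Rightarrow> 'a \<Rightarrow> real) \<Rightarrow> (nat \<Rightarrow> 'a) \<Rightarrow> bool"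
  where "orthonormal4 b e \<longleftrightarrow>
    (\<forall>i\<in>{1..4}. \<forall>j\<in>{1..4}. b (e i) (e j) = (if i = j then 1 else 0))"

text \<open>\<open>F \<and> F / 2\<close> as a 4-form.\<close>

definition half_square :: "('a \<Rightarrow> 'a \<Rightarrow> real) \<Rightarrow> 'a \<Rightarrow> 'a \<Rightarrow> 'a \<Rightarrow> 'a \<Rightarrow> real"
  where "half_square F X Y Z V = F X Y * F Z V - F X Z * F Y V + F X V * F Y Z"

definition oriented_orthonormal4 ::
  "('a \<Rightarrow> 'a \<Rightarrow> real) \<Rightarrow> ('a \<Rightarrow> 'a \<Rightarrow> real) \<Rightarrow> (nat \<Rightarrow> 'a) \<Rightarrow> bool"
  where "oriented_orthonormal4 b F e \<longleftrightarrow>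
    orthonormal4 b e \<and> half_square F (e 1) (e 2) (e 3) (e 4) > 0"

definition two_form :: "('a::real_vector \<Rightarrow> 'a \<Rightarrow> real) \<Rightarrow> bool"
  where "two_form \<alpha> \<longleftrightarrow> bilinear \<alpha> \<and> (\<forall>X. \<alpha> X X = 0)"

text \<open>\<open>\<beta> = \<star>\<alpha>\<close>, where \<open>\<star>(e\<^sup>3 \<and> e\<^sup>4) = e\<^sup>1 \<and> e\<^sup>2\<close> for the dual basis of each positively
  oriented orthonormal basis.\<close>

definition is_hodge_star ::
  "('a \<Rightarrow> 'a \<Rightarrow> real) \<Rightarrow> ('a \<Rightarrow> 'a \<Rightarrow> real) \<Rightarrow> ('a \<Rightarrow> 'a \<Rightarrow> real) \<Rightarrow> ('a \<Rightarrow> 'a \<Rightarrow> real) \<Rightarrow> bool"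
  where "is_hodge_star b F \<alpha> \<beta> \<longleftrightarrow>
    (\<forall>e. oriented_orthonormal4 b F e \<longrightarrow> \<beta> (e 1) (e 2) = \<alpha> (e 3) (e 4))"

definition anti_self_dual_form ::
  "('a::real_vector \<Rightarrow> 'a \<Rightarrow> real) \<Rightarrow> ('a \<Rightarrow> 'a \<Rightarrow> real) \<Rightarrow> ('a \<Rightarrow> 'a \<Rightarrow> real) \<Rightarrow> bool"
  where "anti_self_dual_form b F \<alpha> \<longleftrightarrow>
    two_form \<alpha> \<and> is_hodge_star b F \<alpha> (\<lambda>X Y. - \<alpha> X Y)"

text \<open>The action of a curvature tensor \<open>W\<close> on 2-forms, computed in an orthonormal basis \<open>e\<close>
  (the result does not depend on \<open>e\<close>).\<close>

definition curv_operator ::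
  "(nat \<Rightarrow> 'a) \<Rightarrow> ('a \<Rightarrow> 'a \<Rightarrow> 'a \<Rightarrow> 'a \<Rightarrow> real) \<Rightarrow> ('a \<Rightarrow> 'a \<Rightarrow> real) \<Rightarrow> 'a \<Rightarrow> 'a \<Rightarrow> real"
  where "curv_operator e W \<alpha> Z V =
    (\<Sum>i\<in>{1..4}. \<Sum>j\<in>{1..4}. \<alpha> (e i) (e j) * W (e i) (e j) Z V) / 2"


section \<open>Complex surfaces and their tangent vectors\<close>

type_synonym ('m, 'e) chart = "'m set \<times> ('m \<Rightarrow> 'e)"

abbreviation chart_dom :: "('m, 'e) chart \<Rightarrow> 'm set" where "chart_dom \<equiv> fst"
abbreviation chart_map :: "('m, 'e) chart \<Rightarrow> 'm \<Rightarrow> 'e" where "chart_map \<equiv> snd"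

definition chart_image :: "('m, 'e) chart \<Rightarrow> 'e set"
  where "chart_image c = chart_map c ` chart_dom c"

definition chart_inv :: "('m, 'e) chart \<Rightarrow> 'e \<Rightarrow> 'm"
  where "chart_inv c = inv_into (chart_dom c) (chart_map c)"

type_synonym 'm cchart = "('m, complex^2) chart"

definition holomorphic2_on :: "(complex^2 \<Rightarrow> complex^2) \<Rightarrow> (complex^2) set \<Rightarrow> bool"
  where "holomorphic2_on f S \<longleftrightarrow>
    (\<forall>p\<in>S. \<exists>L. (f has_derivative L) (at p) \<and> (\<forall>k v. L (k *s v) = k *s L v))"

definition surface_points :: "'m cchart set \<Rightarrow> 'm set"
  where "surface_points A = (\<Union>c\<in>A. chart_dom c)"

text \<open>\<open>A\<close> is a holomorphic atlas on \<open>surface_points A\<close>, an open subset of the Hausdorff, second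
  countable space \<open>'m\<close>. The complex structure \<open>J\<close> is multiplication by \<open>\<i>\<close> in each chart.\<close>

definition complex_surface ::
  "('m::{t2_space,second_countable_topology}) cchart set \<Rightarrow> bool"
  where "complex_surface A \<longleftrightarrow>
    (\<forall>c\<in>A. open (chart_dom c) \<and> open (chart_image c) \<and>
       homeomorphism (chart_dom c) (chart_image c) (chart_map c) (chart_inv c)) \<and>
    (\<forall>c\<in>A. \<forall>c'\<in>A.
       holomorphic2_on (chart_map c' \<circ> chart_inv c) (chart_map c ` (chart_dom c \<inter> chart_dom c')))"

text \<open>A vector at a point is given by its components in all charts around that point. The
  components \<open>\<xi>\<close> in a chart with coordinates \<open>z\<^sup>1, z\<^sup>2\<close> stand for the \<open>(1,0)\<close>-vector
  \<open>\<Sum>\<^sub>k \<xi>\<^sup>k \<partial>/\<partial>z\<^sup>k\<close> and, under the isomorphism \<open>X \<mapsto> (X - \<i> J X)/2\<close> of complex bundles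
  from \<open>(TM, J)\<close> to \<open>T\<^sup>1\<^sup>,\<^sup>0M\<close>, also for the real vector \<open>X = \<Sum>\<^sub>k \<xi>\<^sup>k \<partial>/\<partial>z\<^sup>k + conjugate\<close>.\<close>

type_synonym 'm tvec = "'m cchart \<Rightarrow> complex^2"

definition tangent_space :: "'m cchart set \<Rightarrow> 'm \<Rightarrow> 'm tvec set"
  where "tangent_space A x = {v.
    (\<forall>c. \<not> (c \<in> A \<and> x \<in> chart_dom c) \<longrightarrow> v c = 0) \<and>
    (\<forall>c\<in>A. \<forall>c'\<in>A. x \<in> chart_dom c \<inter> chart_dom c' \<longrightarrow>
       v c' = dir_deriv (chart_map c' \<circ> chart_inv c) (chart_map c x) (v c))}"

definition tvec_scale :: "complex \<Rightarrow> 'm tvec \<Rightarrow> 'm tvec"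
  where "tvec_scale k v = (\<lambda>c. k *s v c)"

definition tvec_add :: "'m tvec \<Rightarrow> 'm tvec \<Rightarrow> 'm tvec"
  where "tvec_add v w = (\<lambda>c. v c + w c)"

text \<open>The vector at \<open>x\<close> with components \<open>a\<close> in the chart \<open>c\<close>.\<close>

definition tvec_at :: "'m cchart set \<Rightarrow> 'm cchart \<Rightarrow> 'm \<Rightarrow> complex^2 \<Rightarrow> 'm tvec"
  where "tvec_at A c x a = (THE v. v \<in> tangent_space A x \<and> v c = a)"

type_synonym 'm metric = "'m \<Rightarrow> 'm tvec \<Rightarrow> 'm tvec \<Rightarrow> real"

definition metric_comp ::
  "'m cchart set \<Rightarrow> 'm metric \<Rightarrow> 'm cchart \<Rightarrow> complex^2 \<Rightarrow> complex^2 \<Rightarrow> complex^2 \<Rightarrow> real"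
  where "metric_comp A h c p a b =
    h (chart_inv c p) (tvec_at A c (chart_inv c p) a) (tvec_at A c (chart_inv c p) b)"

definition hermitian_surface ::
  "('m::{t2_space,second_countable_topology}) cchart set \<Rightarrow> 'm metric \<Rightarrow> bool"
  where "hermitian_surface A h \<longleftrightarrow> complex_surface A \<and>
    (\<forall>x\<in>surface_points A. \<forall>u\<in>tangent_space A x. \<forall>v\<in>tangent_space A x.
       (\<forall>w\<in>tangent_space A x. \<forall>r.
          h x (tvec_add (tvec_scale (of_real r) u) v) w = r * h x u w + h x v w) \<and>
       h x u v = h x v u \<and>
       (u \<noteq> (\<lambda>c. 0) \<longrightarrow> h x u u > 0) \<and>
       h x (tvec_scale \<i> u) (tvec_scale \<i> v) = h x u v) \<and>
    (\<forall>c\<in>A. \<forall>a b. smooth_on (chart_image c) (\<lambda>p. metric_comp A h c p a b))"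

definition kaehler_form_comp ::
  "'m cchart set \<Rightarrow> 'm metric \<Rightarrow> 'm cchart \<Rightarrow> complex^2 \<Rightarrow> complex^2 \<Rightarrow> complex^2 \<Rightarrow> real"
  where "kaehler_form_comp A h c p X Y = metric_comp A h c p (\<i> *s X) Y"

definition kaehler :: "'m cchart set \<Rightarrow> 'm metric \<Rightarrow> bool"
  where "kaehler A h \<longleftrightarrow>
    (\<forall>c\<in>A. \<forall>p\<in>chart_image c. \<forall>X Y Z. ext_deriv2 (kaehler_form_comp A h c) p X Y Z = 0)"

definition flat :: "'m cchart set \<Rightarrow> 'm metric \<Rightarrow> bool"
  where "flat A h \<longleftrightarrow>
    (\<forall>c\<in>A. \<forall>p\<in>chart_image c. \<forall>X Y Z. curvature (metric_comp A h c) p X Y Z = 0)"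

definition einstein :: "'m cchart set \<Rightarrow> 'm metric \<Rightarrow> bool"
  where "einstein A h \<longleftrightarrow>
    (\<forall>c\<in>A. \<forall>p\<in>chart_image c. \<forall>Y Z. tracefree_ricci (metric_comp A h c) p Y Z = 0)"

definition has_scalar_curvature :: "'m cchart set \<Rightarrow> 'm metric \<Rightarrow> real \<Rightarrow> bool"
  where "has_scalar_curvature A h s \<longleftrightarrow>
    (\<forall>c\<in>A. \<forall>p\<in>chart_image c. scalar_curv (metric_comp A h c) p = s)"

text \<open>\<open>W\<^sup>- = 0\<close>: the Weyl operator vanishes on anti-self-dual 2-forms.\<close>

definition self_dual :: "'m cchart set \<Rightarrow> 'm metric \<Rightarrow> bool"
  where "self_dual A h \<longleftrightarrow>
    (\<forall>c\<in>A. \<forall>p\<in>chart_image c. \<forall>e \<alpha>.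
       orthonormal4 (metric_comp A h c p) e \<longrightarrow>
       anti_self_dual_form (metric_comp A h c p) (kaehler_form_comp A h c p) \<alpha> \<longrightarrow>
       (\<forall>Z V. curv_operator e (weyl4 (metric_comp A h c) p) \<alpha> Z V = 0))"


section \<open>Unitary frames\<close>

type_synonym 'm frame = "'m \<times> (('m tvec)^2)"

text \<open>\<open>(e\<^sub>1 - \<i> J e\<^sub>1)/\<surd>2\<close> has \<open>\<surd>2\<close> times the components of \<open>e\<^sub>1\<close>, by the conventions
  for \<open>tvec\<close>; hence \<open>e\<^sub>1\<close> and \<open>e\<^sub>3\<close> have the components of \<open>u\<^sub>1/\<surd>2\<close> and \<open>u\<^sub>2/\<surd>2\<close>.\<close>

definition real_frame :: "('m tvec)^2 \<Rightarrow> nat \<Rightarrow> 'm tvec"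
  where "real_frame u i =
    (if i = 1 then tvec_scale (of_real (1 / sqrt 2)) (u $ 1)
     else if i = 2 then tvec_scale (\<i> * of_real (1 / sqrt 2)) (u $ 1)
     else if i = 3 then tvec_scale (of_real (1 / sqrt 2)) (u $ 2)
     else tvec_scale (\<i> * of_real (1 / sqrt 2)) (u $ 2))"

definition unitary_frames :: "'m cchart set \<Rightarrow> 'm metric \<Rightarrow> 'm frame set"
  where "unitary_frames A h = {(x, u). x \<in> surface_points A \<and>
    (\<forall>a. u $ a \<in> tangent_space A x) \<and> orthonormal4 (h x) (real_frame u)}"

text \<open>A chart \<open>c\<close> identifies frames with elements of \<open>complex^2 \<times> complex^2^2\<close>: the base point
  and the components of the two vectors. The forms on the frame bundle are written at a frame
  \<open>q = (p, a)\<close> on a tangent vector \<open>X = (\<xi>, \<eta>)\<close> in these coordinates.\<close>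

definition frame_coords :: "'m cchart \<Rightarrow> 'm frame \<Rightarrow> (complex^2) \<times> (complex^2^2)"
  where "frame_coords c q = (chart_map c (fst q), (\<chi> b. (snd q $ b) c))"

definition frame_coeff :: "complex^2^2 \<Rightarrow> complex^2 \<Rightarrow> complex^2"
  where "frame_coeff a v = (THE k. v = (\<Sum>b\<in>UNIV. (k $ b) *s (a $ b)))"

definition canonical_form ::
  "(complex^2) \<times> (complex^2^2) \<Rightarrow> (complex^2) \<times> (complex^2^2) \<Rightarrow> complex^2"
  where "canonical_form q X = frame_coeff (snd q) (fst X)"

text \<open>\<open>D\<^sub>X Y = (\<nabla>\<^sub>X Y - J \<nabla>\<^sub>X (J Y))/2 = dir_deriv Y p X + lichnerowicz g p X (Y p)\<close>.\<close>

definition lichnerowicz ::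
  "(complex^2 \<Rightarrow> complex^2 \<Rightarrow> complex^2 \<Rightarrow> real) \<Rightarrow> complex^2 \<Rightarrow> complex^2 \<Rightarrow> complex^2 \<Rightarrow> complex^2"
  where "lichnerowicz g p X Y =
    (1/2) *\<^sub>R (christoffel g p X Y - \<i> *s christoffel g p X (\<i> *s Y))"

text \<open>\<open>connection_form \<Gamma> q X $ a $ b\<close> is \<open>\<phi>\<^sup>a\<^sub>b\<close>, defined by \<open>D u\<^sub>b = \<Sum>\<^sub>a \<phi>\<^sup>a\<^sub>b u\<^sub>a\<close>, for the
  connection \<open>D = d + \<Gamma>\<close> on \<open>T\<^sup>1\<^sup>,\<^sup>0M\<close>.\<close>

definition connection_form ::
  "(complex^2 \<Rightarrow> complex^2 \<Rightarrow> complex^2 \<Rightarrow> complex^2) \<Rightarrow>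
    (complex^2) \<times> (complex^2^2) \<Rightarrow> (complex^2) \<times> (complex^2^2) \<Rightarrow> complex^2^2"
  where "connection_form \<Gamma> q X =
    (\<chi> a b. frame_coeff (snd q) (snd X $ b + \<Gamma> (fst q) (fst X) (snd q $ b)) $ a)"


section \<open>The twistor space\<close>

type_synonym 'm zpoint = "'m \<times> 'm tvec set"

definition complex_line :: "'m tvec \<Rightarrow> 'm tvec set"
  where "complex_line v = {tvec_scale k v |k. True}"

definition twistor_space :: "'m cchart set \<Rightarrow> 'm zpoint set"
  where "twistor_space A = {(x, complex_line v) |x v.
    x \<in> surface_points A \<and> v \<in> tangent_space A x \<and> v \<noteq> (\<lambda>c. 0)}"

definition twistor_proj :: "'m frame \<Rightarrow> 'm zpoint"
  where "twistor_proj q = (fst q, complex_line (snd q $ 1))"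

text \<open>Over the domain of a chart \<open>c\<close>, the two affine charts of the projective line give charts of
  the twistor space: \<open>(x, \<ell>) \<mapsto> (c x, t)\<close>, where \<open>\<ell>\<close> is spanned by \<open>(1,t)\<close> or \<open>(t,1)\<close>.\<close>

definition affine_vec :: "2 \<Rightarrow> complex \<Rightarrow> complex^2"
  where "affine_vec i t = (\<chi> j. if j = i then 1 else t)"

definition twistor_chart ::
  "'m cchart set \<Rightarrow> 'm cchart \<Rightarrow> 2 \<Rightarrow> ('m zpoint, (complex^2) \<times> complex) chart"
  where "twistor_chart A c i =
    ({z \<in> twistor_space A. fst z \<in> chart_dom c \<and> (\<exists>v\<in>snd z. v c $ i \<noteq> 0)},
     \<lambda>z. (chart_map c (fst z), THE t. \<exists>v\<in>snd z. v c = affine_vec i t))"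

text \<open>\<open>u\<close> is a smooth section of \<open>\<pi>\<^sub>1 : Q \<rightarrow> Z\<close> over an open subset of the domain of a twistor
  chart, \<open>W\<close> being the image of that subset in the chart.\<close>

definition local_section ::
  "'m cchart set \<Rightarrow> 'm metric \<Rightarrow> 'm cchart \<Rightarrow> 2 \<Rightarrow> ((complex^2) \<times> complex) set \<Rightarrow>
    ('m zpoint \<Rightarrow> 'm frame) \<Rightarrow> bool"
  where "local_section A h c i W u \<longleftrightarrow>
    open W \<and> W \<subseteq> chart_image (twistor_chart A c i) \<and>
    (\<forall>z\<in>chart_inv (twistor_chart A c i) ` W. u z \<in> unitary_frames A h \<and> twistor_proj (u z) = z) \<and>
    smooth_on W (frame_coords c \<circ> u \<circ> chart_inv (twistor_chart A c i))"

text \<open>The pull-backs \<open>u\<^sup>*\<phi>\<^sup>1\<close>, \<open>u\<^sup>*\<phi>\<^sup>2\<close>, \<open>u\<^sup>*\<phi>\<^sup>3\<close> with \<open>\<phi>\<^sup>3 = \<phi>\<^sup>1\<^sub>2\<close>, for the Lichnerowicz connection,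
  at the point \<open>w\<close> of a twistor chart.\<close>

definition pulled_back_forms ::
  "'m cchart set \<Rightarrow> 'm metric \<Rightarrow> 'm cchart \<Rightarrow> 2 \<Rightarrow> ('m zpoint \<Rightarrow> 'm frame) \<Rightarrow>
    (complex^2) \<times> complex \<Rightarrow> nat \<Rightarrow> (complex^2) \<times> complex \<Rightarrow> complex"
  where "pulled_back_forms A h c i u w k X =
    (let \<sigma> = frame_coords c \<circ> u \<circ> chart_inv (twistor_chart A c i);
         q = \<sigma> w; Y = dir_deriv \<sigma> w X
     in if k = 1 then canonical_form q Y $ 1
        else if k = 2 then canonical_form q Y $ 2
        else connection_form (lichnerowicz (metric_comp A h c)) q Y $ 1 $ 2)"

text \<open>\<open>fundamental_expr n \<lambda> \<phi>\<close> is \<open>\<K>\<^sub>n(\<lambda>)\<close> in terms of \<open>\<phi>\<^sup>1, \<phi>\<^sup>2, \<phi>\<^sup>3\<close> (for \<open>1 \<le> n \<le> 4\<close>).\<close>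

definition fundamental_expr ::
  "nat \<Rightarrow> real \<Rightarrow> (nat \<Rightarrow> 'a \<Rightarrow> complex) \<Rightarrow> 'a \<Rightarrow> 'a \<Rightarrow> complex"
  where "fundamental_expr n lam \<phi> X Y =
    (let hol = (\<lambda>k. wedge (\<phi> k) (conj_form (\<phi> k)) X Y);
         anti = (\<lambda>k. wedge (conj_form (\<phi> k)) (\<phi> k) X Y);
         l = complex_of_real (lam\<^sup>2)
     in if n = 1 then \<i> * (hol 1 + anti 2 + l * hol 3)
        else if n = 2 then \<i> * (hol 1 + anti 2 + l * anti 3)
        else if n = 3 then \<i> * (hol 1 + hol 2 + l * hol 3)
        else \<i> * (hol 1 + hol 2 + l * anti 3))"

text \<open>The form \<open>\<K>\<^sub>n\<^sup>L(\<lambda>)\<close> on the twistor space, in the chart \<open>twistor_chart A c i\<close>: its value is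
  the one obtained from any local section \<open>u\<close> around \<open>w\<close>.\<close>

definition K_form ::
  "'m cchart set \<Rightarrow> 'm metric \<Rightarrow> nat \<Rightarrow> real \<Rightarrow> 'm cchart \<Rightarrow> 2 \<Rightarrow>
    (complex^2) \<times> complex \<Rightarrow> (complex^2) \<times> complex \<Rightarrow> (complex^2) \<times> complex \<Rightarrow> complex"
  where "K_form A h n lam c i w X Y =
    (THE k. \<exists>W u. local_section A h c i W u \<and> w \<in> W \<and>
       k = fundamental_expr n lam (pulled_back_forms A h c i u w) X Y)"

definition K_closed :: "'m cchart set \<Rightarrow> 'm metric \<Rightarrow> nat \<Rightarrow> real \<Rightarrow> bool"
  where "K_closed A h n lam \<longleftrightarrow>
    (\<forall>c\<in>A. \<forall>i. \<forall>w\<in>chart_image (twistor_chart A c i). \<forall>X Y Z.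
       ext_deriv2 (K_form A h n lam c i) w X Y Z = 0)"

end

theory Submission
  imports Defs
begin

text \<open>Let \<open>H\<close> be the Hermitian form of the metric \<open>h\<close>, \<open>D\<close> the Lichnerowicz connection, \<open>\<Omega>\<close> its
  curvature, and \<open>v\<close> a local holomorphic section of the tautological line bundle over the fibres
  of the twistor space, so that a point of the twistor space is the line spanned by \<open>v\<close>; put
  \<open>N = H(v,v)\<close>.

  \<^bold>\<open>The forms without frames.\<close> If \<open>(u\<^sub>1, u\<^sub>2)\<close> is a unitary frame with \<open>u\<^sub>1\<close> in the line of \<open>v\<close>, then
  \<open>\<phi>\<^sup>1\<close> and \<open>\<phi>\<^sup>2\<close> are the components of a vector along the line and orthogonal to it, and
  differentiating \<open>H(u\<^sub>2, u\<^sub>1) = 0\<close> expresses \<open>\<phi>\<^sup>3 = \<phi>\<^sup>1\<^sub>2\<close> by the component of \<open>Dv\<close> orthogonal to \<open>v\<close>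
  (\<open>unitary_section_forms\<close>). Hence the four forms \<open>\<K>\<^sub>n\<close> are combinations of the fundamental form
  \<open>F\<close>, of the form \<open>\<phi>\<^sup>1 \<and> \<phi>\<^sup>1\<close>-conjugate, which only involves \<open>H(X,v) H(v,Y) / N\<close>, and of the
  Fubini-Study form of the fibres extended by \<open>D\<close>; they are well defined because smooth unitary
  frames along the twistor space exist (\<open>K_form_eq\<close>).

  \<^bold>\<open>Removing the vertical part.\<close> The form \<open>\<kappa> = H(Dv,v) / N\<close> is the connection form of the
  tautological line bundle. Its exterior derivative is \<open>H(\<Omega> v,v) / N\<close> minus the Fubini-Study
  form (\<open>taut_connection_curvature\<close>). Modulo an exact form, \<open>\<K>\<^sub>n\<close> therefore has no vertical
  legs: up to a factor, its value on \<open>X, Y\<close> is \<open>H(T(X,Y)v,v) / N\<close> plus a multiple of \<open>F(X,Y)\<close>, where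
  \<open>T(X,Y)\<close> is a combination of \<open>\<Omega>(X,Y)\<close> and, for \<open>n = 1, 2\<close>, of the endomorphism
  \<open>v \<mapsto> H(v,Y)X - H(v,X)Y\<close>. A closed form without vertical legs is constant along the fibres,
  which means that all \<open>T(X,Y)\<close> are scalar. In that case the form is the pull-back of a form on the
  surface: a multiple of the trace of \<open>\<Omega>\<close>, which is closed as the curvature of a line bundle, plus
  a multiple of \<open>F\<close>, which is zero for \<open>n = 1, 2\<close> and not for \<open>n = 3, 4\<close>
  (\<open>twistor_form_closed_iff\<close>).

  \<^bold>\<open>Curvature.\<close> The Lichnerowicz and Levi-Civita connections differ by skew antilinear
  endomorphisms, and in complex dimension two a product of two of these is scalar. So the trace-free
  part of \<open>\<Omega>\<close> is the anti-self-dual part of the Riemannian curvature (\<open>R_lin_lichnerowicz\<close>). For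
  \<open>n = 1, 2\<close> the condition on \<open>T\<close> says that this part is the one of a space of constant curvature
  \<open>\<plusminus>2 / \<lambda>\<^sup>2\<close>; as this half of the curvature operator is made of the trace-free Ricci tensor and of
  \<open>W\<^sup>- + s/12\<close>, the claim follows (\<open>asd_curvature_iff\<close>, \<open>obstruction_scalar_iff\<close>). For \<open>n = 3, 4\<close> the
  conditions are that \<open>F\<close> is closed and \<open>\<Omega>\<close> is scalar. Then \<open>\<Omega>\<close> is the Riemannian curvature, and a
  Riemannian curvature tensor with scalar values vanishes by the Bianchi identity
  (\<open>eq_0_if_scalar\<close>, \<open>kaehler_obstruction_iff_flat\<close>).\<close>

section \<open>Directional derivatives and smooth functions\<close>

lemma dir_deriv_eqI: "(f has_derivative f') (at p) \<Longrightarrow> dir_deriv f p v = f' v"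
  using frechet_derivative_at by metis

lemma dir_deriv_cong:
  assumes "open S" "p \<in> S" "\<And>q. q \<in> S \<Longrightarrow> f q = g q"
  shows "dir_deriv f p v = dir_deriv g p v"
proof -
  have "(f has_derivative F) (at p) \<longleftrightarrow> (g has_derivative F) (at p)" for F
    using has_derivative_transform_within_open[OF _ assms(1,2)] assms(3) by metis
  then show ?thesis
    unfolding frechet_derivative_def by simp
qed

lemma differentiable_cong_open:
  assumes "open S" "p \<in> S" "\<And>q. q \<in> S \<Longrightarrow> f q = g q"
  shows "f differentiable (at p) \<longleftrightarrow> g differentiable (at p)"
  unfolding differentiable_def
  using has_derivative_transform_within_open[OF _ assms(1,2)] assms(3) by metis

lemma differentiable_imp_dir_deriv:
  "f differentiable (at p) \<Longrightarrow> (f has_derivative dir_deriv f p) (at p)"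
  using frechet_derivative_works by blast

lemma dir_deriv_add:
  "f differentiable (at p) \<Longrightarrow> g differentiable (at p) \<Longrightarrow>
   dir_deriv (\<lambda>q. f q + g q) p v = dir_deriv f p v + dir_deriv g p v"
  by (rule dir_deriv_eqI) (intro has_derivative_add differentiable_imp_dir_deriv)

lemma dir_deriv_diff:
  "f differentiable (at p) \<Longrightarrow> g differentiable (at p) \<Longrightarrow>
   dir_deriv (\<lambda>q. f q - g q) p v = dir_deriv f p v - dir_deriv g p v"
  by (rule dir_deriv_eqI) (intro has_derivative_diff differentiable_imp_dir_deriv)

lemma dir_deriv_bounded_linear:
  "bounded_linear L \<Longrightarrow> f differentiable (at p) \<Longrightarrow> dir_deriv (\<lambda>q. L (f q)) p v = L (dir_deriv f p v)"
  by (rule dir_deriv_eqI[OF bounded_linear.has_derivative[OF _ differentiable_imp_dir_deriv]])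

lemma differentiable_bounded_linear:
  "bounded_linear L \<Longrightarrow> f differentiable (at p) \<Longrightarrow> (\<lambda>q. L (f q)) differentiable (at p)"
  using bounded_linear.has_derivative[of L f] unfolding differentiable_def by blast

lemma dir_deriv_compose_linear:
  assumes "bounded_linear L" "f differentiable (at (L w))"
  shows "dir_deriv (\<lambda>w. f (L w)) w v = dir_deriv f (L w) (L v)"
  by (rule dir_deriv_eqI)
     (rule has_derivative_compose[OF bounded_linear_imp_has_derivative[OF assms(1)]
        differentiable_imp_dir_deriv[OF assms(2)]])

lemma differentiable_compose_linear:
  assumes "bounded_linear L" "f differentiable (at (L w))"
  shows "(\<lambda>w. f (L w)) differentiable (at w)"
  using has_derivative_compose[OF bounded_linear_imp_has_derivative[OF assms(1)]
        differentiable_imp_dir_deriv[OF assms(2)]] unfolding differentiable_def by blast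

lemma linear_dir_deriv: "f differentiable (at p) \<Longrightarrow> linear (dir_deriv f p)"
  using linear_frechet_derivative by blast

lemma dir_deriv_vec_add:
  "f differentiable (at p) \<Longrightarrow> dir_deriv f p (v + w) = dir_deriv f p v + dir_deriv f p w"
  using linear_dir_deriv linear_add by blast

lemma dir_deriv_vec_scale:
  "f differentiable (at p) \<Longrightarrow> dir_deriv f p (r *\<^sub>R v) = r *\<^sub>R dir_deriv f p v"
  using linear_dir_deriv linear_scale by blast

lemma bilinear_expansion:
  fixes B :: "'a::euclidean_space \<Rightarrow> 'b::euclidean_space \<Rightarrow> 'c::real_vector"
  assumes "bilinear B"
  shows "B x y = (\<Sum>i\<in>Basis. \<Sum>j\<in>Basis. ((x \<bullet> i) * (y \<bullet> j)) *\<^sub>R B i j)"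
proof -
  have "B x y = B (\<Sum>i\<in>Basis. (x \<bullet> i) *\<^sub>R i) (\<Sum>j\<in>Basis. (y \<bullet> j) *\<^sub>R j)"
    by (simp add: euclidean_representation)
  also have "\<dots> = (\<Sum>(i, j)\<in>Basis \<times> Basis. B ((x \<bullet> i) *\<^sub>R i) ((y \<bullet> j) *\<^sub>R j))"
    by (rule bilinear_sum[OF assms])
  also have "\<dots> = (\<Sum>i\<in>Basis. \<Sum>j\<in>Basis. ((x \<bullet> i) * (y \<bullet> j)) *\<^sub>R B i j)"
    by (simp add: sum.cartesian_product[symmetric] bilinear_lmul[OF assms] bilinear_rmul[OF assms]
        mult.commute)
  finally show ?thesis .
qed

text \<open>The product rule for a bilinear map that itself varies with the point.\<close>

lemma has_derivative_bilinear_field: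
  fixes B :: "'w::real_normed_vector \<Rightarrow> 'a::euclidean_space \<Rightarrow> 'b::euclidean_space \<Rightarrow> 'c::real_normed_vector"
  assumes S: "open S" "w \<in> S" and bil: "\<And>x. x \<in> S \<Longrightarrow> bilinear (B x)"
    and dB: "\<And>i j. (\<lambda>x. B x i j) differentiable (at w)"
    and a: "a differentiable (at w)" and b: "b differentiable (at w)"
  shows "((\<lambda>x. B x (a x) (b x)) has_derivative
    (\<lambda>v. dir_deriv (\<lambda>x. B x (a w) (b w)) w v + B w (dir_deriv a w v) (b w) + B w (a w) (dir_deriv b w v))) (at w)"
proof -
  have expand: "((\<lambda>x. B x (a x) (b x)) has_derivative
     (\<lambda>v. \<Sum>i\<in>Basis. \<Sum>j\<in>Basis. ((a w \<bullet> i) * (b w \<bullet> j)) *\<^sub>R dir_deriv (\<lambda>x. B x i j) w v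
        + ((a w \<bullet> i) * (b' v \<bullet> j) + (a' v \<bullet> i) * (b w \<bullet> j)) *\<^sub>R B w i j)) (at w)"
    if "(a has_derivative a') (at w)" "(b has_derivative b') (at w)" for a b a' b'
  proof (rule has_derivative_transform_within_open[OF _ S])
    show "((\<lambda>x. \<Sum>i\<in>Basis. \<Sum>j\<in>Basis. ((a x \<bullet> i) * (b x \<bullet> j)) *\<^sub>R B x i j) has_derivative
     (\<lambda>v. \<Sum>i\<in>Basis. \<Sum>j\<in>Basis. ((a w \<bullet> i) * (b w \<bullet> j)) *\<^sub>R dir_deriv (\<lambda>x. B x i j) w v
        + ((a w \<bullet> i) * (b' v \<bullet> j) + (a' v \<bullet> i) * (b w \<bullet> j)) *\<^sub>R B w i j)) (at w)"
      by (intro has_derivative_sum has_derivative_scaleR has_derivative_mult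
          has_derivative_inner_left that differentiable_imp_dir_deriv dB)
    show "(\<Sum>i\<in>Basis. \<Sum>j\<in>Basis. ((a x \<bullet> i) * (b x \<bullet> j)) *\<^sub>R B x i j) = B x (a x) (b x)" if "x \<in> S" for x
      by (rule bilinear_expansion[OF bil[OF that], symmetric])
  qed
  have 1: "dir_deriv (\<lambda>x. B x (a w) (b w)) w v =
      (\<Sum>i\<in>Basis. \<Sum>j\<in>Basis. ((a w \<bullet> i) * (b w \<bullet> j)) *\<^sub>R dir_deriv (\<lambda>x. B x i j) w v)" for v
    using dir_deriv_eqI[OF expand[OF has_derivative_const[of "a w"] has_derivative_const[of "b w"]]]
    by (simp only: inner_zero_left mult_zero_left mult_zero_right add_0 scaleR_zero_left add_0_right)
  have 2: "B w (dir_deriv a w v) (b w) + B w (a w) (dir_deriv b w v) = (\<Sum>i\<in>Basis. \<Sum>j\<in>Basis.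
      ((a w \<bullet> i) * (dir_deriv b w v \<bullet> j) + (dir_deriv a w v \<bullet> i) * (b w \<bullet> j)) *\<^sub>R B w i j)" for v
    unfolding bilinear_expansion[OF bil[OF S(2)], of "dir_deriv a w v" "b w"]
      bilinear_expansion[OF bil[OF S(2)], of "a w" "dir_deriv b w v"] sum.distrib[symmetric]
    by (simp only: scaleR_add_left add.commute)
  show ?thesis
    using expand[OF a[THEN differentiable_imp_dir_deriv] b[THEN differentiable_imp_dir_deriv]]
    unfolding add.assoc 1 2 by (simp only: sum.distrib)
qed

lemmas dir_deriv_bilinear_field = dir_deriv_eqI[OF has_derivative_bilinear_field]

lemma Ck_on_cong:
  assumes "open S" "\<And>x. x \<in> S \<Longrightarrow> f x = g x"
  shows "Ck_on k f S \<longleftrightarrow> Ck_on k g S"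
  using assms(2)
proof (induction k arbitrary: f g)
  case 0
  then show ?case using continuous_on_cong by force
next
  case (Suc k)
  have "Ck_on k (\<lambda>p. dir_deriv f p v) S = Ck_on k (\<lambda>p. dir_deriv g p v) S" for v
    by (rule Suc.IH) (rule dir_deriv_cong[OF assms(1)], use Suc.prems in auto)
  moreover have "f differentiable (at p) \<longleftrightarrow> g differentiable (at p)" if "p \<in> S" for p
    using differentiable_cong_open[OF assms(1) that] Suc.prems by blast
  ultimately show ?case by simp
qed

lemma Ck_on_SucD: "Ck_on (Suc k) f S \<Longrightarrow> Ck_on k f S"
proof (induction k arbitrary: f)
  case 0
  then show ?case
    by (auto intro!: differentiable_imp_continuous_on simp: differentiable_on_def differentiable_at_withinI)
qed auto

lemma smooth_on_cong:
  assumes "open S" "\<And>x. x \<in> S \<Longrightarrow> f x = g x"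
  shows "smooth_on S f \<longleftrightarrow> smooth_on S g"
  using Ck_on_cong[of S f g, OF assms] by (simp add: smooth_on_def)

lemma smooth_on_differentiable: "smooth_on S f \<Longrightarrow> p \<in> S \<Longrightarrow> f differentiable (at p)"
  unfolding smooth_on_def by (metis Ck_on.simps(2))

lemma smooth_on_dir_deriv: "smooth_on S f \<Longrightarrow> smooth_on S (\<lambda>p. dir_deriv f p v)"
  unfolding smooth_on_def by (metis Ck_on.simps(2))

lemma smooth_on_continuous: "smooth_on S f \<Longrightarrow> continuous_on S f"
  unfolding smooth_on_def by (metis Ck_on.simps(1))

lemma Ck_on_const: "Ck_on k (\<lambda>x. c) S"
  by (induction k arbitrary: c) auto

lemma smooth_on_const: "smooth_on S (\<lambda>x. c)"
  by (simp add: smooth_on_def Ck_on_const)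

lemma smooth_on_linear:
  assumes "bounded_linear L" shows "smooth_on S L"
  unfolding smooth_on_def
proof
  have "dir_deriv L p v = L v" for p v
    by (rule dir_deriv_eqI[OF bounded_linear_imp_has_derivative[OF assms]])
  then show "Ck_on k L S" for k
    using assms by (cases k)
      (auto intro: Ck_on_const linear_continuous_on bounded_linear_imp_differentiable)
qed

lemma Ck_on_add:
  assumes "open S"
  shows "Ck_on k f S \<Longrightarrow> Ck_on k g S \<Longrightarrow> Ck_on k (\<lambda>x. f x + g x) S"
proof (induction k arbitrary: f g)
  case (Suc k)
  have "Ck_on k (\<lambda>p. dir_deriv (\<lambda>x. f x + g x) p v) S" for v
    using Suc by (subst Ck_on_cong[OF assms dir_deriv_add]) auto
  then show ?case using Suc.prems by simp
qed (simp add: continuous_on_add)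

lemma smooth_on_add:
  "open S \<Longrightarrow> smooth_on S f \<Longrightarrow> smooth_on S g \<Longrightarrow> smooth_on S (\<lambda>x. f x + g x)"
  by (simp add: smooth_on_def Ck_on_add)

lemma smooth_on_sum:
  assumes "open S" "\<And>i. i \<in> I \<Longrightarrow> smooth_on S (f i)"
  shows "smooth_on S (\<lambda>x. \<Sum>i\<in>I. f i x)"
  using assms(2)
proof (induction I rule: infinite_finite_induct)
  case (insert i I)
  then show ?case using smooth_on_add[OF assms(1), of "f i" "\<lambda>x. \<Sum>i\<in>I. f i x"] by simp
qed (auto intro: smooth_on_const)

lemma Ck_on_bounded_linear:
  assumes "open S" "bounded_linear L"
  shows "Ck_on k f S \<Longrightarrow> Ck_on k (\<lambda>x. L (f x)) S"
proof (induction k arbitrary: f)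
  case 0
  then show ?case using bounded_linear.continuous_on[OF assms(2), of S f] by simp
next
  case (Suc k)
  have "Ck_on k (\<lambda>p. dir_deriv (\<lambda>x. L (f x)) p v) S" for v
    using Suc by (subst Ck_on_cong[OF assms(1) dir_deriv_bounded_linear[OF assms(2)]]) auto
  moreover have "(\<lambda>x. L (f x)) differentiable (at p)" if "p \<in> S" for p
    using differentiable_bounded_linear[OF assms(2)] Suc.prems that by auto
  ultimately show ?case by simp
qed

lemma smooth_on_bounded_linear:
  assumes "open S" "bounded_linear L" "smooth_on S f"
  shows "smooth_on S (\<lambda>x. L (f x))"
  unfolding smooth_on_def
  by (rule allI, rule Ck_on_bounded_linear[OF assms(1,2)]) (use assms(3) in \<open>simp add: smooth_on_def\<close>)

lemma smooth_on_diff: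
  assumes "open S" "smooth_on S f" "smooth_on S g"
  shows "smooth_on S (\<lambda>x. f x - g x)"
proof -
  have "smooth_on S (\<lambda>x. - g x)"
    by (rule smooth_on_bounded_linear[OF assms(1) bounded_linear_minus[OF bounded_linear_ident] assms(3)])
  from smooth_on_add[OF assms(1,2) this] show ?thesis by simp
qed

lemma Ck_on_bounded_bilinear:
  assumes "open S" "bounded_bilinear P"
  shows "Ck_on k f S \<Longrightarrow> Ck_on k g S \<Longrightarrow> Ck_on k (\<lambda>x. P (f x) (g x)) S"
proof (induction k arbitrary: f g)
  case 0
  then show ?case using bounded_bilinear.continuous_on[OF assms(2), of S f g] by simp
next
  case (Suc k)
  have d: "((\<lambda>x. P (f x) (g x)) has_derivative (\<lambda>v. P (f p) (dir_deriv g p v) + P (dir_deriv f p v) (g p))) (at p)"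
    if "p \<in> S" for p
  proof (rule bounded_bilinear.FDERIV[OF assms(2)])
    show "(f has_derivative dir_deriv f p) (at p)" "(g has_derivative dir_deriv g p) (at p)"
      using Suc.prems that by (auto intro: differentiable_imp_dir_deriv)
  qed
  have "Ck_on k (\<lambda>p. P (f p) (dir_deriv g p v) + P (dir_deriv f p v) (g p)) S" for v
  proof (rule Ck_on_add[OF assms(1)])
    show "Ck_on k (\<lambda>p. P (f p) (dir_deriv g p v)) S"
      using Suc.prems by (intro Suc.IH[OF Ck_on_SucD[OF Suc.prems(1)]]) simp
    show "Ck_on k (\<lambda>p. P (dir_deriv f p v) (g p)) S"
      using Suc.prems by (intro Suc.IH[OF _ Ck_on_SucD[OF Suc.prems(2)]]) simp
  qed
  then have "Ck_on k (\<lambda>p. dir_deriv (\<lambda>x. P (f x) (g x)) p v) S" for v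
    using dir_deriv_eqI[OF d] by (subst Ck_on_cong[OF assms(1)]) auto
  then show ?case using d by (auto simp: differentiable_def)
qed

lemma smooth_on_mult:
  fixes f g :: "'a::real_normed_vector \<Rightarrow> 'b::real_normed_algebra"
  assumes "open S" "smooth_on S f" "smooth_on S g"
  shows "smooth_on S (\<lambda>x. f x * g x)"
  unfolding smooth_on_def
  by (rule allI, rule Ck_on_bounded_bilinear[OF assms(1) bounded_bilinear_mult])
     (use assms(2,3) in \<open>simp_all add: smooth_on_def\<close>)

lemma smooth_on_scaleR:
  assumes "open S" "smooth_on S f" "smooth_on S g"
  shows "smooth_on S (\<lambda>x. f x *\<^sub>R g x)"
  unfolding smooth_on_def
  by (rule allI, rule Ck_on_bounded_bilinear[OF assms(1) bounded_bilinear_scaleR])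
     (use assms(2,3) in \<open>simp_all add: smooth_on_def\<close>)

text \<open>The derivative of \<open>f powr r\<close> contains \<open>f powr (r - 1)\<close>, so the induction on the order of
  differentiability runs over all exponents simultaneously.\<close>

lemma Ck_on_powr:
  fixes f :: "'a::real_normed_vector \<Rightarrow> real"
  assumes S: "open S" and pos: "\<And>x. x \<in> S \<Longrightarrow> f x > 0"
  shows "Ck_on k f S \<Longrightarrow> Ck_on k (\<lambda>x. f x powr r) S"
proof (induction k arbitrary: r)
  case 0
  then show ?case using pos by (auto intro!: continuous_intros simp: less_imp_neq[OF pos, symmetric])
next
  case (Suc k)
  have d: "((\<lambda>x. f x powr r) has_derivative (\<lambda>v. r * f p powr (r - 1) * dir_deriv f p v)) (at p)"
    if "p \<in> S" for p
  proof -
    have "((\<lambda>y. y powr r) has_field_derivative r * f p powr (r - 1)) (at (f p))"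
      using has_real_derivative_powr[of "f p" r] pos[OF that] by simp
    then show ?thesis
      using has_derivative_compose[of f "dir_deriv f p" p UNIV "\<lambda>y. y powr r"]
        differentiable_imp_dir_deriv[of f p] Suc.prems that
      by (simp add: has_field_derivative_def)
  qed
  have "Ck_on k (\<lambda>p. (r * f p powr (r - 1)) * dir_deriv f p v) S" for v
  proof (intro Ck_on_bounded_bilinear[OF S bounded_bilinear_mult] Ck_on_const)
    show "Ck_on k (\<lambda>p. f p powr (r - 1)) S"
      by (rule Suc.IH[OF Ck_on_SucD[OF Suc.prems]])
    show "Ck_on k (\<lambda>p. dir_deriv f p v) S" using Suc.prems by simp
  qed
  then have "Ck_on k (\<lambda>p. dir_deriv (\<lambda>x. f x powr r) p v) S" for v
    using dir_deriv_eqI[OF d] by (subst Ck_on_cong[OF S]) auto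
  then show ?case using d by (auto simp: differentiable_def)
qed

lemma smooth_on_powr:
  fixes f :: "'a::real_normed_vector \<Rightarrow> real"
  assumes "open S" "smooth_on S f" "\<And>x. x \<in> S \<Longrightarrow> f x > 0"
  shows "smooth_on S (\<lambda>x. f x powr r)"
  using assms by (simp add: smooth_on_def Ck_on_powr)

lemma smooth_on_inverse_real:
  fixes f :: "'a::real_normed_vector \<Rightarrow> real"
  assumes "open S" "smooth_on S f" "\<And>x. x \<in> S \<Longrightarrow> f x > 0"
  shows "smooth_on S (\<lambda>x. inverse (f x))"
proof -
  have "inverse (f x) = f x powr (-1)" if "x \<in> S" for x
    using assms(3)[OF that] by (simp add: powr_minus)
  then show ?thesis
    using smooth_on_powr[OF assms, of "-1"] by (subst smooth_on_cong[OF assms(1)]) auto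
qed

lemma Ck_on_compose_linear:
  assumes L: "bounded_linear L" and S': "open S'" "\<And>x. x \<in> S' \<Longrightarrow> L x \<in> S"
  shows "Ck_on k f S \<Longrightarrow> Ck_on k (\<lambda>x. f (L x)) S'"
proof (induction k arbitrary: f)
  case 0
  then show ?case
    using continuous_on_compose2[OF _ linear_continuous_on[OF L], of S f S'] S'(2) by auto
next
  case (Suc k)
  have "Ck_on k (\<lambda>p. dir_deriv (\<lambda>x. f (L x)) p v) S'" for v
    using Suc S'(2) by (subst Ck_on_cong[OF S'(1) dir_deriv_compose_linear[OF L]]) auto
  moreover have "(\<lambda>x. f (L x)) differentiable (at p)" if "p \<in> S'" for p
    using differentiable_compose_linear[OF L, of f p] S'(2)[OF that] Suc.prems by simp
  ultimately show ?case by simp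
qed

lemma smooth_on_compose_linear:
  assumes "bounded_linear L" "open S'" "\<And>x. x \<in> S' \<Longrightarrow> L x \<in> S" "smooth_on S f"
  shows "smooth_on S' (\<lambda>x. f (L x))"
  unfolding smooth_on_def
  by (rule allI, rule Ck_on_compose_linear[OF assms(1,2,3)]) (use assms(4) in \<open>simp_all add: smooth_on_def\<close>)

lemma smooth_on_bilinear_field:
  fixes B :: "'w::real_normed_vector \<Rightarrow> 'a::euclidean_space \<Rightarrow> 'b::euclidean_space \<Rightarrow> 'c::real_normed_vector"
  assumes S: "open S" and bil: "\<And>x. x \<in> S \<Longrightarrow> bilinear (B x)"
    and B: "\<And>i j. smooth_on S (\<lambda>x. B x i j)"
    and a: "smooth_on S a" and b: "smooth_on S b"
  shows "smooth_on S (\<lambda>x. B x (a x) (b x))"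
proof -
  have "smooth_on S (\<lambda>x. \<Sum>i\<in>Basis. \<Sum>j\<in>Basis. ((a x \<bullet> i) * (b x \<bullet> j)) *\<^sub>R B x i j)"
    by (intro smooth_on_sum smooth_on_scaleR smooth_on_mult S B
        smooth_on_bounded_linear[OF S bounded_linear_inner_left a]
        smooth_on_bounded_linear[OF S bounded_linear_inner_left b])
  then show ?thesis
    using bilinear_expansion[OF bil] by (subst smooth_on_cong[OF S]) auto
qed

lemma has_real_derivative_along_line:
  fixes f :: "'a::real_normed_vector \<Rightarrow> real"
  assumes "f differentiable (at (p + s *\<^sub>R X))"
  shows "((\<lambda>s. f (p + s *\<^sub>R X)) has_real_derivative dir_deriv f (p + s *\<^sub>R X) X) (at s)"
proof -
  have "((\<lambda>s. p + s *\<^sub>R X) has_derivative (\<lambda>t. t *\<^sub>R X)) (at s)"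
    by (auto intro!: derivative_eq_intros)
  from has_derivative_compose[OF this differentiable_imp_dir_deriv[OF assms]]
  have "((\<lambda>s. f (p + s *\<^sub>R X)) has_derivative (\<lambda>t. dir_deriv f (p + s *\<^sub>R X) (t *\<^sub>R X))) (at s)" .
  moreover have "dir_deriv f (p + s *\<^sub>R X) (t *\<^sub>R X) = dir_deriv f (p + s *\<^sub>R X) X * t" for t
    using dir_deriv_vec_scale[OF assms] by simp
  ultimately show ?thesis unfolding has_field_derivative_def by (simp add: fun_eq_iff)
qed

text \<open>Two applications of the mean value theorem express the second difference of \<open>f\<close>, which is
  symmetric in the two directions, by an iterated derivative; this gives the symmetry of second
  derivatives in the limit.\<close>

lemma second_difference_eq:
  fixes f :: "'a::real_normed_vector \<Rightarrow> real"
  assumes f: "smooth_on (ball p r) f" and h: "h > 0" "h * (norm X + norm Y) < r"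
  shows "\<exists>q\<in>ball p r. f (p + h *\<^sub>R X + h *\<^sub>R Y) - f (p + h *\<^sub>R X) - f (p + h *\<^sub>R Y) + f p
     = h * h * dir_deriv (\<lambda>q. dir_deriv f q X) q Y"
proof -
  have inb: "p + s *\<^sub>R X + t *\<^sub>R Y \<in> ball p r" if "0 \<le> s" "s \<le> h" "0 \<le> t" "t \<le> h" for s t
  proof -
    have "norm (s *\<^sub>R X + t *\<^sub>R Y) \<le> s * norm X + t * norm Y"
      using norm_triangle_ineq[of "s *\<^sub>R X" "t *\<^sub>R Y"] that by simp
    also have "\<dots> \<le> h * norm X + h * norm Y"
      using that by (intro add_mono mult_right_mono) auto
    also have "\<dots> < r" using h(2) by (simp add: algebra_simps)
    finally have "norm (s *\<^sub>R X + t *\<^sub>R Y) < r" .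
    moreover have "dist p (p + s *\<^sub>R X + t *\<^sub>R Y) = norm (s *\<^sub>R X + t *\<^sub>R Y)"
      unfolding dist_norm norm_minus_commute[of p] by (simp add: add.assoc)
    ultimately show ?thesis by simp
  qed
  have d1: "((\<lambda>s. f (p + s *\<^sub>R X + h *\<^sub>R Y) - f (p + s *\<^sub>R X)) has_real_derivative
      dir_deriv f (p + s *\<^sub>R X + h *\<^sub>R Y) X - dir_deriv f (p + s *\<^sub>R X) X) (at s)" if "0 \<le> s" "s \<le> h" for s
  proof (rule DERIV_diff)
    have "f differentiable (at ((p + h *\<^sub>R Y) + s *\<^sub>R X))"
      using smooth_on_differentiable[OF f inb[of s h]] that h by (simp add: algebra_simps)
    from has_real_derivative_along_line[OF this]
    show "((\<lambda>s. f (p + s *\<^sub>R X + h *\<^sub>R Y)) has_real_derivative dir_deriv f (p + s *\<^sub>R X + h *\<^sub>R Y) X) (at s)"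
      by (simp add: algebra_simps)
    show "((\<lambda>s. f (p + s *\<^sub>R X)) has_real_derivative dir_deriv f (p + s *\<^sub>R X) X) (at s)"
      using smooth_on_differentiable[OF f inb[of s 0]] that h by (intro has_real_derivative_along_line) auto
  qed
  obtain s where s: "0 < s" "s < h" and
    1: "(f (p + h *\<^sub>R X + h *\<^sub>R Y) - f (p + h *\<^sub>R X)) - (f (p + 0 *\<^sub>R X + h *\<^sub>R Y) - f (p + 0 *\<^sub>R X))
      = (h - 0) * (dir_deriv f (p + s *\<^sub>R X + h *\<^sub>R Y) X - dir_deriv f (p + s *\<^sub>R X) X)"
    using MVT2[OF h(1) d1] by blast
  have "((\<lambda>t. dir_deriv f (p + s *\<^sub>R X + t *\<^sub>R Y) X) has_real_derivative
      dir_deriv (\<lambda>q. dir_deriv f q X) (p + s *\<^sub>R X + t *\<^sub>R Y) Y) (at t)" if "0 \<le> t" "t \<le> h" for t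
    using smooth_on_differentiable[OF smooth_on_dir_deriv[OF f] inb[of s t]] that s
    by (intro has_real_derivative_along_line) auto
  from MVT2[OF h(1) this] obtain t where t: "0 < t" "t < h" and
    2: "dir_deriv f (p + s *\<^sub>R X + h *\<^sub>R Y) X - dir_deriv f (p + s *\<^sub>R X + 0 *\<^sub>R Y) X
      = (h - 0) * dir_deriv (\<lambda>q. dir_deriv f q X) (p + s *\<^sub>R X + t *\<^sub>R Y) Y" by blast
  show ?thesis
    using 1 2 s t by (intro bexI[OF _ inb[of s t]]) auto
qed

text \<open>Both iterated derivatives are limits of the same second difference quotient.\<close>

lemma dir_deriv_commute_real:
  fixes f :: "'a::real_normed_vector \<Rightarrow> real"
  assumes S: "open S" "p \<in> S" and f: "smooth_on S f"
  shows "dir_deriv (\<lambda>q. dir_deriv f q X) p Y = dir_deriv (\<lambda>q. dir_deriv f q Y) p X"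
proof -
  define G where "G X Y q = dir_deriv (\<lambda>q. dir_deriv f q X) q Y" for X Y q
  have "\<bar>G X Y p - G Y X p\<bar> \<le> 2 * e" if "e > 0" for e
  proof -
    have cont: "continuous_on S (G X Y)" for X Y
      unfolding G_def by (intro smooth_on_continuous smooth_on_dir_deriv f)
    have near: "\<exists>r>0. \<forall>q\<in>ball p r. \<bar>G X Y q - G X Y p\<bar> < e" for X Y
    proof -
      have "isCont (G X Y) p" using cont S continuous_on_eq_continuous_at by blast
      then obtain d where "d > 0" "\<And>q. dist q p < d \<Longrightarrow> dist (G X Y q) (G X Y p) < e"
        using \<open>e > 0\<close> by (metis continuous_at_eps_delta)
      then show ?thesis by (intro exI[of _ d]) (auto simp: dist_commute dist_real_def)
    qed
    obtain r1 where r1: "r1 > 0" "\<And>q. q\<in>ball p r1 \<Longrightarrow> \<bar>G X Y q - G X Y p\<bar> < e" using near by blast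
    obtain r2 where r2: "r2 > 0" "\<And>q. q\<in>ball p r2 \<Longrightarrow> \<bar>G Y X q - G Y X p\<bar> < e" using near by blast
    obtain r3 where r3: "r3 > 0" "ball p r3 \<subseteq> S" using S openE by blast
    define r where "r = min r1 (min r2 r3)"
    have r: "r > 0" "r \<le> r1" "r \<le> r2" "r \<le> r3" using r1 r2 r3 by (auto simp: r_def)
    \<comment> \<open>the summand \<open>1\<close> covers the case \<open>X = Y = 0\<close>\<close>
    define h where "h = r / (norm X + norm Y + 1)"
    have n: "norm X + norm Y + 1 > 0" by (smt (verit) norm_ge_zero)
    have h: "h > 0" using r n by (simp add: h_def)
    have "h * (norm X + norm Y) < h * (norm X + norm Y + 1)" using h by simp
    then have h2: "h * (norm X + norm Y) < r" using n by (simp add: h_def)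
    have fr: "smooth_on (ball p r) f"
    proof -
      have "ball p r \<subseteq> S" using r3 r by (auto simp: subset_iff)
      then show ?thesis
        using smooth_on_compose_linear[OF bounded_linear_ident open_ball _ f] by blast
    qed
    obtain q1 where q1: "q1 \<in> ball p r" and
      e1: "f (p + h *\<^sub>R X + h *\<^sub>R Y) - f (p + h *\<^sub>R X) - f (p + h *\<^sub>R Y) + f p = h * h * G X Y q1"
      using second_difference_eq[OF fr h h2] unfolding G_def by blast
    obtain q2 where q2: "q2 \<in> ball p r" and
      e2: "f (p + h *\<^sub>R Y + h *\<^sub>R X) - f (p + h *\<^sub>R Y) - f (p + h *\<^sub>R X) + f p = h * h * G Y X q2"
      using second_difference_eq[OF fr h, of Y X] h2 unfolding G_def by (auto simp: add.commute)
    have "p + h *\<^sub>R X + h *\<^sub>R Y = p + h *\<^sub>R Y + h *\<^sub>R X" by (simp add: add_ac)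
    from arg_cong[OF this, of f] have "h * h * G X Y q1 = h * h * G Y X q2"
      using e1 e2 by linarith
    then have "G X Y q1 = G Y X q2" using h by simp
    moreover have "\<bar>G X Y q1 - G X Y p\<bar> < e" "\<bar>G Y X q2 - G Y X p\<bar> < e"
      using r1(2)[of q1] r2(2)[of q2] q1 q2 r by auto
    ultimately show ?thesis by linarith
  qed
  from this[of "\<bar>G X Y p - G Y X p\<bar> / 4"] have "G X Y p = G Y X p" by (cases "G X Y p = G Y X p") auto
  then show ?thesis by (simp add: G_def)
qed

lemma dir_deriv_commute:
  fixes f :: "'a::real_normed_vector \<Rightarrow> 'b::euclidean_space"
  assumes S: "open S" "p \<in> S" and f: "smooth_on S f"
  shows "dir_deriv (\<lambda>q. dir_deriv f q X) p Y = dir_deriv (\<lambda>q. dir_deriv f q Y) p X"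
proof (rule euclidean_eqI)
  fix b :: 'b
  note L = bounded_linear_inner_left[of b]
  have sm: "smooth_on S (\<lambda>q. f q \<bullet> b)" by (rule smooth_on_bounded_linear[OF S(1) L f])
  have "dir_deriv (\<lambda>q. dir_deriv f q X) p Y \<bullet> b = dir_deriv (\<lambda>q. dir_deriv (\<lambda>q. f q \<bullet> b) q X) p Y" for X Y
  proof -
    have "dir_deriv (\<lambda>q. dir_deriv (\<lambda>q. f q \<bullet> b) q X) p Y = dir_deriv (\<lambda>q. dir_deriv f q X \<bullet> b) p Y"
      by (rule dir_deriv_cong[OF S]) (rule dir_deriv_bounded_linear[OF L smooth_on_differentiable[OF f]])
    also have "\<dots> = dir_deriv (\<lambda>q. dir_deriv f q X) p Y \<bullet> b"
      by (rule dir_deriv_bounded_linear[OF L smooth_on_differentiable[OF smooth_on_dir_deriv[OF f] S(2)]])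
    finally show ?thesis by simp
  qed
  then show "dir_deriv (\<lambda>q. dir_deriv f q X) p Y \<bullet> b = dir_deriv (\<lambda>q. dir_deriv f q Y) p X \<bullet> b"
    using dir_deriv_commute_real[OF S sm] by simp
qed

section \<open>Hermitian metrics on open subsets of complex two-space\<close>

lemma scaleR_eq_smult: "r *\<^sub>R (x::complex^'n) = complex_of_real r *s x"
  by (simp add: vec_eq_iff) (simp add: scaleR_conv_of_real)

lemma smult_scaleR_commute: "k *s (r *\<^sub>R (x::complex^'n)) = r *\<^sub>R (k *s x)"
  by (simp add: vec_eq_iff scaleR_conv_of_real)

lemma smult_Re_Im: "k *s (x::complex^'n) = Re k *\<^sub>R x + Im k *\<^sub>R (\<i> *s x)"
  by (simp add: vec_eq_iff) (simp add: complex_eq_iff algebra_simps)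

lemma i_i_smult [simp]: "\<i> *s (\<i> *s (x::complex^'n)) = - x"
  by (simp add: vec_eq_iff flip: mult.assoc)

lemma bounded_linear_smult: "bounded_linear (\<lambda>x::complex^'n. k *s x)"
  by (rule linear_conv_bounded_linear[THEN iffD1])
     (rule linearI, simp_all add: vector_add_ldistrib smult_scaleR_commute)

lemma vec2_expand: "(x::complex^2) = x$1 *s axis 1 1 + x$2 *s axis 2 1"
  by (simp add: vec_eq_iff forall_2 axis_def)

locale hermitian_metric =
  fixes U :: "(complex^2) set" and g :: "complex^2 \<Rightarrow> complex^2 \<Rightarrow> complex^2 \<Rightarrow> real"
  assumes open_U: "open U"
    and bil: "p \<in> U \<Longrightarrow> bilinear (g p)"
    and sym: "p \<in> U \<Longrightarrow> g p X Y = g p Y X"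
    and pos: "p \<in> U \<Longrightarrow> X \<noteq> 0 \<Longrightarrow> g p X X > 0"
    and J_inv: "p \<in> U \<Longrightarrow> g p (\<i> *s X) (\<i> *s Y) = g p X Y"
    and smooth_g: "smooth_on U (\<lambda>p. g p X Y)"
begin

text \<open>The Hermitian form with real part \<open>g\<close>, complex linear in its first argument.\<close>

definition H :: "complex^2 \<Rightarrow> complex^2 \<Rightarrow> complex^2 \<Rightarrow> complex"
  where "H p X Y = Complex (g p X Y) (g p X (\<i> *s Y))"

definition dg :: "complex^2 \<Rightarrow> complex^2 \<Rightarrow> complex^2 \<Rightarrow> complex^2 \<Rightarrow> real"
  where "dg p X Y Z = dir_deriv (\<lambda>q. g q Y Z) p X"

lemma Re_H [simp]: "Re (H p X Y) = g p X Y"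
  by (simp add: H_def)

lemma Im_H: "Im (H p X Y) = g p X (\<i> *s Y)"
  by (simp add: H_def)

lemma g_differentiable: "p \<in> U \<Longrightarrow> (\<lambda>q. g q X Y) differentiable (at p)"
  using smooth_on_differentiable[OF smooth_g] .

subsection \<open>Algebra at a point\<close>

context
  fixes p assumes p: "p \<in> U"
begin

lemma g_add [simp]: "g p (X + Y) Z = g p X Z + g p Y Z" "g p Z (X + Y) = g p Z X + g p Z Y"
  using bil[OF p] by (simp_all add: bilinear_ladd bilinear_radd)

lemma g_scale [simp]: "g p (r *\<^sub>R X) Z = r * g p X Z" "g p Z (r *\<^sub>R X) = r * g p Z X"
  using bil[OF p] by (simp_all add: bilinear_lmul bilinear_rmul)

lemma g_minus [simp]: "g p (- X) Z = - g p X Z" "g p Z (- X) = - g p Z X"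
  using bil[OF p] by (simp_all add: bilinear_lneg bilinear_rneg)

lemma g_diff [simp]: "g p (X - Y) Z = g p X Z - g p Y Z" "g p Z (X - Y) = g p Z X - g p Z Y"
  using bil[OF p] by (simp_all add: bilinear_lsub bilinear_rsub)

lemma g_zero [simp]: "g p 0 Z = 0" "g p Z 0 = 0"
  using bil[OF p] by (simp_all add: bilinear_lzero bilinear_rzero)

lemma g_i_right: "g p X (\<i> *s Y) = - g p (\<i> *s X) Y"
  using J_inv[OF p, of X "\<i> *s Y"] by simp

lemma g_nondegenerate: "(\<And>W. g p V W = g p V' W) \<Longrightarrow> V = V'"
  using pos[OF p, of "V - V'"] by (metis g_diff(1) eq_iff_diff_eq_0 less_irrefl)

lemma H_add [simp]: "H p (X + Y) Z = H p X Z + H p Y Z" "H p Z (X + Y) = H p Z X + H p Z Y"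
  by (simp_all add: complex_eq_iff Im_H vector_add_ldistrib)

lemma H_scaleR [simp]: "H p (r *\<^sub>R X) Z = r * H p X Z" "H p Z (r *\<^sub>R X) = r * H p Z X"
  by (simp_all add: complex_eq_iff Im_H smult_scaleR_commute)

lemma H_i: "H p (\<i> *s X) Y = \<i> * H p X Y" "H p X (\<i> *s Y) = - \<i> * H p X Y"
  using g_i_right[of X Y] by (simp_all add: complex_eq_iff Im_H J_inv[OF p])

lemma H_smult [simp]: "H p (k *s X) Y = k * H p X Y" "H p X (k *s Y) = cnj k * H p X Y"
  by (subst smult_Re_Im, simp add: H_i, simp add: complex_eq_iff)+

lemma H_minus [simp]: "H p (- X) Z = - H p X Z" "H p Z (- X) = - H p Z X"
  by (simp_all add: complex_eq_iff Im_H vector_smult_rneg)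

lemma H_diff [simp]: "H p (X - Y) Z = H p X Z - H p Y Z" "H p Z (X - Y) = H p Z X - H p Z Y"
  by (simp_all add: complex_eq_iff Im_H vector_ssub_ldistrib)

lemma H_zero [simp]: "H p 0 Z = 0" "H p Z 0 = 0"
  by (simp_all add: complex_eq_iff Im_H)

lemma H_cnj: "cnj (H p X Y) = H p Y X"
  using g_i_right[of X Y] sym[OF p, of X Y] sym[OF p, of "\<i> *s X" Y]
  by (simp add: complex_eq_iff Im_H)

lemma H_self: "H p X X = of_real (g p X X)"
  using g_i_right[of X X] sym[OF p, of "\<i> *s X" X] by (simp add: complex_eq_iff Im_H)

lemma H_self_neq_0: "X \<noteq> 0 \<Longrightarrow> H p X X \<noteq> 0"
  using pos[OF p, of X] by (simp add: H_self)

lemma H_nondegenerate: "(\<And>W. H p V W = H p V' W) \<Longrightarrow> V = V'"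
  by (rule g_nondegenerate) (metis Re_H)

lemma bilinear_H: "bilinear (H p)"
  by (auto simp: bilinear_def intro!: linearI)
     (simp_all add: scaleR_conv_of_real)

end

lemma smooth_H: "smooth_on U (\<lambda>p. H p X Y)"
proof -
  have eq: "H p X Y = g p X Y *\<^sub>R 1 + g p X (\<i> *s Y) *\<^sub>R \<i>" for p
    by (simp add: complex_eq_iff Im_H)
  show ?thesis
    unfolding eq by (intro smooth_on_add smooth_on_scaleR smooth_g smooth_on_const open_U)
qed

lemma H_differentiable: "p \<in> U \<Longrightarrow> (\<lambda>q. H q X Y) differentiable (at p)"
  using smooth_on_differentiable[OF smooth_H] .

lemma dir_deriv_H: "p \<in> U \<Longrightarrow> dir_deriv (\<lambda>q. H q Y Z) p X = Complex (dg p X Y Z) (dg p X Y (\<i> *s Z))"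
  using dir_deriv_bounded_linear[OF bounded_linear_Re H_differentiable, of p Y Z X]
    dir_deriv_bounded_linear[OF bounded_linear_Im H_differentiable, of p Y Z X]
  by (simp add: complex_eq_iff dg_def Im_H)

subsection \<open>Raising an index\<close>

definition gram_det :: "complex^2 \<Rightarrow> complex"
  where "gram_det p = H p (axis 1 1) (axis 1 1) * H p (axis 2 1) (axis 2 1)
    - H p (axis 1 1) (axis 2 1) * H p (axis 2 1) (axis 1 1)"

text \<open>Cramer's rule for the Gram matrix of \<open>H\<close>. Being explicit, the formula shows that the
  Christoffel symbols are smooth.\<close>

definition raise :: "complex^2 \<Rightarrow> (complex^2 \<Rightarrow> real) \<Rightarrow> complex^2"
  where "raise p \<alpha> = (let \<beta> = \<lambda>j. Complex (\<alpha> (axis j 1)) (\<alpha> (\<i> *s axis j 1)) in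
     ((\<beta> 1 * H p (axis 2 1) (axis 2 1) - \<beta> 2 * H p (axis 2 1) (axis 1 1)) * of_real (inverse (Re (gram_det p)))) *s axis 1 1
   + ((\<beta> 2 * H p (axis 1 1) (axis 1 1) - \<beta> 1 * H p (axis 1 1) (axis 2 1)) * of_real (inverse (Re (gram_det p)))) *s axis 2 1)"

lemma gram_det_pos:
  assumes p: "p \<in> U"
  shows "gram_det p = of_real (Re (gram_det p))" "Re (gram_det p) > 0"
proof -
  define e1 e2 where "e1 = (axis 1 1 :: complex^2)" and "e2 = (axis 2 1 :: complex^2)"
  \<comment> \<open>a multiple of the component of \<open>e2\<close> orthogonal to \<open>e1\<close>\<close>
  define y where "y = H p e1 e1 *s e2 - H p e2 e1 *s e1"
  have "y $ 2 = H p e1 e1" by (simp add: y_def e1_def e2_def axis_def)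
  moreover have "e1 \<noteq> 0" by (simp add: e1_def)
  ultimately have "y \<noteq> 0" using H_self_neq_0[OF p, of e1] by auto
  have r: "cnj (H p e1 e1) = H p e1 e1" "cnj (H p e1 e2) = H p e2 e1"
    using H_cnj[OF p] by auto
  have 1: "H p y y = gram_det p * of_real (g p e1 e1)"
    unfolding y_def gram_det_def e1_def[symmetric] e2_def[symmetric] H_self[OF p, symmetric]
    using r by (simp add: p algebra_simps)
  have 2: "g p e1 e1 > 0" using pos[OF p] \<open>e1 \<noteq> 0\<close> by blast
  have "gram_det p = of_real (g p y y / g p e1 e1)"
    using 1 2 by (simp add: H_self[OF p] field_simps)
  moreover have "g p y y / g p e1 e1 > 0" using pos[OF p \<open>y \<noteq> 0\<close>] 2 by simp
  ultimately show "gram_det p = of_real (Re (gram_det p))" "Re (gram_det p) > 0" by simp_all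
qed

lemma g_raise:
  assumes p: "p \<in> U" and lin: "linear \<alpha>"
  shows "g p (raise p \<alpha>) W = \<alpha> W"
proof -
  define e where "e j = (axis j 1 :: complex^2)" for j
  define \<beta> where "\<beta> j = Complex (\<alpha> (e j)) (\<alpha> (\<i> *s e j))" for j
  define d where "d = Re (gram_det p)"
  have d: "of_real d = gram_det p" "d \<noteq> 0" using gram_det_pos[OF p] by (auto simp: d_def)
  have V: "raise p \<alpha> = ((\<beta> 1 * H p (e 2) (e 2) - \<beta> 2 * H p (e 2) (e 1)) * of_real (inverse d)) *s e 1
   + ((\<beta> 2 * H p (e 1) (e 1) - \<beta> 1 * H p (e 1) (e 2)) * of_real (inverse d)) *s e 2"
    by (simp add: raise_def \<beta>_def e_def d_def Let_def)
  have "of_real d * H p (raise p \<alpha>) (e 1) = of_real d * \<beta> 1" "of_real d * H p (raise p \<alpha>) (e 2) = of_real d * \<beta> 2"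
    unfolding V using d(2) unfolding of_real_inverse
    by (simp_all add: p field_simps) (simp_all add: d(1) gram_det_def e_def algebra_simps)
  then have b: "H p (raise p \<alpha>) (e 1) = \<beta> 1" "H p (raise p \<alpha>) (e 2) = \<beta> 2" using d(2) by auto
  have W: "W = W$1 *s e 1 + W$2 *s e 2" unfolding e_def by (rule vec2_expand)
  have "H p (raise p \<alpha>) W = cnj (W$1) * \<beta> 1 + cnj (W$2) * \<beta> 2"
    by (subst W) (simp add: p b)
  then have "g p (raise p \<alpha>) W = Re (cnj (W$1) * \<beta> 1 + cnj (W$2) * \<beta> 2)" by (metis Re_H)
  also have "\<dots> = \<alpha> W"
    by (subst (3) W) (subst (1 2) smult_Re_Im, simp add: \<beta>_def linear_add[OF lin] linear_scale[OF lin])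
  finally show ?thesis .
qed

lemma sharp_eqI:
  assumes p: "p \<in> U" and V: "\<And>W. g p V W = \<alpha> W"
  shows "sharp (g p) \<alpha> = V"
  unfolding sharp_def
proof (rule the_equality)
  show "\<forall>W. g p V W = \<alpha> W" using V by blast
  show "V' = V" if "\<forall>W. g p V' W = \<alpha> W" for V'
    using that V by (intro g_nondegenerate[OF p]) simp
qed

lemma g_sharp:
  assumes "p \<in> U" "linear \<alpha>" shows "g p (sharp (g p) \<alpha>) W = \<alpha> W"
  unfolding sharp_eqI[OF assms(1) g_raise[OF assms]] by (rule g_raise[OF assms])

lemma smooth_raise:
  assumes "\<And>Z. smooth_on U (\<lambda>p. \<alpha> p Z)"
  shows "smooth_on U (\<lambda>p. raise p (\<alpha> p))"
proof -
  have b: "smooth_on U (\<lambda>p. Complex (\<alpha> p Z) (\<alpha> p W))" for Z W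
  proof -
    have eq: "Complex (\<alpha> p Z) (\<alpha> p W) = \<alpha> p Z *\<^sub>R 1 + \<alpha> p W *\<^sub>R \<i>" for p
      by (simp add: complex_eq_iff)
    show ?thesis
      unfolding eq by (intro smooth_on_add smooth_on_scaleR assms smooth_on_const open_U)
  qed
  have "smooth_on U gram_det"
    unfolding gram_det_def by (intro smooth_on_diff smooth_on_mult smooth_H open_U)
  then have "smooth_on U (\<lambda>p. inverse (Re (gram_det p)))"
    by (intro smooth_on_inverse_real open_U gram_det_pos)
      (rule smooth_on_bounded_linear[OF open_U bounded_linear_Re])
  then have d: "smooth_on U (\<lambda>p. complex_of_real (inverse (Re (gram_det p))))"
    by (rule smooth_on_bounded_linear[OF open_U bounded_linear_of_real])
  have ax: "smooth_on U (\<lambda>p. f p *s axis j 1)" if "smooth_on U f" for f :: "complex^2 \<Rightarrow> complex" and j :: 2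
  proof (rule smooth_on_bounded_linear[OF open_U _ that])
    show "bounded_linear (\<lambda>k::complex. k *s axis j (1::complex))"
      by (rule linear_conv_bounded_linear[THEN iffD1])
         (rule linearI, simp_all add: vec_eq_iff distrib_right)
  qed
  show ?thesis
    unfolding raise_def Let_def
    by (intro smooth_on_add ax smooth_on_mult smooth_on_diff b d smooth_H open_U)
qed

subsection \<open>The Levi-Civita connection\<close>

abbreviation "\<Gamma> \<equiv> christoffel g"
abbreviation "L \<equiv> lichnerowicz g"

lemma dg_linear:
  assumes p: "p \<in> U"
  shows "linear (\<lambda>X. dg p X Y Z)" "linear (\<lambda>Y. dg p X Y Z)" "linear (\<lambda>Z. dg p X Y Z)"
proof -
  show "linear (\<lambda>X. dg p X Y Z)"
    unfolding dg_def using linear_dir_deriv[OF g_differentiable[OF p]] .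
  have 1: "dg p X (Y + Y') Z = dg p X Y Z + dg p X Y' Z" "dg p X Z (Y + Y') = dg p X Z Y + dg p X Z Y'" for X Y Y' Z
    unfolding dg_def
    by (subst dir_deriv_add[OF g_differentiable[OF p] g_differentiable[OF p], symmetric];
        rule dir_deriv_cong[OF open_U p], simp)+
  have 2: "dg p X (r *\<^sub>R Y) Z = r * dg p X Y Z" "dg p X Z (r *\<^sub>R Y) = r * dg p X Z Y" for X Y Z r
    unfolding dg_def
    by (subst dir_deriv_bounded_linear[OF bounded_linear_mult_right g_differentiable[OF p], symmetric];
        rule dir_deriv_cong[OF open_U p], simp)+
  show "linear (\<lambda>Y. dg p X Y Z)" "linear (\<lambda>Z. dg p X Y Z)"
    by (rule linearI; simp add: 1 2)+
qed

lemma dg_sym: "p \<in> U \<Longrightarrow> dg p X Y Z = dg p X Z Y"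
  unfolding dg_def by (rule dir_deriv_cong[OF open_U]) (simp_all add: sym)

lemma dg_J: "p \<in> U \<Longrightarrow> dg p X (\<i> *s Y) (\<i> *s Z) = dg p X Y Z"
  unfolding dg_def by (rule dir_deriv_cong[OF open_U]) (simp_all add: J_inv)

lemma dg_i_right: "p \<in> U \<Longrightarrow> dg p X Y (\<i> *s Z) = - dg p X (\<i> *s Y) Z"
  using dg_J[of p X Y "\<i> *s Z"] linear_neg[OF dg_linear(3), of p X "\<i> *s Y" Z] by simp

lemmas dg_add = dg_linear[THEN linear_add]
lemmas dg_scale = dg_linear[THEN linear_scale]
lemmas dg_minus = dg_linear[THEN linear_neg]

lemma koszul_linear:
  "p \<in> U \<Longrightarrow> linear (\<lambda>Z. (dg p X Y Z + dg p Y X Z - dg p Z X Y) / 2)"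
  by (rule linearI) (simp_all add: dg_add dg_scale algebra_simps add_divide_distrib diff_divide_distrib)

lemma christoffel_koszul: "\<Gamma> p X Y = sharp (g p) (\<lambda>Z. (dg p X Y Z + dg p Y X Z - dg p Z X Y) / 2)"
  by (simp add: christoffel_def dg_def)

lemma koszul: "p \<in> U \<Longrightarrow> g p (\<Gamma> p X Y) Z = (dg p X Y Z + dg p Y X Z - dg p Z X Y) / 2"
  unfolding christoffel_koszul by (rule g_sharp[OF _ koszul_linear])

lemma christoffel_sym:
  assumes p: "p \<in> U" shows "\<Gamma> p X Y = \<Gamma> p Y X"
  by (rule g_nondegenerate[OF p]) (simp add: koszul[OF p] dg_sym[OF p, of _ X Y])

lemma christoffel_linear:
  assumes p: "p \<in> U" shows "linear (\<Gamma> p X)"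
  by (rule linearI; rule g_nondegenerate[OF p])
     (simp_all add: p koszul dg_add dg_scale algebra_simps add_divide_distrib diff_divide_distrib)

lemma christoffel_linear_left: "p \<in> U \<Longrightarrow> linear (\<lambda>X. \<Gamma> p X Y)"
  using christoffel_linear[of p Y] christoffel_sym[of p _ Y] by (simp add: linear_iff)

lemma bilinear_christoffel: "p \<in> U \<Longrightarrow> bilinear (\<Gamma> p)"
  by (simp add: bilinear_def christoffel_linear christoffel_linear_left)

lemma christoffel_metric: "p \<in> U \<Longrightarrow> dg p X Y Z = g p (\<Gamma> p X Y) Z + g p Y (\<Gamma> p X Z)"
  by (subst sym[of p Y], assumption) (simp add: koszul dg_sym[of p _ Z] field_simps)

lemma smooth_christoffel: "smooth_on U (\<lambda>p. \<Gamma> p X Y)"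
proof -
  have "smooth_on U (\<lambda>p. dg p X Y Z)" for X Y Z
    unfolding dg_def by (intro smooth_on_dir_deriv smooth_g)
  then have "smooth_on U (\<lambda>p. (1/2) *\<^sub>R (dg p X Y Z + dg p Y X Z - dg p Z X Y))" for Z
    by (intro smooth_on_scaleR smooth_on_add smooth_on_diff smooth_on_const open_U)
  from smooth_raise[OF this] show ?thesis
  proof (subst smooth_on_cong[OF open_U])
    fix p assume p: "p \<in> U"
    show "\<Gamma> p X Y = raise p (\<lambda>Z. (1 / 2) *\<^sub>R (dg p X Y Z + dg p Y X Z - dg p Z X Y))"
      unfolding christoffel_koszul
      by (rule sharp_eqI[OF p]) (subst g_raise[OF p], use koszul_linear[OF p] in simp_all)
  qed
qed

subsection \<open>The Lichnerowicz connection\<close>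

lemma lichnerowicz_christoffel: "L p X Y = (1/2) *\<^sub>R (\<Gamma> p X Y - \<i> *s \<Gamma> p X (\<i> *s Y))"
  by (simp add: lichnerowicz_def)

lemma bilinear_lichnerowicz: assumes p: "p \<in> U" shows "bilinear (L p)"
  unfolding bilinear_def lichnerowicz_christoffel
  using christoffel_linear[OF p] christoffel_linear_left[OF p]
  by (auto simp: linear_iff algebra_simps vector_add_ldistrib vector_ssub_ldistrib smult_scaleR_commute)

lemma lichnerowicz_i: "p \<in> U \<Longrightarrow> L p X (\<i> *s Y) = \<i> *s L p X Y"
  using linear_neg[OF christoffel_linear, of p X Y]
  by (simp add: lichnerowicz_christoffel smult_scaleR_commute vector_ssub_ldistrib vector_smult_rneg)

lemma lichnerowicz_smult:
  assumes p: "p \<in> U" shows "L p X (k *s Y) = k *s L p X Y"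
  by (subst (1 2) smult_Re_Im)
     (simp add: bilinear_radd[OF bilinear_lichnerowicz[OF p]] bilinear_rmul[OF bilinear_lichnerowicz[OF p]]
        lichnerowicz_i[OF p])

text \<open>The Lichnerowicz connection is the mean of the Levi-Civita connection and of its conjugate by
  \<open>J\<close>, and both are metric.\<close>

lemma lichnerowicz_metric:
  assumes p: "p \<in> U" shows "dg p X Y Z = g p (L p X Y) Z + g p Y (L p X Z)"
proof -
  have "dg p X (\<i> *s Y) (\<i> *s Z) = g p (\<Gamma> p X (\<i> *s Y)) (\<i> *s Z) + g p (\<i> *s Y) (\<Gamma> p X (\<i> *s Z))"
    by (rule christoffel_metric[OF p])
  then have "dg p X Y Z = - g p (\<i> *s \<Gamma> p X (\<i> *s Y)) Z - g p Y (\<i> *s \<Gamma> p X (\<i> *s Z))"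
    using g_i_right[OF p] by (simp add: dg_J[OF p])
  then show ?thesis
    using christoffel_metric[OF p, of X Y Z] by (simp add: lichnerowicz_christoffel p algebra_simps)
qed

text \<open>Since the connection preserves both \<open>g\<close> and \<open>J\<close>, it preserves \<open>H\<close>.\<close>

lemma dir_deriv_H_lichnerowicz:
  assumes p: "p \<in> U" shows "dir_deriv (\<lambda>q. H q Y Z) p X = H p (L p X Y) Z + H p Y (L p X Z)"
  unfolding dir_deriv_H[OF p]
  by (simp add: complex_eq_iff Im_H lichnerowicz_metric[OF p] lichnerowicz_i[OF p])

lemma smooth_lichnerowicz: "smooth_on U (\<lambda>p. L p X Y)"
  unfolding lichnerowicz_christoffel
  by (intro smooth_on_scaleR smooth_on_const smooth_on_diff smooth_christoffel open_U
      smooth_on_bounded_linear[OF open_U bounded_linear_smult])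

lemma christoffel_differentiable: "p \<in> U \<Longrightarrow> (\<lambda>q. \<Gamma> q X Y) differentiable (at p)"
  using smooth_on_differentiable[OF smooth_christoffel] .

lemma lichnerowicz_differentiable: "p \<in> U \<Longrightarrow> (\<lambda>q. L q X Y) differentiable (at p)"
  using smooth_on_differentiable[OF smooth_lichnerowicz] .

end

section \<open>Curvature of the Levi-Civita and Lichnerowicz connections\<close>

definition connection_curvature ::
  "(complex^2 \<Rightarrow> complex^2 \<Rightarrow> complex^2 \<Rightarrow> complex^2) \<Rightarrow> complex^2 \<Rightarrow> complex^2 \<Rightarrow> complex^2 \<Rightarrow> complex^2 \<Rightarrow> complex^2"
  where "connection_curvature C p X Y Z = dir_deriv (\<lambda>q. C q Y Z) p X - dir_deriv (\<lambda>q. C q X Z) p Y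
    + C p X (C p Y Z) - C p Y (C p X Z)"

context hermitian_metric
begin

abbreviation "R \<equiv> curvature g"
abbreviation "\<Omega> \<equiv> connection_curvature L"

subsection \<open>Unitary frames at a point\<close>

lemma frame_spans:
  assumes p: "p \<in> U" and r: "r \<noteq> 0" and u: "H p u1 u1 = r" "H p u2 u2 = r" "H p u1 u2 = 0"
  shows "x = (H p x u1 / r) *s u1 + (H p x u2 / r) *s u2"
proof -
  have u': "H p u2 u1 = 0" using H_cnj[OF p, of u1 u2] u by simp
  \<comment> \<open>Cramer's rule; a vanishing determinant would make the orthogonal vectors parallel\<close>
  define d where "d = u1$1 * u2$2 - u1$2 * u2$1"
  have "d \<noteq> 0"
  proof
    assume "d = 0"
    then have eq: "u1$1 *s u2 = u2$1 *s u1" "u1$2 *s u2 = u2$2 *s u1"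
      by (simp_all add: vec_eq_iff forall_2 d_def mult.commute)
    have "H p (u2$1 *s u1) u1 = 0" "H p (u2$2 *s u1) u1 = 0"
      unfolding eq[symmetric] by (simp_all add: p u')
    then have "u2 = 0" using r by (simp add: p u vec_eq_iff forall_2)
    then show False using u r p by simp
  qed
  define k1 k2 where "k1 = (x$1 * u2$2 - x$2 * u2$1) / d" and "k2 = (x$2 * u1$1 - x$1 * u1$2) / d"
  have "k1 * u1$1 + k2 * u2$1 = x$1" "k1 * u1$2 + k2 * u2$2 = x$2"
    unfolding k1_def k2_def using \<open>d \<noteq> 0\<close>
    by (simp_all add: add_divide_distrib[symmetric] divide_eq_eq) (simp_all add: d_def algebra_simps)
  then have x: "x = k1 *s u1 + k2 *s u2"
    by (simp add: vec_eq_iff forall_2)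
  show ?thesis
    by (subst (2 3) x) (use x r in \<open>simp add: p u u'\<close>)
qed

text \<open>A nonzero vector orthogonal to \<open>v\<close> which depends smoothly on \<open>v\<close> and on the metric.\<close>

definition perp :: "complex^2 \<Rightarrow> complex^2 \<Rightarrow> complex^2"
  where "perp p v = H p (axis 2 1) v *s axis 1 1 - H p (axis 1 1) v *s axis 2 1"

lemma H_perp: "p \<in> U \<Longrightarrow> H p (perp p v) v = 0"
  by (simp add: perp_def)

lemma perp_neq_0:
  assumes p: "p \<in> U" and v: "v \<noteq> 0" shows "perp p v \<noteq> 0"
proof
  assume "perp p v = 0"
  then have 0: "H p (axis 1 1) v = 0" "H p (axis 2 1) v = 0"
    by (simp_all add: perp_def vec_eq_iff forall_2 axis_def)
  have "H p v v = 0" by (subst (1) vec2_expand) (simp add: p 0)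
  then show False using H_self_neq_0[OF p v] by simp
qed

lemma normalize_H:
  assumes p: "p \<in> U" and v: "v \<noteq> 0" and r: "r \<ge> 0"
  shows "H p ((sqrt r / sqrt (g p v v)) *\<^sub>R v) ((sqrt r / sqrt (g p v v)) *\<^sub>R v) = of_real r"
proof -
  have "g p v v > 0" using pos[OF p v] .
  then have "sqrt r / sqrt (g p v v) * (sqrt r / sqrt (g p v v)) * g p v v = r"
    using r by (simp add: field_simps real_sqrt_mult[symmetric]) 
  then show ?thesis
    using p by (simp add: H_self flip: of_real_mult mult.assoc)
qed

lemma ex_unitary_frame:
  assumes p: "p \<in> U"
  obtains u1 u2 where "H p u1 u1 = 1" "H p u2 u2 = 1" "H p u1 u2 = 0"
proof -
  have e: "axis 1 1 \<noteq> (0::complex^2)" by simp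
  define y where "y = perp p (axis 1 1)"
  have y: "y \<noteq> 0" "H p y (axis 1 1) = 0" using perp_neq_0[OF p e] H_perp[OF p] by (auto simp: y_def)
  have "H p (axis 1 1) y = 0" using y(2) H_cnj[OF p, of y] by (metis complex_cnj_zero)
  then show thesis
    using that[of "(sqrt 1 / sqrt (g p (axis 1 1) (axis 1 1))) *\<^sub>R axis 1 1" "(sqrt 1 / sqrt (g p y y)) *\<^sub>R y"]
      normalize_H[OF p e, of 1] normalize_H[OF p y(1), of 1] p by simp
qed

text \<open>In complex dimension two the skew antilinear maps form a complex line, spanned by a map
  whose square is real.\<close>

lemma antilinear_skew_compose_scalar:
  assumes p: "p \<in> U"
    and S: "linear S" "\<And>v. S (\<i> *s v) = - (\<i> *s S v)" "\<And>v w. g p (S v) w = - g p v (S w)"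
    and T: "linear T" "\<And>v. T (\<i> *s v) = - (\<i> *s T v)" "\<And>v w. g p (T v) w = - g p v (T w)"
  obtains c where "\<And>v. S (T v) = c *s v"
proof -
  obtain u1 u2 where u: "H p u1 u1 = 1" "H p u2 u2 = 1" "H p u1 u2 = 0"
    using ex_unitary_frame[OF p] by blast
  note span = frame_spans[OF p _ u, simplified]
  have smult: "F (k *s v) = cnj k *s F v" if "linear F" "\<And>v. F (\<i> *s v) = - (\<i> *s F v)" for F :: "complex^2 \<Rightarrow> complex^2" and k v
    by (subst smult_Re_Im, subst (2) smult_Re_Im)
       (simp add: linear_add[OF that(1)] linear_scale[OF that(1)] that(2))
  \<comment> \<open>\<open>H(F v, w)\<close> is alternating, so \<open>F u1\<close> is orthogonal to \<open>u1\<close> and \<open>F u2\<close> to \<open>u2\<close>\<close>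
  have form: "\<exists>s. F u1 = s *s u2 \<and> F u2 = - s *s u1"
    if F: "linear F" "\<And>v. F (\<i> *s v) = - (\<i> *s F v)" "\<And>v w. g p (F v) w = - g p v (F w)" for F
  proof -
    have skew: "H p (F v) w = - H p (F w) v" for v w
    proof -
      have "g p (F v) w = - g p (F w) v" using F(3)[of v w] sym[OF p] by simp
      moreover have "g p (F v) (\<i> *s w) = - g p (F w) (\<i> *s v)"
        using F(3)[of v "\<i> *s w"] sym[OF p, of v] g_i_right[OF p, of "F w" v] by (simp add: F(2) p)
      ultimately show ?thesis by (simp add: complex_eq_iff Im_H)
    qed
    have z: "H p (F v) v = 0" for v
    proof -
      have "H p (F v) v + H p (F v) v = 0" using skew[of v v] by (simp only: eq_neg_iff_add_eq_0)
      then show ?thesis by (simp only: mult_2[symmetric] mult_eq_0_iff) simp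
    qed
    have "F u1 = H p (F u1) u2 *s u2" using span[of "F u1"] z[of u1] by simp
    moreover have "F u2 = - H p (F u1) u2 *s u1" using span[of "F u2"] z[of u2] skew[of u2 u1] by simp
    ultimately show ?thesis by blast
  qed
  obtain s where s: "S u1 = s *s u2" "S u2 = - s *s u1" using form[OF S] by blast
  obtain t where t: "T u1 = t *s u2" "T u2 = - t *s u1" using form[OF T] by blast
  define c where "c = - (cnj t * s)"
  have c: "S (T u1) = c *s u1" "S (T u2) = c *s u2"
    by (simp_all only: s t smult[OF S(1,2)]) (simp_all add: c_def vec_eq_iff)
  have "S (T v) = c *s v" for v
  proof -
    define k1 k2 where "k1 = H p v u1" and "k2 = H p v u2"
    have v: "v = k1 *s u1 + k2 *s u2" unfolding k1_def k2_def by (rule span)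
    have "S (T v) = k1 *s S (T u1) + k2 *s S (T u2)"
      unfolding v by (simp add: linear_add[OF S(1)] linear_add[OF T(1)] smult[OF S(1,2)] smult[OF T(1,2)])
    then show ?thesis unfolding c v by (simp add: vec_eq_iff algebra_simps)
  qed
  then show thesis by (rule that)
qed

subsection \<open>Symmetries of the Riemannian curvature\<close>

lemma curvature_skew_left: "R p X Y Z = - R p Y X Z"
  by (simp add: curvature_def)

lemma dir_deriv_linear_family:
  assumes p: "p \<in> U" and lin: "\<And>q. q \<in> U \<Longrightarrow> linear (F q)" and d: "\<And>Y. (\<lambda>q. F q Y) differentiable (at p)"
  shows "linear (\<lambda>Y. dir_deriv (\<lambda>q. F q Y) p X)"
proof (rule linearI)
  show "dir_deriv (\<lambda>q. F q (Y + Y')) p X = dir_deriv (\<lambda>q. F q Y) p X + dir_deriv (\<lambda>q. F q Y') p X" for Y Y'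
    unfolding dir_deriv_add[OF d d, symmetric]
    by (rule dir_deriv_cong[OF open_U p]) (rule linear_add[OF lin])
  show "dir_deriv (\<lambda>q. F q (r *\<^sub>R Y)) p X = r *\<^sub>R dir_deriv (\<lambda>q. F q Y) p X" for r Y
    unfolding dir_deriv_bounded_linear[OF bounded_linear_scaleR_right d, symmetric]
    by (rule dir_deriv_cong[OF open_U p]) (rule linear_scale[OF lin])
qed

lemma curvature_linear:
  assumes p: "p \<in> U"
  shows "linear (\<lambda>X. R p X Y Z)" "linear (\<lambda>Y. R p X Y Z)" "linear (\<lambda>Z. R p X Y Z)"
proof -
  note b = bilinear_christoffel[OF p]
  note bs = bilinear_ladd[OF b] bilinear_radd[OF b] bilinear_lmul[OF b] bilinear_rmul[OF b]
  note F1 = dir_deriv_linear_family[OF p christoffel_linear_left christoffel_differentiable[OF p]]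
  note F2 = dir_deriv_linear_family[OF p christoffel_linear christoffel_differentiable[OF p]]
  note D = linear_dir_deriv[OF christoffel_differentiable[OF p]]
  note s = bs linear_add[OF F1] linear_scale[OF F1] linear_add[OF F2] linear_scale[OF F2]
    linear_add[OF D] linear_scale[OF D] scaleR_add_right scaleR_diff_right
  show 1: "linear (\<lambda>X. R p X Y Z)" for Y
    unfolding curvature_def by (rule linearI) (simp_all add: s)
  show "linear (\<lambda>Z. R p X Y Z)"
    unfolding curvature_def by (rule linearI) (simp_all add: s)
  show "linear (\<lambda>Y. R p X Y Z)"
    unfolding curvature_def by (rule linearI) (simp_all add: s)
qed

lemma bianchi:
  assumes p: "p \<in> U" shows "R p X Y Z + R p Y Z X + R p Z X Y = 0"
proof -
  have s: "dir_deriv (\<lambda>q. \<Gamma> q Y Z) p X = dir_deriv (\<lambda>q. \<Gamma> q Z Y) p X" for X Y Z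
    by (rule dir_deriv_cong[OF open_U p]) (rule christoffel_sym)
  show ?thesis
    unfolding curvature_def
    using s[of X Y Z] s[of Y Z X] s[of Z X Y] christoffel_sym[OF p, of X Y] christoffel_sym[OF p, of Y Z]
      christoffel_sym[OF p, of X Z] by simp
qed

text \<open>Differentiate twice the identity stating that the connection is metric; the second derivatives
  of \<open>g(Z,V)\<close> commute.\<close>

lemma curvature_skew_right:
  assumes p: "p \<in> U" shows "g p (R p X Y Z) V = - g p Z (R p X Y V)"
proof -
  have d1: "((\<lambda>q. g q (\<Gamma> q Y Z) V) has_derivative
      (\<lambda>X. dg p X (\<Gamma> p Y Z) V + g p (dir_deriv (\<lambda>q. \<Gamma> q Y Z) p X) V)) (at p)" for Y Z V
    using has_derivative_bilinear_field[OF open_U p bil g_differentiable[OF p]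
        christoffel_differentiable[OF p] differentiable_const, of Y Z V]
    by (simp add: dg_def p)
  have d2: "((\<lambda>q. g q V (\<Gamma> q Y Z)) has_derivative
      (\<lambda>X. dg p X V (\<Gamma> p Y Z) + g p V (dir_deriv (\<lambda>q. \<Gamma> q Y Z) p X))) (at p)" for Y Z V
    using has_derivative_bilinear_field[OF open_U p bil g_differentiable[OF p]
        differentiable_const christoffel_differentiable[OF p], of V Y Z]
    by (simp add: dg_def p)
  have "dir_deriv (\<lambda>q. dg q Y Z V) p X
      = dg p X (\<Gamma> p Y Z) V + g p (dir_deriv (\<lambda>q. \<Gamma> q Y Z) p X) V
      + (dg p X Z (\<Gamma> p Y V) + g p Z (dir_deriv (\<lambda>q. \<Gamma> q Y V) p X))" for X Y
  proof -
    have "dir_deriv (\<lambda>q. dg q Y Z V) p X = dir_deriv (\<lambda>q. g q (\<Gamma> q Y Z) V + g q Z (\<Gamma> q Y V)) p X"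
      by (rule dir_deriv_cong[OF open_U p]) (rule christoffel_metric)
    then show ?thesis using dir_deriv_eqI[OF has_derivative_add[OF d1 d2]] by simp
  qed
  moreover have "dir_deriv (\<lambda>q. dg q Y Z V) p X = dir_deriv (\<lambda>q. dg q X Z V) p Y"
    unfolding dg_def by (rule dir_deriv_commute[OF open_U p smooth_g])
  ultimately show ?thesis
    unfolding curvature_def by (simp add: p christoffel_metric)
qed

subsection \<open>The complex linear part of the Riemannian curvature\<close>

definition R_lin :: "complex^2 \<Rightarrow> complex^2 \<Rightarrow> complex^2 \<Rightarrow> complex^2 \<Rightarrow> complex^2"
  where "R_lin p X Y Z = (1/2) *\<^sub>R (R p X Y Z - \<i> *s R p X Y (\<i> *s Z))"

text \<open>Half of \<open>J \<circ> \<nabla>\<^sub>X J\<close>, as a function of \<open>X\<close>.\<close>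

definition nablaJ :: "complex^2 \<Rightarrow> complex^2 \<Rightarrow> complex^2 \<Rightarrow> complex^2"
  where "nablaJ p X Y = \<Gamma> p X Y - L p X Y"

lemma nablaJ_i: "p \<in> U \<Longrightarrow> nablaJ p X (\<i> *s Y) = - (\<i> *s nablaJ p X Y)"
  unfolding nablaJ_def lichnerowicz_i
  by (simp add: lichnerowicz_christoffel scaleR_eq_smult vec_eq_iff algebra_simps)

lemma nablaJ_linear: "p \<in> U \<Longrightarrow> linear (nablaJ p X)"
  unfolding nablaJ_def using bilinear_christoffel[of p] bilinear_lichnerowicz[of p]
  by (auto simp: bilinear_def intro!: linear_compose_sub)

lemma nablaJ_skew: "p \<in> U \<Longrightarrow> g p (nablaJ p X Y) Z = - g p Y (nablaJ p X Z)"
  using lichnerowicz_metric[of p X Y Z] christoffel_metric[of p X Y Z] by (simp add: nablaJ_def)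

text \<open>The Levi-Civita connection is the sum of a complex linear and of an antilinear part. Mixed
  products are antilinear and do not contribute.\<close>

lemma R_lin_eq:
  assumes p: "p \<in> U"
  shows "R_lin p X Y Z = \<Omega> p X Y Z + nablaJ p X (nablaJ p Y Z) - nablaJ p Y (nablaJ p X Z)"
proof -
  have d: "dir_deriv (\<lambda>q. L q Y Z) p X = (1/2) *\<^sub>R (dir_deriv (\<lambda>q. \<Gamma> q Y Z) p X - \<i> *s dir_deriv (\<lambda>q. \<Gamma> q Y (\<i> *s Z)) p X)" for X Y
  proof -
    note c = christoffel_differentiable[OF p]
    have m: "(\<lambda>q. \<i> *s \<Gamma> q Y (\<i> *s Z)) differentiable (at p)"
      by (rule differentiable_bounded_linear[OF bounded_linear_smult c])
    have "(\<lambda>q. \<Gamma> q Y Z - \<i> *s \<Gamma> q Y (\<i> *s Z)) differentiable (at p)"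
      by (rule differentiable_diff[OF c m])
    then show ?thesis
      unfolding lichnerowicz_christoffel
      using dir_deriv_bounded_linear[OF bounded_linear_scaleR_right[of "1/2"], of "\<lambda>q. \<Gamma> q Y Z - \<i> *s \<Gamma> q Y (\<i> *s Z)" p X]
        dir_deriv_diff[OF c[of Y Z] m, of X] dir_deriv_bounded_linear[OF bounded_linear_smult c, of \<i> Y "\<i> *s Z" X]
      by simp
  qed
  have q: "(1/2) *\<^sub>R (\<Gamma> p X (\<Gamma> p Y Z) - \<i> *s \<Gamma> p X (\<Gamma> p Y (\<i> *s Z)))
      = L p X (L p Y Z) + nablaJ p X (nablaJ p Y Z)" for X Y
  proof -
    have G: "\<Gamma> p X V = L p X V + nablaJ p X V" for X V by (simp add: nablaJ_def)
    note s = bilinear_radd[OF bilinear_lichnerowicz[OF p]] linear_add[OF nablaJ_linear[OF p]]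
      linear_neg[OF nablaJ_linear[OF p]] bilinear_rneg[OF bilinear_lichnerowicz[OF p]]
      linear_diff[OF nablaJ_linear[OF p]] bilinear_rsub[OF bilinear_lichnerowicz[OF p]]
      lichnerowicz_i[OF p] nablaJ_i[OF p]
    show ?thesis unfolding G by (simp add: s) (simp add: vec_eq_iff scaleR_eq_smult algebra_simps)
  qed
  have "R_lin p X Y Z = (1/2) *\<^sub>R (dir_deriv (\<lambda>q. \<Gamma> q Y Z) p X - \<i> *s dir_deriv (\<lambda>q. \<Gamma> q Y (\<i> *s Z)) p X)
     - (1/2) *\<^sub>R (dir_deriv (\<lambda>q. \<Gamma> q X Z) p Y - \<i> *s dir_deriv (\<lambda>q. \<Gamma> q X (\<i> *s Z)) p Y)
     + (1/2) *\<^sub>R (\<Gamma> p X (\<Gamma> p Y Z) - \<i> *s \<Gamma> p X (\<Gamma> p Y (\<i> *s Z)))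
     - (1/2) *\<^sub>R (\<Gamma> p Y (\<Gamma> p X Z) - \<i> *s \<Gamma> p Y (\<Gamma> p X (\<i> *s Z)))"
    unfolding R_lin_def curvature_def
    by (simp add: vector_ssub_ldistrib scaleR_diff_right scaleR_add_right)
  then show ?thesis
    unfolding d[symmetric] q connection_curvature_def by simp
qed

text \<open>The commutators in the preceding identity are scalar. So both curvatures have the same component
  in the trace-free skew-Hermitian endomorphisms, which correspond to the anti-self-dual 2-forms.\<close>

lemma R_lin_lichnerowicz:
  assumes p: "p \<in> U"
  obtains c where "\<And>Z. R_lin p X Y Z = \<Omega> p X Y Z + c *s Z"
proof -
  note n = nablaJ_linear[OF p] nablaJ_i[OF p] nablaJ_skew[OF p]
  obtain c1 where c1: "\<And>Z. nablaJ p X (nablaJ p Y Z) = c1 *s Z"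
    using antilinear_skew_compose_scalar[OF p n n] by blast
  obtain c2 where c2: "\<And>Z. nablaJ p Y (nablaJ p X Z) = c2 *s Z"
    using antilinear_skew_compose_scalar[OF p n n] by blast
  show thesis
    by (rule that[of "c1 - c2"]) (simp add: R_lin_eq[OF p] c1 c2 vector_sub_rdistrib)
qed

end

section \<open>The exterior derivative of the fundamental forms\<close>

lemma dir_deriv_divide:
  fixes f g :: "'a::real_normed_vector \<Rightarrow> complex"
  assumes "f differentiable (at p)" "g differentiable (at p)" "g p \<noteq> 0"
  shows "dir_deriv (\<lambda>q. f q / g q) p v = (dir_deriv f p v * g p - f p * dir_deriv g p v) / (g p * g p)"
  by (rule dir_deriv_eqI[OF has_derivative_divide'[OF assms(1,2)[THEN differentiable_imp_dir_deriv] assms(3)]])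

lemma ext_deriv2_cong:
  assumes "open S" "w \<in> S" "\<And>q X Y. q \<in> S \<Longrightarrow> \<alpha> q X Y = \<beta> q X Y"
  shows "ext_deriv2 \<alpha> w X Y Z = ext_deriv2 \<beta> w X Y Z"
  unfolding ext_deriv2_def
  using dir_deriv_cong[OF assms(1,2), of "\<lambda>q. \<alpha> q _ _" "\<lambda>q. \<beta> q _ _"] assms(3) by metis

lemma ext_deriv2_add:
  assumes "\<And>X Y. (\<lambda>q. \<alpha> q X Y) differentiable (at w)" "\<And>X Y. (\<lambda>q. \<beta> q X Y) differentiable (at w)"
  shows "ext_deriv2 (\<lambda>q X Y. \<alpha> q X Y + \<beta> q X Y) w X Y Z = ext_deriv2 \<alpha> w X Y Z + ext_deriv2 \<beta> w X Y Z"
  unfolding ext_deriv2_def by (simp add: dir_deriv_add[OF assms])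

lemma ext_deriv2_bounded_linear:
  assumes "bounded_linear l" "\<And>X Y. (\<lambda>q. \<alpha> q X Y) differentiable (at w)"
  shows "ext_deriv2 (\<lambda>q X Y. l (\<alpha> q X Y)) w X Y Z = l (ext_deriv2 \<alpha> w X Y Z)"
  unfolding ext_deriv2_def dir_deriv_bounded_linear[OF assms]
  using bounded_linear.linear[OF assms(1)] by (simp add: linear_add linear_diff)

lemma ext_deriv2_exact:
  fixes \<kappa> :: "'a::real_normed_vector \<Rightarrow> 'a \<Rightarrow> 'b::euclidean_space"
  assumes S: "open S" "w \<in> S" and sm: "\<And>X. smooth_on S (\<lambda>q. \<kappa> q X)"
  shows "ext_deriv2 (\<lambda>q X Y. dir_deriv (\<lambda>q. \<kappa> q Y) q X - dir_deriv (\<lambda>q. \<kappa> q X) q Y) w X Y Z = 0"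
proof -
  note d = smooth_on_differentiable[OF smooth_on_dir_deriv[OF sm] S(2)]
  show ?thesis
    unfolding ext_deriv2_def dir_deriv_diff[OF d d]
    using dir_deriv_commute[OF S sm] by simp
qed

lemma ext_deriv2_pullback_linear:
  assumes l: "bounded_linear l" and d: "\<And>X Y. (\<lambda>q. \<alpha> q X Y) differentiable (at (l w))"
  shows "ext_deriv2 (\<lambda>w X Y. \<alpha> (l w) (l X) (l Y)) w X Y Z = ext_deriv2 \<alpha> (l w) (l X) (l Y) (l Z)"
  unfolding ext_deriv2_def by (subst (1 2 3) dir_deriv_compose_linear[OF l d]) simp

subsection \<open>Affine coordinates on the projective line\<close>

definition affine_dir :: "2 \<Rightarrow> complex \<Rightarrow> complex^2"
  where "affine_dir i t = (\<chi> j. if j = i then 0 else t)"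

lemma affine_vec_eq: "affine_vec i t = axis i 1 + affine_dir i t"
  by (simp add: affine_vec_def affine_dir_def axis_def vec_eq_iff)

lemma bounded_linear_affine_dir: "bounded_linear (affine_dir i)"
  by (rule linear_conv_bounded_linear[THEN iffD1])
     (rule linearI, simp_all add: affine_dir_def vec_eq_iff)

lemma affine_dir_scale: "affine_dir i t = t *s affine_dir i 1"
  by (simp add: affine_dir_def vec_eq_iff)

lemma affine_vec_neq_0: "affine_vec i t \<noteq> 0"
  by (auto simp: affine_vec_def vec_eq_iff)

lemma smooth_affine_vec:
  assumes "open S" shows "smooth_on S (\<lambda>w::'a::real_normed_vector \<times> complex. affine_vec i (snd w))"
  unfolding affine_vec_eq
  by (intro smooth_on_add smooth_on_const assms smooth_on_linear
      bounded_linear_compose[OF bounded_linear_affine_dir bounded_linear_snd])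

lemma dir_deriv_affine_vec:
  "dir_deriv (\<lambda>w::'a::real_normed_vector \<times> complex. affine_vec i (snd w)) w X = affine_dir i (snd X)"
proof -
  have "((\<lambda>w::'a \<times> complex. affine_vec i (snd w)) has_derivative (\<lambda>X. 0 + affine_dir i (snd X))) (at w)"
    unfolding affine_vec_eq
    by (intro has_derivative_add has_derivative_const bounded_linear_imp_has_derivative
        bounded_linear_compose[OF bounded_linear_affine_dir bounded_linear_snd])
  from dir_deriv_eqI[OF this] show ?thesis by simp
qed

lemma affine_basis_expansion: "(x::complex^2) = x $ i *s axis i 1 + (\<Sum>j\<in>UNIV - {i}. x $ j) *s affine_dir i 1"
proof -
  consider "i = 1" | "i = 2" using exhaust_2 by blast
  then show ?thesis
  proof cases
    case 1
    moreover have "UNIV - {1::2} = {2}" by (auto simp: UNIV_2)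
    ultimately show ?thesis by (simp add: vec_eq_iff forall_2 affine_dir_def axis_def)
  next
    case 2
    moreover have "UNIV - {2::2} = {1}" by (auto simp: UNIV_2)
    ultimately show ?thesis by (simp add: vec_eq_iff forall_2 affine_dir_def axis_def)
  qed
qed

context hermitian_metric
begin

text \<open>An endomorphism is determined by its sesquilinear form, and this by its values on the
  diagonal; here the points \<open>0, 1, -1, \<i>\<close> of an affine chart suffice.\<close>

lemma endomorphism_eq_0I:
  assumes p: "p \<in> U" and F: "\<And>x y. F (x + y) = F x + F y" "\<And>k x. F (k *s x) = k *s F x"
    and 0: "\<And>t. H p (F (affine_vec i t)) (affine_vec i t) = 0"
  shows "F x = 0"
proof -
  define e f where "e = (axis i 1 :: complex^2)" and "f = affine_dir i 1"
  have v: "affine_vec i t = e + t *s f" for t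
    unfolding e_def f_def affine_vec_eq affine_dir_scale[symmetric] ..
  define q11 q12 q21 q22 where "q11 = H p (F e) e" and "q12 = H p (F e) f"
    and "q21 = H p (F f) e" and "q22 = H p (F f) f"
  have *: "q11 + cnj t * q12 + t * q21 + t * cnj t * q22 = 0" for t
    using 0[of t] unfolding v by (simp add: F p q11_def q12_def q21_def q22_def algebra_simps)
  have "q11 = 0" using *[of 0] by simp
  moreover have "q12 + q21 + q22 = 0" "- q12 - q21 + q22 = 0" using *[of 1] *[of "-1"] \<open>q11 = 0\<close> by simp_all
  moreover have "- \<i> * q12 + \<i> * q21 + q22 = 0" using *[of \<i>] \<open>q11 = 0\<close> by (simp add: algebra_simps)
  moreover have "2 * q22 = (q12 + q21 + q22) + (- q12 - q21 + q22)" by simp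
  ultimately have q22: "q22 = 0" and a: "q12 + q21 = 0" and b: "\<i> * q21 = \<i> * q12" by auto
  from b have "q21 = q12" by simp
  with a have q: "q12 = 0" "q21 = 0" by auto
  have s: "y = y $ i *s e + (\<Sum>j\<in>UNIV - {i}. y $ j) *s f" for y
    unfolding e_def f_def by (rule affine_basis_expansion)
  have "H p (F x) y = H p 0 y" for y
    by (subst s[of x], subst s[of y])
       (use \<open>q11 = 0\<close> q q22 in \<open>simp add: F p q11_def q12_def q21_def q22_def\<close>)
  then show ?thesis by (rule H_nondegenerate[OF p])
qed

subsection \<open>Calculus on the product with an affine line\<close>

abbreviation U' :: "((complex^2) \<times> complex) set" where "U' \<equiv> U \<times> UNIV"

lemma open_U': "open U'"
  using open_U by (simp add: open_Times)

lemma smooth_on_base: "smooth_on U f \<Longrightarrow> smooth_on U' (\<lambda>w. f (fst w))"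
  by (rule smooth_on_compose_linear[OF bounded_linear_fst open_U']) auto

lemma differentiable_base: "f differentiable (at (fst w)) \<Longrightarrow> (\<lambda>w. f (fst w)) differentiable (at w)"
  by (rule differentiable_compose_linear[OF bounded_linear_fst])

lemma dir_deriv_base: "f differentiable (at (fst w)) \<Longrightarrow> dir_deriv (\<lambda>w. f (fst w)) w X = dir_deriv f (fst w) (fst X)"
  by (rule dir_deriv_compose_linear[OF bounded_linear_fst])

text \<open>The covariant derivative of a vector field along the projection to \<open>U\<close>.\<close>

definition cov :: "((complex^2) \<times> complex \<Rightarrow> complex^2) \<Rightarrow> (complex^2) \<times> complex \<Rightarrow> (complex^2) \<times> complex \<Rightarrow> complex^2"
  where "cov a w X = dir_deriv a w X + L (fst w) (fst X) (a w)"

lemma H_along: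
  assumes w: "fst w \<in> U" and a: "a differentiable (at w)" and b: "b differentiable (at w)"
  shows "(\<lambda>w. H (fst w) (a w) (b w)) differentiable (at w)"
    and "dir_deriv (\<lambda>w. H (fst w) (a w) (b w)) w X
      = H (fst w) (cov a w X) (b w) + H (fst w) (a w) (cov b w X)"
proof -
  have w': "w \<in> U'" using w by (simp add: mem_Times_iff)
  have bl: "bilinear (H (fst w))" if "w \<in> U'" for w
    using bilinear_H[of "fst w"] that by (auto simp: mem_Times_iff)
  note D = has_derivative_bilinear_field[OF open_U' w' bl differentiable_base[OF H_differentiable[OF w]] a b]
  show "(\<lambda>w. H (fst w) (a w) (b w)) differentiable (at w)"
    using D unfolding differentiable_def by blast
  show "dir_deriv (\<lambda>w. H (fst w) (a w) (b w)) w X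
      = H (fst w) (cov a w X) (b w) + H (fst w) (a w) (cov b w X)"
    using dir_deriv_eqI[OF D, of X] dir_deriv_base[OF H_differentiable[OF w], of "a w" "b w" X]
    by (simp add: dir_deriv_H_lichnerowicz[OF w] cov_def w)
qed

lemma smooth_H_along:
  "smooth_on U' a \<Longrightarrow> smooth_on U' b \<Longrightarrow> smooth_on U' (\<lambda>w. H (fst w) (a w) (b w))"
  by (rule smooth_on_bilinear_field[OF open_U' _ smooth_on_base[OF smooth_H]])
     (auto simp: mem_Times_iff bilinear_H)

lemma smooth_L_along:
  "smooth_on U' b \<Longrightarrow> smooth_on U' (\<lambda>w. L (fst w) \<xi> (b w))"
  by (rule smooth_on_bilinear_field[OF open_U' _ smooth_on_base[OF smooth_lichnerowicz] smooth_on_const])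
     (auto simp: mem_Times_iff bilinear_lichnerowicz)

text \<open>The section of the tautological line bundle given by an affine chart of the projective line.\<close>

definition tautv :: "2 \<Rightarrow> (complex^2) \<times> complex \<Rightarrow> complex^2"
  where "tautv i w = affine_vec i (snd w)"

lemma smooth_tautv: "smooth_on U' (tautv i)"
  unfolding tautv_def using smooth_affine_vec[OF open_U'] by simp

lemma tautv_differentiable: "tautv i differentiable (at w)"
  using smooth_on_differentiable[OF smooth_affine_vec[OF open_UNIV], of w] unfolding tautv_def by simp

lemma dir_deriv_tautv: "dir_deriv (tautv i) w X = affine_dir i (snd X)"
  unfolding tautv_def[abs_def] by (rule dir_deriv_affine_vec)

lemma cov_tautv: "cov (tautv i) w X = affine_dir i (snd X) + L (fst w) (fst X) (tautv i w)"
  unfolding cov_def dir_deriv_tautv ..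

lemma smooth_cov_tautv: "smooth_on U' (\<lambda>w. cov (tautv i) w X)"
  unfolding cov_tautv by (intro smooth_on_add smooth_on_const smooth_L_along smooth_tautv open_U')

lemma cov_curvature:
  assumes w: "fst w \<in> U"
  shows "cov (\<lambda>w. cov (tautv i) w Y) w X - cov (\<lambda>w. cov (tautv i) w X) w Y
    = \<Omega> (fst w) (fst X) (fst Y) (tautv i w)"
proof -
  have w': "w \<in> U'" using w by (simp add: mem_Times_iff)
  have bl: "bilinear (L (fst w))" if "w \<in> U'" for w
    using bilinear_lichnerowicz[of "fst w"] that by (auto simp: mem_Times_iff)
  have Ld: "(\<lambda>w. L (fst w) (fst Y) (tautv i w)) differentiable (at w)" for Y :: "(complex^2) \<times> complex"
    by (rule smooth_on_differentiable[OF smooth_L_along[OF smooth_tautv] w'])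
  have "dir_deriv (\<lambda>w. cov (tautv i) w Y) w X
      = dir_deriv (\<lambda>q. L q (fst Y) (tautv i w)) (fst w) (fst X) + L (fst w) (fst Y) (affine_dir i (snd X))" for X Y
    using dir_deriv_add[OF differentiable_const Ld, of "affine_dir i (snd Y)" Y X]
      dir_deriv_bilinear_field[OF open_U' w' bl differentiable_base[OF lichnerowicz_differentiable[OF w]]
        differentiable_const tautv_differentiable, of "fst Y" i X]
    by (simp add: cov_tautv dir_deriv_base[OF lichnerowicz_differentiable[OF w]] dir_deriv_tautv
        bilinear_lzero[OF bilinear_lichnerowicz[OF w]])
  then show ?thesis
    unfolding cov_def[of "\<lambda>w. cov (tautv i) w _"] connection_curvature_def
    by (simp add: cov_tautv bilinear_radd[OF bilinear_lichnerowicz[OF w]])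
qed

subsection \<open>The vertical part of the fundamental forms\<close>

definition taut_norm :: "2 \<Rightarrow> (complex^2) \<times> complex \<Rightarrow> complex"
  where "taut_norm i w = H (fst w) (tautv i w) (tautv i w)"

text \<open>The Fubini-Study form of the fibres, extended to all tangent vectors by the connection. Its
  value at \<open>(Y, X)\<close> is the product of \<open>\<phi>\<^sup>3(X)\<close> and of the conjugate of \<open>\<phi>\<^sup>3(Y)\<close>.\<close>

definition fubini_study :: "2 \<Rightarrow> (complex^2) \<times> complex \<Rightarrow> (complex^2) \<times> complex \<Rightarrow> (complex^2) \<times> complex \<Rightarrow> complex"
  where "fubini_study i w X Y =
    H (fst w) (cov (tautv i) w X) (cov (tautv i) w Y) / taut_norm i w
    - H (fst w) (cov (tautv i) w X) (tautv i w) * H (fst w) (tautv i w) (cov (tautv i) w Y) / (taut_norm i w)\<^sup>2"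

text \<open>The connection form of the tautological line bundle.\<close>

definition taut_connection :: "2 \<Rightarrow> (complex^2) \<times> complex \<Rightarrow> (complex^2) \<times> complex \<Rightarrow> complex"
  where "taut_connection i w X = H (fst w) (cov (tautv i) w X) (tautv i w) / taut_norm i w"

lemma taut_norm_neq_0: "fst w \<in> U \<Longrightarrow> taut_norm i w \<noteq> 0"
  unfolding taut_norm_def by (rule H_self_neq_0) (simp_all add: tautv_def affine_vec_neq_0)

lemma smooth_divide_taut_norm:
  assumes "smooth_on U' f" shows "smooth_on U' (\<lambda>w. f w / taut_norm i w)"
proof -
  have "smooth_on U' (\<lambda>w. Re (taut_norm i w))"
    unfolding taut_norm_def
    by (rule smooth_on_bounded_linear[OF open_U' bounded_linear_Re smooth_H_along[OF smooth_tautv smooth_tautv]])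
  then have "smooth_on U' (\<lambda>w. inverse (Re (taut_norm i w)))"
    by (rule smooth_on_inverse_real[OF open_U'])
       (auto simp: taut_norm_def mem_Times_iff tautv_def affine_vec_neq_0 intro!: pos)
  then have "smooth_on U' (\<lambda>w. f w * complex_of_real (inverse (Re (taut_norm i w))))"
    by (intro smooth_on_mult open_U' assms smooth_on_bounded_linear[OF open_U' bounded_linear_of_real])
  moreover have "f w * complex_of_real (inverse (Re (taut_norm i w))) = f w / taut_norm i w" if "w \<in> U'" for w
    using that by (auto simp: taut_norm_def H_self mem_Times_iff divide_inverse)
  ultimately show ?thesis by (subst (asm) smooth_on_cong[OF open_U']) auto
qed

lemma smooth_taut_connection: "smooth_on U' (\<lambda>w. taut_connection i w X)"
  unfolding taut_connection_def
  by (intro smooth_divide_taut_norm smooth_H_along smooth_cov_tautv smooth_tautv)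

text \<open>The Gauss equation for a line subbundle: its curvature is that of the ambient connection,
  corrected by the square of the second fundamental form. For the tautological line bundle this
  square is the Fubini-Study form.\<close>

lemma taut_connection_curvature:
  assumes w: "fst w \<in> U"
  shows "dir_deriv (\<lambda>w. taut_connection i w Y) w X - dir_deriv (\<lambda>w. taut_connection i w X) w Y
    = H (fst w) (\<Omega> (fst w) (fst X) (fst Y) (tautv i w)) (tautv i w) / taut_norm i w
      + fubini_study i w Y X - fubini_study i w X Y"
proof -
  have w': "w \<in> U'" using w by (simp add: mem_Times_iff)
  define N v D where "N = taut_norm i w" and "v = tautv i w" and "D = cov (tautv i) w"
  define DD where "DD = (\<lambda>X Y. cov (\<lambda>w. cov (tautv i) w Y) w X)"
  define h where "h = H (fst w)"
  have N: "N \<noteq> 0" using taut_norm_neq_0[OF w] by (simp add: N_def)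
  note dv = tautv_differentiable
  note dD = smooth_on_differentiable[OF smooth_cov_tautv w']
  have dN: "taut_norm i differentiable (at w)" "dir_deriv (taut_norm i) w X = h (D X) v + h v (D X)" for X
    using H_along[OF w dv dv] unfolding taut_norm_def[abs_def] h_def D_def v_def by auto
  have "dir_deriv (\<lambda>w. taut_connection i w Y) w X
      = ((h (DD X Y) v + h (D Y) (D X)) * N - h (D Y) v * (h (D X) v + h v (D X))) / (N * N)" for X Y
    unfolding taut_connection_def
    using dir_deriv_divide[OF H_along(1)[OF w dD dv] dN(1)] N H_along(2)[OF w dD dv]
    by (simp add: dN(2) h_def D_def DD_def v_def N_def)
  note eq = this
  have "dir_deriv (\<lambda>w. taut_connection i w Y) w X - dir_deriv (\<lambda>w. taut_connection i w X) w Y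
     = (h (DD X Y) v - h (DD Y X) v + h (D Y) (D X) - h (D X) (D Y)) / N
       + (h (D X) v * h v (D Y) - h (D Y) v * h v (D X)) / N\<^sup>2"
    unfolding eq using N by (simp add: field_simps power2_eq_square)
  also have "h (DD X Y) v - h (DD Y X) v = h (DD X Y - DD Y X) v"
    by (simp add: h_def w)
  also have "DD X Y - DD Y X = \<Omega> (fst w) (fst X) (fst Y) v"
    unfolding DD_def v_def by (rule cov_curvature[OF w])
  finally show ?thesis
    unfolding fubini_study_def h_def D_def v_def N_def by (simp add: add_divide_distrib diff_divide_distrib)
qed

end

subsection \<open>Closedness\<close>

context hermitian_metric
begin

text \<open>Minus \<open>\<i>\<close> times the fundamental form of the metric.\<close>

definition herm_form :: "complex^2 \<Rightarrow> complex^2 \<Rightarrow> complex^2 \<Rightarrow> complex"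
  where "herm_form p X Y = (H p X Y - H p Y X) / 2"

text \<open>The curvature tensor of complex space forms, up to scalar endomorphisms and a factor.\<close>

definition model_curvature :: "complex^2 \<Rightarrow> complex^2 \<Rightarrow> complex^2 \<Rightarrow> complex^2 \<Rightarrow> complex^2"
  where "model_curvature p X Y v = H p v Y *s X - H p v X *s Y"

text \<open>The endomorphism \<open>T(X,Y)\<close> whose scalarity decides whether the semibasic form below is constant
  along the fibres.\<close>

definition obstruction :: "real \<Rightarrow> real \<Rightarrow> complex^2 \<Rightarrow> complex^2 \<Rightarrow> complex^2 \<Rightarrow> complex^2 \<Rightarrow> complex^2"
  where "obstruction a m p X Y v = complex_of_real a *s model_curvature p X Y v - complex_of_real m *s \<Omega> p X Y v"

text \<open>The fundamental forms of the twistor space for suitable \<open>a, b, m\<close>. The coefficient of \<open>a\<close> is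
  twice the form \<open>\<phi>\<^sup>1 \<and> \<phi>\<^sup>1\<close>-conjugate, that of \<open>b\<close> is the sum of this form and of its analogue for
  \<open>\<phi>\<^sup>2\<close>, and that of \<open>m\<close> is the analogue for \<open>\<phi>\<^sup>3\<close>.\<close>

definition twistor_form :: "2 \<Rightarrow> real \<Rightarrow> real \<Rightarrow> real \<Rightarrow> (complex^2) \<times> complex \<Rightarrow>
    (complex^2) \<times> complex \<Rightarrow> (complex^2) \<times> complex \<Rightarrow> complex"
  where "twistor_form i a b m w X Y = \<i> * (complex_of_real a *
      ((H (fst w) (fst X) (tautv i w) * H (fst w) (tautv i w) (fst Y)
      - H (fst w) (fst Y) (tautv i w) * H (fst w) (tautv i w) (fst X)) / taut_norm i w)
    + complex_of_real b * herm_form (fst w) (fst X) (fst Y)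
    + complex_of_real m * (fubini_study i w Y X - fubini_study i w X Y))"

definition semibasic_form :: "2 \<Rightarrow> real \<Rightarrow> real \<Rightarrow> real \<Rightarrow> (complex^2) \<times> complex \<Rightarrow>
    (complex^2) \<times> complex \<Rightarrow> (complex^2) \<times> complex \<Rightarrow> complex"
  where "semibasic_form i a b m w X Y =
      H (fst w) (obstruction a m (fst w) (fst X) (fst Y) (tautv i w)) (tautv i w) / taut_norm i w
    + complex_of_real b * herm_form (fst w) (fst X) (fst Y)"

lemma lichnerowicz_curvature_add:
  assumes p: "p \<in> U" shows "\<Omega> p X Y (x + y) = \<Omega> p X Y x + \<Omega> p X Y y"
proof -
  note b = bilinear_lichnerowicz
  have "linear (\<lambda>Z. dir_deriv (\<lambda>q. L q Y Z) p X)" for X Y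
    by (rule dir_deriv_linear_family[OF p _ lichnerowicz_differentiable[OF p]])
       (use b in \<open>auto simp: bilinear_def\<close>)
  from linear_add[OF this] show ?thesis
    by (simp add: connection_curvature_def bilinear_radd[OF b[OF p]])
qed

lemma lichnerowicz_curvature_smult:
  assumes p: "p \<in> U" shows "\<Omega> p X Y (k *s x) = k *s \<Omega> p X Y x"
proof -
  have "dir_deriv (\<lambda>q. L q Y (k *s x)) p X = k *s dir_deriv (\<lambda>q. L q Y x) p X" for X Y
    unfolding dir_deriv_bounded_linear[OF bounded_linear_smult lichnerowicz_differentiable[OF p], symmetric]
    by (rule dir_deriv_cong[OF open_U p]) (rule lichnerowicz_smult)
  then show ?thesis
    by (simp add: connection_curvature_def lichnerowicz_smult[OF p] vector_ssub_ldistrib vector_add_ldistrib)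
qed

lemma lichnerowicz_curvature_zero:
  assumes p: "p \<in> U" shows "\<Omega> p X 0 Z = 0" "\<Omega> p 0 X Z = 0"
proof -
  have "dir_deriv (\<lambda>q. L q 0 Z) p X = dir_deriv (\<lambda>q. 0) p X" for X
    by (rule dir_deriv_cong[OF open_U p]) (simp add: bilinear_lzero[OF bilinear_lichnerowicz])
  then have 0: "dir_deriv (\<lambda>q. L q 0 Z) p X = 0" for X by simp
  note b = bilinear_lichnerowicz[OF p]
  have 1: "dir_deriv (\<lambda>q. L q X Z) p 0 = 0"
    using linear_0[OF linear_dir_deriv[OF lichnerowicz_differentiable[OF p]]] .
  show "\<Omega> p X 0 Z = 0" "\<Omega> p 0 X Z = 0"
    by (simp_all add: connection_curvature_def 0 1 bilinear_lzero[OF b] bilinear_rzero[OF b])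
qed

lemma obstruction_add:
  "p \<in> U \<Longrightarrow> obstruction a m p X Y (x + y) = obstruction a m p X Y x + obstruction a m p X Y y"
  by (simp add: obstruction_def model_curvature_def lichnerowicz_curvature_add vec_eq_iff algebra_simps)

lemma obstruction_smult:
  "p \<in> U \<Longrightarrow> obstruction a m p X Y (k *s x) = k *s obstruction a m p X Y x"
  by (simp add: obstruction_def model_curvature_def lichnerowicz_curvature_smult vec_eq_iff algebra_simps)

lemma obstruction_zero: "p \<in> U \<Longrightarrow> obstruction a m p X 0 v = 0" "p \<in> U \<Longrightarrow> obstruction a m p 0 X v = 0"
  by (simp_all add: obstruction_def model_curvature_def lichnerowicz_curvature_zero)

lemma H_obstruction:
  "p \<in> U \<Longrightarrow> H p (obstruction a m p X Y v) v
   = complex_of_real a * (H p X v * H p v Y - H p Y v * H p v X) - complex_of_real m * H p (\<Omega> p X Y v) v"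
  by (simp add: obstruction_def model_curvature_def algebra_simps)

lemma smooth_cov: "smooth_on U' a \<Longrightarrow> smooth_on U' (\<lambda>w. cov a w X)"
  unfolding cov_def by (intro smooth_on_add smooth_on_dir_deriv smooth_L_along open_U')

lemma smooth_semibasic_form: "smooth_on U' (\<lambda>w. semibasic_form i a b m w X Y)"
proof -
  have "smooth_on U' (\<lambda>w. \<Omega> (fst w) (fst X) (fst Y) (tautv i w))"
  proof (subst smooth_on_cong[OF open_U'])
    show "smooth_on U' (\<lambda>w. cov (\<lambda>w. cov (tautv i) w Y) w X - cov (\<lambda>w. cov (tautv i) w X) w Y)"
      by (intro smooth_on_diff smooth_cov smooth_tautv open_U')
    show "\<Omega> (fst w) (fst X) (fst Y) (tautv i w) = cov (\<lambda>w. cov (tautv i) w Y) w X - cov (\<lambda>w. cov (tautv i) w X) w Y"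
      if "w \<in> U'" for w
      using that by (subst cov_curvature) (auto simp: mem_Times_iff)
  qed
  then have "smooth_on U' (\<lambda>w. (complex_of_real a * (H (fst w) (fst X) (tautv i w) * H (fst w) (tautv i w) (fst Y)
      - H (fst w) (fst Y) (tautv i w) * H (fst w) (tautv i w) (fst X))
      - complex_of_real m * H (fst w) (\<Omega> (fst w) (fst X) (fst Y) (tautv i w)) (tautv i w)) / taut_norm i w
    + complex_of_real b * ((H (fst w) (fst X) (fst Y) - H (fst w) (fst Y) (fst X)) * (1/2)))"
    by (intro smooth_on_add smooth_on_diff smooth_on_mult smooth_divide_taut_norm smooth_H_along
        smooth_tautv smooth_on_const open_U')
  then show ?thesis
    by (subst smooth_on_cong[OF open_U']) (auto simp: semibasic_form_def H_obstruction herm_form_def)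
qed

text \<open>By the Gauss equation for the tautological line bundle, the vertical part of the fundamental
  forms is exact.\<close>

lemma twistor_form_eq:
  assumes w: "fst w \<in> U"
  shows "twistor_form i a b m w X Y = \<i> * (semibasic_form i a b m w X Y + complex_of_real m *
     (dir_deriv (\<lambda>w. taut_connection i w Y) w X - dir_deriv (\<lambda>w. taut_connection i w X) w Y))"
  unfolding taut_connection_curvature[OF w] twistor_form_def semibasic_form_def H_obstruction[OF w]
  by (simp add: algebra_simps add_divide_distrib diff_divide_distrib)

lemma ext_deriv2_twistor_form:
  assumes w: "w \<in> U'"
  shows "ext_deriv2 (twistor_form i a b m) w X Y Z = \<i> * ext_deriv2 (semibasic_form i a b m) w X Y Z"
proof -
  define d where "d = (\<lambda>w X Y. dir_deriv (\<lambda>w. taut_connection i w Y) w X - dir_deriv (\<lambda>w. taut_connection i w X) w Y)"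
  have d: "(\<lambda>w. d w X Y) differentiable (at w)" for X Y
    unfolding d_def
    by (intro differentiable_diff smooth_on_differentiable[OF smooth_on_dir_deriv[OF smooth_taut_connection] w])
  have "ext_deriv2 d w X Y Z = 0"
    unfolding d_def by (rule ext_deriv2_exact[OF open_U' w smooth_taut_connection])
  then have 0: "ext_deriv2 (\<lambda>w X Y. complex_of_real m * d w X Y) w X Y Z = 0"
    by (subst ext_deriv2_bounded_linear[OF bounded_linear_mult_right d]) simp
  have md: "(\<lambda>w. complex_of_real m * d w X Y) differentiable (at w)" for X Y
    by (rule differentiable_bounded_linear[OF bounded_linear_mult_right d])
  have s: "(\<lambda>w. semibasic_form i a b m w X Y) differentiable (at w)" for X Y
    by (rule smooth_on_differentiable[OF smooth_semibasic_form w])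
  have "ext_deriv2 (twistor_form i a b m) w X Y Z
      = ext_deriv2 (\<lambda>w X Y. \<i> * (semibasic_form i a b m w X Y + complex_of_real m * d w X Y)) w X Y Z"
    by (rule ext_deriv2_cong[OF open_U' w]) (auto simp: twistor_form_eq d_def mem_Times_iff)
  also have "\<dots> = \<i> * ext_deriv2 (\<lambda>w X Y. semibasic_form i a b m w X Y + complex_of_real m * d w X Y) w X Y Z"
    by (rule ext_deriv2_bounded_linear[OF bounded_linear_mult_right differentiable_add[OF s md]])
  also have "\<dots> = \<i> * ext_deriv2 (semibasic_form i a b m) w X Y Z"
    by (simp add: ext_deriv2_add[OF s md] 0)
  finally show ?thesis .
qed

text \<open>Contracting the exterior derivative of a form without vertical legs with a vertical vector gives
  the vertical derivative of the form. If it vanishes, the form is constant along the fibres, and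
  the endomorphism \<open>T(X,Y)\<close> is scalar because \<open>H(T(X,Y)v,v) / H(v,v)\<close> does not depend on \<open>v\<close>.\<close>

lemma closed_semibasic_imp_scalar:
  assumes closed: "\<And>w X Y Z. w \<in> U' \<Longrightarrow> ext_deriv2 (semibasic_form i a b m) w X Y Z = 0" and p: "p \<in> U"
  shows "\<exists>c. \<forall>v. obstruction a m p X Y v = c *s v"
proof -
  define F where "F w = semibasic_form i a b m w (X, 0) (Y, 0)" for w
  have "((\<lambda>t. F (p, t)) has_derivative (\<lambda>\<tau>. 0)) (at t within UNIV)" for t
  proof -
    have w: "(p, t) \<in> U'" using p by simp
    have z: "dir_deriv (\<lambda>w. semibasic_form i a b m w (V, 0) (0, \<tau>)) (p, t) W = 0" for V \<tau> W
    proof -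
      have "dir_deriv (\<lambda>w. semibasic_form i a b m w (V, 0) (0, \<tau>)) (p, t) W = dir_deriv (\<lambda>w. 0) (p, t) W"
        by (rule dir_deriv_cong[OF open_U' w])
           (auto simp: semibasic_form_def obstruction_zero herm_form_def)
      then show ?thesis by simp
    qed
    have "dir_deriv F (p, t) (0, \<tau>) = 0" for \<tau>
      using closed[OF w, of "(X, 0)" "(Y, 0)" "(0, \<tau>)"]
      unfolding ext_deriv2_def z F_def by simp
    moreover have "((\<lambda>t. F (p, t)) has_derivative (\<lambda>\<tau>. dir_deriv F (p, t) (0, \<tau>))) (at t)"
    proof -
      have 1: "(Pair p has_derivative Pair 0) (at t)"
        by (intro has_derivative_Pair has_derivative_const has_derivative_ident)
      have 2: "(F has_derivative dir_deriv F (p, t)) (at (p, t))"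
        unfolding F_def
        by (rule differentiable_imp_dir_deriv[OF smooth_on_differentiable[OF smooth_semibasic_form w]])
      show ?thesis by (rule has_derivative_compose[OF 1 2])
    qed
    ultimately show ?thesis by simp
  qed
  then obtain c where c: "F (p, t) = c" for t
    using has_derivative_zero_constant[OF convex_UNIV, of "\<lambda>t. F (p, t)"] by auto
  \<comment> \<open>the \<open>b\<close>-term is constant along the fibres anyway\<close>
  define c' where "c' = c - complex_of_real b * herm_form p X Y"
  have "obstruction a m p X Y x - c' *s x = 0" for x
  proof (rule endomorphism_eq_0I[OF p, where i = i and F = "\<lambda>x. obstruction a m p X Y x - c' *s x"])
    show "obstruction a m p X Y (x + y) - c' *s (x + y)
        = obstruction a m p X Y x - c' *s x + (obstruction a m p X Y y - c' *s y)" for x y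
      by (simp add: obstruction_add[OF p] vec_eq_iff algebra_simps)
    show "obstruction a m p X Y (k *s x) - c' *s (k *s x) = k *s (obstruction a m p X Y x - c' *s x)" for k x
      by (simp add: obstruction_smult[OF p] vec_eq_iff algebra_simps)
    show "H p (obstruction a m p X Y (affine_vec i t) - c' *s affine_vec i t) (affine_vec i t) = 0" for t
    proof -
      have N: "H p (affine_vec i t) (affine_vec i t) \<noteq> 0"
        by (rule H_self_neq_0[OF p affine_vec_neq_0])
      have "H p (obstruction a m p X Y (affine_vec i t)) (affine_vec i t) / H p (affine_vec i t) (affine_vec i t) = c'"
        using c[of t] by (simp add: F_def semibasic_form_def taut_norm_def tautv_def c'_def algebra_simps)
      then show ?thesis using N by (simp add: p field_simps)
    qed
  qed
  then show ?thesis by (intro exI[of _ c']) simp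
qed

definition ctrace :: "(complex^2 \<Rightarrow> complex^2) \<Rightarrow> complex"
  where "ctrace F = F (axis 1 1) $ 1 + F (axis 2 1) $ 2"

text \<open>The trace of the curvature is the curvature of the determinant line bundle, hence closed.\<close>

lemma ctrace_lichnerowicz_curvature:
  assumes p: "p \<in> U"
  shows "ctrace (\<Omega> p X Y) = dir_deriv (\<lambda>q. ctrace (L q Y)) p X - dir_deriv (\<lambda>q. ctrace (L q X)) p Y"
proof -
  have d: "dir_deriv (\<lambda>q. ctrace (L q Y)) p X
      = dir_deriv (\<lambda>q. L q Y (axis 1 1)) p X $ 1 + dir_deriv (\<lambda>q. L q Y (axis 2 1)) p X $ 2" for X Y
  proof -
    note l = lichnerowicz_differentiable[OF p]
    note n = bounded_linear_vec_nth
    show ?thesis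
      unfolding ctrace_def dir_deriv_add[OF differentiable_bounded_linear[OF n l] differentiable_bounded_linear[OF n l]]
      by (simp only: dir_deriv_bounded_linear[OF n l])
  qed
  have L: "L p X (L p Y e) = (L p Y e) $ 1 *s L p X (axis 1 1) + (L p Y e) $ 2 *s L p X (axis 2 1)" for X Y e
    by (subst vec2_expand[of "L p Y e"])
       (simp only: bilinear_radd[OF bilinear_lichnerowicz[OF p]] lichnerowicz_smult[OF p])
  show ?thesis
    unfolding d unfolding ctrace_def connection_curvature_def
    by (subst (1 2 3 4) L) (simp add: algebra_simps)
qed

lemma ctrace_model_curvature:
  assumes p: "p \<in> U" shows "ctrace (model_curvature p X Y) = 2 * herm_form p X Y"
proof -
  have "H p X Y = X$1 * H p (axis 1 1) Y + X$2 * H p (axis 2 1) Y" for X Y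
    by (subst vec2_expand[of X]) (simp add: p)
  from this[of X Y] this[of Y X] show ?thesis
    by (simp add: ctrace_def model_curvature_def herm_form_def algebra_simps)
qed

lemma smooth_herm_form: "smooth_on U (\<lambda>p. herm_form p X Y)"
proof -
  have "smooth_on U (\<lambda>p. (H p X Y - H p Y X) * (1/2))"
    by (intro smooth_on_mult smooth_on_diff smooth_on_const smooth_H open_U)
  then show ?thesis by (simp add: herm_form_def)
qed

text \<open>A scalar endomorphism of a complex plane is half of its trace. The trace of the curvature is
  closed, and that of the model curvature is a multiple of the fundamental form.\<close>

lemma ext_deriv2_semibasic_scalar:
  assumes sc: "\<And>p X Y. p \<in> U \<Longrightarrow> \<exists>c. \<forall>v. obstruction a m p X Y v = c *s v" and w: "w \<in> U'"
  shows "ext_deriv2 (semibasic_form i a b m) w X Y Z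
    = complex_of_real (a + b) * ext_deriv2 herm_form (fst w) (fst X) (fst Y) (fst Z)"
proof -
  define d where "d = (\<lambda>p X Y. dir_deriv (\<lambda>q. ctrace (L q Y)) p X - dir_deriv (\<lambda>q. ctrace (L q X)) p Y)"
  define G where "G = (\<lambda>p X Y. complex_of_real (a + b) * herm_form p X Y + - (complex_of_real m / 2) * d p X Y)"
  have p: "fst w \<in> U" using w by (simp add: mem_Times_iff)
  have smL: "smooth_on U (\<lambda>q. ctrace (L q Y))" for Y
    unfolding ctrace_def
    by (intro smooth_on_add open_U smooth_on_bounded_linear[OF open_U bounded_linear_vec_nth] smooth_lichnerowicz)
  have dd: "(\<lambda>p. d p X Y) differentiable (at (fst w))" for X Y
    unfolding d_def
    by (intro differentiable_diff smooth_on_differentiable[OF smooth_on_dir_deriv[OF smL] p])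
  have hd: "(\<lambda>p. herm_form p X Y) differentiable (at (fst w))" for X Y
    by (rule smooth_on_differentiable[OF smooth_herm_form p])
  note d1 = differentiable_bounded_linear[OF bounded_linear_mult_right hd]
  note d2 = differentiable_bounded_linear[OF bounded_linear_mult_right dd]
  have "semibasic_form i a b m w X Y = G (fst w) (fst X) (fst Y)" if w: "w \<in> U'" for w X Y
  proof -
    have p: "fst w \<in> U" using w by (simp add: mem_Times_iff)
    obtain c where c: "\<And>v. obstruction a m (fst w) (fst X) (fst Y) v = c *s v" using sc[OF p] by blast
    have "2 * c = ctrace (obstruction a m (fst w) (fst X) (fst Y))"
      by (simp add: ctrace_def c)
    also have "\<dots> = complex_of_real a * ctrace (model_curvature (fst w) (fst X) (fst Y))
        - complex_of_real m * ctrace (\<Omega> (fst w) (fst X) (fst Y))"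
      by (simp add: ctrace_def obstruction_def algebra_simps)
    finally have "2 * c = 2 * (complex_of_real a * herm_form (fst w) (fst X) (fst Y) - complex_of_real m / 2 * d (fst w) (fst X) (fst Y))"
      by (simp add: ctrace_model_curvature[OF p] ctrace_lichnerowicz_curvature[OF p] d_def algebra_simps)
    then have "c = complex_of_real a * herm_form (fst w) (fst X) (fst Y) - complex_of_real m / 2 * d (fst w) (fst X) (fst Y)"
      by (simp only: mult_cancel_left) simp
    moreover have "semibasic_form i a b m w X Y = c + complex_of_real b * herm_form (fst w) (fst X) (fst Y)"
      using taut_norm_neq_0[OF p, of i] unfolding semibasic_form_def c by (simp add: p taut_norm_def)
    ultimately show ?thesis by (simp add: G_def algebra_simps)
  qed
  then have "ext_deriv2 (semibasic_form i a b m) w X Y Z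
      = ext_deriv2 (\<lambda>w X Y. G (fst w) (fst X) (fst Y)) w X Y Z"
    by (rule ext_deriv2_cong[OF open_U' w])
  also have "\<dots> = ext_deriv2 G (fst w) (fst X) (fst Y) (fst Z)"
    by (rule ext_deriv2_pullback_linear[OF bounded_linear_fst])
       (unfold G_def, rule differentiable_add[OF d1 d2])
  also have "\<dots> = complex_of_real (a + b) * ext_deriv2 herm_form (fst w) (fst X) (fst Y) (fst Z)
      + - (complex_of_real m / 2) * ext_deriv2 d (fst w) (fst X) (fst Y) (fst Z)"
    unfolding G_def ext_deriv2_add[OF d1 d2] ext_deriv2_bounded_linear[OF bounded_linear_mult_right hd]
      ext_deriv2_bounded_linear[OF bounded_linear_mult_right dd] ..
  also have "ext_deriv2 d (fst w) (fst X) (fst Y) (fst Z) = 0"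
    unfolding d_def by (rule ext_deriv2_exact[OF open_U p smL])
  finally show ?thesis by simp
qed

theorem twistor_form_closed_iff:
  "(\<forall>w\<in>U'. \<forall>X Y Z. ext_deriv2 (twistor_form i a b m) w X Y Z = 0) \<longleftrightarrow>
   (\<forall>p\<in>U. \<forall>X Y. \<exists>c. \<forall>v. obstruction a m p X Y v = c *s v) \<and>
   (a + b = 0 \<or> (\<forall>p\<in>U. \<forall>X Y Z. ext_deriv2 herm_form p X Y Z = 0))"
  (is "?closed \<longleftrightarrow> ?scalar \<and> ?rest")
proof -
  have closed: "?closed \<longleftrightarrow> (\<forall>w\<in>U'. \<forall>X Y Z. ext_deriv2 (semibasic_form i a b m) w X Y Z = 0)"
    by (simp add: ext_deriv2_twistor_form)
  have 1: "?closed \<Longrightarrow> ?scalar"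
    unfolding closed using closed_semibasic_imp_scalar by blast
  have 2: "?closed \<longleftrightarrow> ?rest" if ?scalar
  proof -
    have e: "ext_deriv2 (semibasic_form i a b m) w X Y Z
      = complex_of_real (a + b) * ext_deriv2 herm_form (fst w) (fst X) (fst Y) (fst Z)" if "w \<in> U'" for w X Y Z
      using ext_deriv2_semibasic_scalar[OF _ that] \<open>?scalar\<close> by blast
    show ?thesis unfolding closed
    proof
      assume *: "\<forall>w\<in>U'. \<forall>X Y Z. ext_deriv2 (semibasic_form i a b m) w X Y Z = 0"
      have "complex_of_real (a + b) * ext_deriv2 herm_form p X Y Z = 0" if "p \<in> U" for p X Y Z
        using *[rule_format, of "(p, 0)" "(X, 0)" "(Y, 0)" "(Z, 0)"] e[of "(p, 0)" "(X, 0)" "(Y, 0)" "(Z, 0)"] that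
        by simp
      then show ?rest by (metis mult_eq_0_iff of_real_eq_0_iff)
    next
      assume ?rest
      then show "\<forall>w\<in>U'. \<forall>X Y Z. ext_deriv2 (semibasic_form i a b m) w X Y Z = 0"
        by (auto simp: e simp del: of_real_add)
    qed
  qed
  show ?thesis using 1 2 by blast
qed

lemma ext_deriv2_herm_form:
  assumes p: "p \<in> U"
  shows "ext_deriv2 herm_form p X Y Z = - \<i> * complex_of_real (ext_deriv2 (\<lambda>p X Y. g p (\<i> *s X) Y) p X Y Z)"
proof -
  have "ext_deriv2 herm_form p X Y Z = ext_deriv2 (\<lambda>p X Y. - \<i> * complex_of_real (g p (\<i> *s X) Y)) p X Y Z"
  proof (rule ext_deriv2_cong[OF open_U p])
    fix q X Y assume q: "q \<in> U"
    show "herm_form q X Y = - \<i> * complex_of_real (g q (\<i> *s X) Y)"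
      using sym[OF q, of X Y] sym[OF q, of Y "\<i> *s X"] g_i_right[OF q, of X Y]
      by (simp add: herm_form_def complex_eq_iff Im_H)
  qed
  also have "\<dots> = - \<i> * complex_of_real (ext_deriv2 (\<lambda>p X Y. g p (\<i> *s X) Y) p X Y Z)"
    by (rule ext_deriv2_bounded_linear[OF bounded_linear_compose[OF bounded_linear_mult_right bounded_linear_of_real]])
       (rule g_differentiable[OF p])
  finally show ?thesis .
qed

end

section \<open>Algebraic curvature tensors in dimension four\<close>

lemma ball_4: "(\<forall>i\<in>{1..4::nat}. P i) \<longleftrightarrow> P 1 \<and> P 2 \<and> P 3 \<and> P 4"
proof -
  have "{1..4::nat} = {1, 2, 3, 4}" by auto
  then show ?thesis by simp
qed

lemma sum_4: "sum f {1..4::nat} = f 1 + f 2 + f 3 + f 4"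
proof -
  have "{1..4::nat} = {1, 2, 3, 4}" by auto
  then show ?thesis by (simp add: add.assoc)
qed

text \<open>The components of the curvature tensor of the unit sphere.\<close>

definition sphere_curv :: "nat \<Rightarrow> nat \<Rightarrow> nat \<Rightarrow> nat \<Rightarrow> real"
  where "sphere_curv i j k l = (if j = k \<and> i = l then 1 else 0) - (if i = k \<and> j = l then 1 else 0)"

text \<open>The anti-self-dual part of the 2-form with components \<open>a\<close> vanishes.\<close>

definition asd_null :: "(nat \<Rightarrow> nat \<Rightarrow> real) \<Rightarrow> bool"
  where "asd_null a \<longleftrightarrow> a 1 2 - a 3 4 = 0 \<and> a 1 3 + a 2 4 = 0 \<and> a 1 4 - a 2 3 = 0"

locale curvature_components =
  fixes r :: "nat \<Rightarrow> nat \<Rightarrow> nat \<Rightarrow> nat \<Rightarrow> real"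
  assumes skew_left: "r i j k l = - r j i k l"
    and skew_right: "r i j k l = - r i j l k"
    and bianchi: "r i j k l + r j k i l + r k i j l = 0"
begin

lemma pair_sym: "r i j k l = r k l i j"
  using bianchi[of i j k l] bianchi[of j k l i] bianchi[of k l i j] bianchi[of l i j k]
    skew_right[of j k l i] skew_right[of k l j i] skew_right[of l i k j] skew_left[of i k l j]
    skew_right[of i j l k] skew_left[of j l i k] skew_right[of l j i k] skew_right[of k i l j] skew_left[of k i l j]
    skew_right[of k i j l] 
  by linarith

definition ric :: "nat \<Rightarrow> nat \<Rightarrow> real"
  where "ric j k = (\<Sum>i\<in>{1..4}. r i j k i)"

definition scal :: real
  where "scal = (\<Sum>j\<in>{1..4}. ric j j)"

definition sch :: "nat \<Rightarrow> nat \<Rightarrow> real"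
  where "sch j k = (ric j k - scal / 6 * (if j = k then 1 else 0)) / 2"

definition w :: "nat \<Rightarrow> nat \<Rightarrow> nat \<Rightarrow> nat \<Rightarrow> real"
  where "w i j k l = r i j k l
    - (sch j k * (if i = l then 1 else 0) - sch i k * (if j = l then 1 else 0)
       + (if j = k then 1 else 0) * sch i l - (if i = k then 1 else 0) * sch j l)"

text \<open>As rewrite rules these identities bring each component to the form in which both index pairs
  are increasing and the pairs are ordered lexicographically; one Bianchi identity remains.\<close>

lemma canonical:
  "r i i k l = 0" "r i j k k = 0"
  "j < i \<Longrightarrow> r i j k l = - r j i k l" "l < k \<Longrightarrow> r i j k l = - r i j l k"
  "k < i \<or> k = i \<and> l < j \<Longrightarrow> r i j k l = r k l i j"
proof -
  show "r i i k l = 0" using skew_left[of i i k l] by simp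
  show "r i j k k = 0" using skew_right[of i j k k] by simp
  show "r i j k l = - r j i k l" by (rule skew_left)
  show "r i j k l = - r i j l k" by (rule skew_right)
  show "r i j k l = r k l i j" by (rule pair_sym)
qed

lemma bianchi_1234: "r 1 2 3 4 = r 1 3 2 4 - r 1 4 2 3"
  using bianchi[of 1 2 3 4] skew_left[of 3 1 2 4] pair_sym[of 2 3 1 4] by linarith

text \<open>The part of the curvature operator with values in the anti-self-dual forms consists of the
  trace-free Ricci tensor, on self-dual forms, and of \<open>W\<^sup>- + s/12\<close>, on anti-self-dual ones.\<close>

lemma asd_curvature_iff:
  "(\<forall>i\<in>{1..4}. \<forall>j\<in>{1..4}. asd_null (\<lambda>k l. r i j k l - m * sphere_curv i j k l)) \<longleftrightarrow>
   (\<forall>k\<in>{1..4}. \<forall>l\<in>{1..4}. asd_null (\<lambda>i j. w i j k l)) \<and>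
   (\<forall>j\<in>{1..4}. \<forall>k\<in>{1..4}. ric j k - scal / 4 * (if j = k then 1 else 0) = 0) \<and> scal = 12 * m"
  (is "?C \<longleftrightarrow> ?W \<and> ?E \<and> ?S")
proof -
  note [simp del] = One_nat_def
  have ric: "ric 1 1 = - r 1 2 1 2 - r 1 3 1 3 - r 1 4 1 4" "ric 2 2 = - r 1 2 1 2 - r 2 3 2 3 - r 2 4 2 4"
    "ric 3 3 = - r 1 3 1 3 - r 2 3 2 3 - r 3 4 3 4" "ric 4 4 = - r 1 4 1 4 - r 2 4 2 4 - r 3 4 3 4"
    "ric 1 2 = - r 1 3 2 3 - r 1 4 2 4" "ric 1 3 = r 1 2 2 3 - r 1 4 3 4" "ric 1 4 = r 1 2 2 4 + r 1 3 3 4"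
    "ric 2 3 = - r 1 2 1 3 - r 2 4 3 4" "ric 2 4 = - r 1 2 1 4 + r 2 3 3 4" "ric 3 4 = - r 1 3 1 4 - r 2 3 2 4"
    "ric 2 1 = ric 1 2" "ric 3 1 = ric 1 3" "ric 4 1 = ric 1 4" "ric 3 2 = ric 2 3" "ric 4 2 = ric 2 4" "ric 4 3 = ric 3 4"
    by (simp_all add: ric_def sum_4 canonical)
  show ?thesis
  proof
    assume ?C
    then have C: "asd_null (\<lambda>k l. r i j k l - m * sphere_curv i j k l)" if "i \<in> {1..4}" "j \<in> {1..4}" for i j
      using that by blast
    have C12: "r 1 2 1 3 + r 1 2 2 4 = 0" "r 1 2 1 4 - r 1 2 2 3 = 0" "r 1 2 1 2 - r 1 2 3 4 = - m"
      using C[of 1 2] by (simp_all add: asd_null_def sphere_curv_def canonical)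
    have C13: "r 1 3 1 3 + r 1 3 2 4 = - m" "r 1 3 1 4 - r 1 3 2 3 = 0" "r 1 2 1 3 - r 1 3 3 4 = 0"
      using C[of 1 3] by (simp_all add: asd_null_def sphere_curv_def canonical)
    have C14: "r 1 3 1 4 + r 1 4 2 4 = 0" "r 1 4 1 4 - r 1 4 2 3 = - m" "r 1 2 1 4 - r 1 4 3 4 = 0"
      using C[of 1 4] by (simp_all add: asd_null_def sphere_curv_def canonical)
    have C23: "r 1 3 2 3 + r 2 3 2 4 = 0" "r 1 4 2 3 - r 2 3 2 3 = m" "r 1 2 2 3 - r 2 3 3 4 = 0"
      using C[of 2 3] by (simp_all add: asd_null_def sphere_curv_def canonical)
    have C24: "r 1 3 2 4 + r 2 4 2 4 = - m" "r 1 4 2 4 - r 2 3 2 4 = 0" "r 1 2 2 4 - r 2 4 3 4 = 0"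
      using C[of 2 4] by (simp_all add: asd_null_def sphere_curv_def canonical)
    have C34: "r 1 3 3 4 + r 2 4 3 4 = 0" "r 1 4 3 4 - r 2 3 3 4 = 0" "r 1 2 3 4 - r 3 4 3 4 = m"
      using C[of 3 4] by (simp_all add: asd_null_def sphere_curv_def canonical)
    note C = C12 C13 C14 C23 C24 C34
    have E: "ric 1 1 = 3 * m" "ric 2 2 = 3 * m" "ric 3 3 = 3 * m" "ric 4 4 = 3 * m"
      "ric 1 2 = 0" "ric 1 3 = 0" "ric 1 4 = 0" "ric 2 3 = 0" "ric 2 4 = 0" "ric 3 4 = 0"
      "ric 2 1 = 0" "ric 3 1 = 0" "ric 4 1 = 0" "ric 3 2 = 0" "ric 4 2 = 0" "ric 4 3 = 0"
      unfolding ric using C bianchi_1234 by linarith+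
    have S: "scal = 12 * m"
      unfolding scal_def sum_4 E by simp
    have ?W
      unfolding ball_4 asd_null_def
      by (intro conjI; simp add: w_def sch_def E S canonical; use C bianchi_1234 in linarith)
    moreover have ?E
      unfolding ball_4 by (intro conjI; simp add: E S)
    ultimately show "?W \<and> ?E \<and> ?S" using S by blast
  next
    assume WES: "?W \<and> ?E \<and> ?S"
    then have S: "scal = 12 * m" by blast
    have E: "ric j k = (if j = k then 3 * m else 0)" if "j \<in> {1..4}" "k \<in> {1..4}" for j k
      using WES that S by auto
    have W: "asd_null (\<lambda>i j. w i j k l)" if "k \<in> {1..4}" "l \<in> {1..4}" for k l
      using WES that by blast
    have C12: "r 1 2 1 2 - r 1 2 3 4 = - m" "r 1 2 1 3 + r 1 2 2 4 = 0" "r 1 2 1 4 - r 1 2 2 3 = 0"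
      using W[of 1 2] by (simp_all add: asd_null_def w_def sch_def E S canonical)
    have C13: "r 1 2 1 3 - r 1 3 3 4 = 0" "r 1 3 1 3 + r 1 3 2 4 = - m" "r 1 3 1 4 - r 1 3 2 3 = 0"
      using W[of 1 3] by (simp_all add: asd_null_def w_def sch_def E S canonical)
    have C14: "r 1 2 1 4 - r 1 4 3 4 = 0" "r 1 3 1 4 + r 1 4 2 4 = 0" "r 1 4 1 4 - r 1 4 2 3 = - m"
      using W[of 1 4] by (simp_all add: asd_null_def w_def sch_def E S canonical)
    have C23: "r 1 2 2 3 - r 2 3 3 4 = 0" "r 1 3 2 3 + r 2 3 2 4 = 0" "r 1 4 2 3 - r 2 3 2 3 = m"
      using W[of 2 3] by (simp_all add: asd_null_def w_def sch_def E S canonical)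
    have C24: "r 1 2 2 4 - r 2 4 3 4 = 0" "r 1 3 2 4 + r 2 4 2 4 = - m" "r 1 4 2 4 - r 2 3 2 4 = 0"
      using W[of 2 4] by (simp_all add: asd_null_def w_def sch_def E S canonical)
    have C34: "r 1 2 3 4 - r 3 4 3 4 = m" "r 1 3 3 4 + r 2 4 3 4 = 0" "r 1 4 3 4 - r 2 3 3 4 = 0"
      using W[of 3 4] by (simp_all add: asd_null_def w_def sch_def E S canonical)
    note C = C12 C13 C14 C23 C24 C34
    show ?C
      unfolding ball_4 asd_null_def
      by (intro conjI; simp add: sphere_curv_def canonical; use C in linarith)
  qed
qed

text \<open>Here the curvature operator takes values in the line of \<open>e\<^sup>1 \<and> e\<^sup>2 + e\<^sup>3 \<and> e\<^sup>4\<close>. By pair symmetry it is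
  a multiple of the projection to this line, and the Bianchi identity excludes a nonzero
  multiple.\<close>

lemma eq_0_if_scalar:
  assumes "\<And>i j. i \<in> {1..4} \<Longrightarrow> j \<in> {1..4} \<Longrightarrow>
     r i j 1 3 = 0 \<and> r i j 1 4 = 0 \<and> r i j 2 3 = 0 \<and> r i j 2 4 = 0 \<and> r i j 1 2 = r i j 3 4"
  shows "\<forall>i\<in>{1..4}. \<forall>j\<in>{1..4}. \<forall>k\<in>{1..4}. \<forall>l\<in>{1..4}. r i j k l = 0"
proof -
  note [simp del] = One_nat_def
  have z12: "r 1 2 1 3 = 0" "r 1 2 1 4 = 0" "r 1 2 2 3 = 0" "r 1 2 2 4 = 0" "r 1 2 1 2 = r 1 2 3 4"
    using assms[of 1 2] by simp_all
  have z13: "r 1 3 1 3 = 0" "r 1 3 1 4 = 0" "r 1 3 2 3 = 0" "r 1 3 2 4 = 0" "r 1 2 1 3 = r 1 3 3 4"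
    using assms[of 1 3] by (simp_all add: canonical)
  have z14: "r 1 4 1 4 = 0" "r 1 4 2 3 = 0" "r 1 4 2 4 = 0" "r 1 2 1 4 = r 1 4 3 4"
    using assms[of 1 4] by (simp_all add: canonical)
  have z23: "r 2 3 2 3 = 0" "r 2 3 2 4 = 0" "r 1 2 2 3 = r 2 3 3 4"
    using assms[of 2 3] by (simp_all add: canonical)
  have z24: "r 2 4 2 4 = 0" "r 1 2 2 4 = r 2 4 3 4"
    using assms[of 2 4] by (simp_all add: canonical)
  have z34: "r 1 2 3 4 = r 3 4 3 4"
    using assms[of 3 4] by (simp_all add: canonical)
  note z = z12 z13 z14 z23 z24 z34
  have "r 1 2 3 4 = 0" using bianchi_1234 z by simp
  then have z0: "r 1 2 1 2 = 0" "r 1 2 3 4 = 0" "r 3 4 3 4 = 0" "r 1 3 3 4 = 0" "r 1 4 3 4 = 0"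
    "r 2 3 3 4 = 0" "r 2 4 3 4 = 0" "r 1 3 1 4 = 0" "r 1 3 2 3 = 0" "r 1 3 2 4 = 0" "r 1 3 1 3 = 0"
    using z by linarith+
  show ?thesis
    unfolding ball_4 by (intro conjI; simp add: canonical z0 z12(1-4) z14(1-3) z23(1,2) z24(1))
qed

end

text \<open>For a skew matrix of order four with orthonormal rows, the dual matrix is the Pfaffian times the
  matrix itself. Comparing norms, the Pfaffian is \<open>1\<close> or \<open>-1\<close>.\<close>

lemma pfaffian_skew_orthogonal:
  fixes F12 F13 F14 F23 F24 F34 :: real
  assumes n1: "F12\<^sup>2 + F13\<^sup>2 + F14\<^sup>2 = 1" and n2: "F12\<^sup>2 + F23\<^sup>2 + F24\<^sup>2 = 1"
    and n3: "F13\<^sup>2 + F23\<^sup>2 + F34\<^sup>2 = 1" and n4: "F14\<^sup>2 + F24\<^sup>2 + F34\<^sup>2 = 1"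
    and o: "F13 * F23 + F14 * F24 = 0" "F14 * F34 - F12 * F23 = 0" "F12 * F24 + F13 * F34 = 0"
    and pos: "F12 * F34 - F13 * F24 + F14 * F23 > 0"
  shows "F12 * F34 - F13 * F24 + F14 * F23 = 1"
proof -
  define Q where "Q = F12 * F34 - F13 * F24 + F14 * F23"
  have "Q * F12 = (F12\<^sup>2 + F13\<^sup>2 + F14\<^sup>2) * F34 - F13 * (F12 * F24 + F13 * F34) - F14 * (F14 * F34 - F12 * F23)"
    by (simp add: Q_def power2_eq_square algebra_simps)
  then have 1: "F34 = Q * F12" by (simp add: n1 o)
  have "Q * F13 = - (F12\<^sup>2 + F13\<^sup>2 + F14\<^sup>2) * F24 + F12 * (F12 * F24 + F13 * F34) + F14 * (F13 * F23 + F14 * F24)"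
    by (simp add: Q_def power2_eq_square algebra_simps)
  then have 2: "F24 = - Q * F13" by (simp add: n1 o)
  have "Q * F14 = (F12\<^sup>2 + F13\<^sup>2 + F14\<^sup>2) * F23 + F12 * (F14 * F34 - F12 * F23) - F13 * (F13 * F23 + F14 * F24)"
    by (simp add: Q_def power2_eq_square algebra_simps)
  then have 3: "F23 = Q * F14" by (simp add: n1 o)
  have "F12\<^sup>2 + Q\<^sup>2 * (F14\<^sup>2 + F13\<^sup>2) = 1" "F13\<^sup>2 + Q\<^sup>2 * (F14\<^sup>2 + F12\<^sup>2) = 1" "F14\<^sup>2 + Q\<^sup>2 * (F13\<^sup>2 + F12\<^sup>2) = 1"
    using n2 n3 n4 unfolding 1 2 3 by (simp_all add: power_mult_distrib algebra_simps)
  then have "(F12\<^sup>2 + F13\<^sup>2 + F14\<^sup>2) + 2 * (Q\<^sup>2 * (F12\<^sup>2 + F13\<^sup>2 + F14\<^sup>2)) = 3"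
    by (simp add: algebra_simps)
  then have "Q\<^sup>2 = 1" by (simp add: n1)
  moreover have "Q > 0" using pos by (simp add: Q_def)
  ultimately show ?thesis by (metis Q_def abs_of_pos power2_eq_1_iff less_asym neg_0_less_iff_less zero_less_one)
qed

text \<open>Complementary minors of a rotation of four-space agree: the bivectors \<open>a \<and> b\<close> and \<open>\<star>(c \<and> d)\<close>
  are unit vectors, and their inner product is the determinant.\<close>

lemma complementary_minors:
  fixes a1 :: real
  assumes n: "a1*a1 + a2*a2 + a3*a3 + a4*a4 = 1" "b1*b1 + b2*b2 + b3*b3 + b4*b4 = 1"
      "c1*c1 + c2*c2 + c3*c3 + c4*c4 = 1" "d1*d1 + d2*d2 + d3*d3 + d4*d4 = 1"
    and o: "a1*b1 + a2*b2 + a3*b3 + a4*b4 = 0" "c1*d1 + c2*d2 + c3*d3 + c4*d4 = 0"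
    and det: "(a1*b2 - a2*b1 + (a3*b4 - a4*b3)) * (c1*d2 - c2*d1 + (c3*d4 - c4*d3))
      - (a1*c2 - a2*c1 + (a3*c4 - a4*c3)) * (b1*d2 - b2*d1 + (b3*d4 - b4*d3))
      + (a1*d2 - a2*d1 + (a3*d4 - a4*d3)) * (b1*c2 - b2*c1 + (b3*c4 - b4*c3)) = 1"
  shows "a1*b2 - a2*b1 = c3*d4 - c4*d3" "a3*b4 - a4*b3 = c1*d2 - c2*d1"
    "a1*b3 - a3*b1 = - (c2*d4 - c4*d2)" "a2*b4 - a4*b2 = - (c1*d3 - c3*d1)"
    "a1*b4 - a4*b1 = c2*d3 - c3*d2" "a2*b3 - a3*b2 = c1*d4 - c4*d1"
proof -
  define p12 p13 p14 p23 p24 p34 where p: "p12 = a1*b2 - a2*b1" "p13 = a1*b3 - a3*b1" "p14 = a1*b4 - a4*b1"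
    "p23 = a2*b3 - a3*b2" "p24 = a2*b4 - a4*b2" "p34 = a3*b4 - a4*b3"
  define q12 q13 q14 q23 q24 q34 where q: "q12 = c1*d2 - c2*d1" "q13 = c1*d3 - c3*d1" "q14 = c1*d4 - c4*d1"
    "q23 = c2*d3 - c3*d2" "q24 = c2*d4 - c4*d2" "q34 = c3*d4 - c4*d3"
  have "p12\<^sup>2 + p13\<^sup>2 + p14\<^sup>2 + p23\<^sup>2 + p24\<^sup>2 + p34\<^sup>2
     = (a1*a1 + a2*a2 + a3*a3 + a4*a4) * (b1*b1 + b2*b2 + b3*b3 + b4*b4) - (a1*b1 + a2*b2 + a3*b3 + a4*b4)\<^sup>2"
    unfolding p power2_eq_square by (simp add: algebra_simps)
  then have P: "p12\<^sup>2 + p13\<^sup>2 + p14\<^sup>2 + p23\<^sup>2 + p24\<^sup>2 + p34\<^sup>2 = 1" by (simp add: n o)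
  have "q12\<^sup>2 + q13\<^sup>2 + q14\<^sup>2 + q23\<^sup>2 + q24\<^sup>2 + q34\<^sup>2
     = (c1*c1 + c2*c2 + c3*c3 + c4*c4) * (d1*d1 + d2*d2 + d3*d3 + d4*d4) - (c1*d1 + c2*d2 + c3*d3 + c4*d4)\<^sup>2"
    unfolding q power2_eq_square by (simp add: algebra_simps)
  then have Q: "q12\<^sup>2 + q13\<^sup>2 + q14\<^sup>2 + q23\<^sup>2 + q24\<^sup>2 + q34\<^sup>2 = 1" by (simp add: n o)
  have D: "p12*q34 - p13*q24 + p14*q23 + p23*q14 - p24*q13 + p34*q12 = 1"
    unfolding det[symmetric] p q by (simp add: algebra_simps)
  have "(p12 - q34)\<^sup>2 + (p13 + q24)\<^sup>2 + (p14 - q23)\<^sup>2 + (p23 - q14)\<^sup>2 + (p24 + q13)\<^sup>2 + (p34 - q12)\<^sup>2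
    = (p12\<^sup>2 + p13\<^sup>2 + p14\<^sup>2 + p23\<^sup>2 + p24\<^sup>2 + p34\<^sup>2) + (q12\<^sup>2 + q13\<^sup>2 + q14\<^sup>2 + q23\<^sup>2 + q24\<^sup>2 + q34\<^sup>2)
      - 2 * (p12*q34 - p13*q24 + p14*q23 + p23*q14 - p24*q13 + p34*q12)"
    by (simp add: power2_eq_square algebra_simps)
  also have "\<dots> = 0" unfolding P Q D by simp
  finally have "(p12 - q34)\<^sup>2 = 0 \<and> (p13 + q24)\<^sup>2 = 0 \<and> (p14 - q23)\<^sup>2 = 0 \<and> (p23 - q14)\<^sup>2 = 0
      \<and> (p24 + q13)\<^sup>2 = 0 \<and> (p34 - q12)\<^sup>2 = 0"
    using zero_le_power2[of "p12 - q34"] zero_le_power2[of "p13 + q24"] zero_le_power2[of "p14 - q23"]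
      zero_le_power2[of "p23 - q14"] zero_le_power2[of "p24 + q13"] zero_le_power2[of "p34 - q12"]
    by linarith
  then have "p12 = q34" "p13 = - q24" "p14 = q23" "p23 = q14" "p24 = - q13" "p34 = q12"
    by (simp_all add: eq_neg_iff_add_eq_0)
  then show "a1*b2 - a2*b1 = c3*d4 - c4*d3" "a3*b4 - a4*b3 = c1*d2 - c2*d1"
    "a1*b3 - a3*b1 = - (c2*d4 - c4*d2)" "a2*b4 - a4*b2 = - (c1*d3 - c3*d1)"
    "a1*b4 - a4*b1 = c2*d3 - c3*d2" "a2*b3 - a3*b2 = c1*d4 - c4*d1"
    unfolding p q by simp_all
qed

section \<open>The curvature conditions at a point\<close>

(* The frame index 1 must keep the form in which the rewrite rules for frames contain it. *)
declare One_nat_def [simp del]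

context hermitian_metric
begin

abbreviation F :: "complex^2 \<Rightarrow> complex^2 \<Rightarrow> complex^2 \<Rightarrow> real"
  where "F p X Y \<equiv> g p (\<i> *s X) Y"

subsection \<open>Orthonormal frames\<close>

lemma orthonormal4D:
  "orthonormal4 b e \<Longrightarrow> i \<in> {1..4} \<Longrightarrow> j \<in> {1..4} \<Longrightarrow> b (e i) (e j) = (if i = j then 1 else 0)"
  by (auto simp: orthonormal4_def)

lemma g_linear: "p \<in> U \<Longrightarrow> linear (\<lambda>X. g p X Y)" "p \<in> U \<Longrightarrow> linear (g p X)"
  using bil by (auto simp: bilinear_def)

lemma orthonormal_expand:
  assumes p: "p \<in> U" and e: "orthonormal4 (g p) e"
  shows "X = (\<Sum>i\<in>{1..4}. g p X (e i) *\<^sub>R e i)"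
proof -
  note o = orthonormal4D[OF e]
  have inj: "inj_on e {1..4}"
    by (rule inj_onI) (metis o zero_neq_one)
  have coeff: "g p (\<Sum>i\<in>{1..4}. u i *\<^sub>R e i) (e j) = u j" if j: "j \<in> {1..4}" for u j
  proof -
    have "g p (\<Sum>i\<in>{1..4}. u i *\<^sub>R e i) (e j) = (\<Sum>i\<in>{1..4}. u i * g p (e i) (e j))"
      by (simp add: linear_sum[OF g_linear(1)[OF p]] p)
    also have "\<dots> = (\<Sum>i\<in>{1..4}. if i = j then u i else 0)"
    proof (rule sum.cong)
      fix i assume "i \<in> {1..4::nat}"
      then show "u i * g p (e i) (e j) = (if i = j then u i else 0)" using o[OF _ j] by simp
    qed simp
    finally show ?thesis using j by simp
  qed
  have reindex: "(\<Sum>v\<in>e ` {1..4}. c v *\<^sub>R v) = (\<Sum>i\<in>{1..4}. c (e i) *\<^sub>R e i)" for c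
    by (simp add: sum.reindex[OF inj])
  have "independent (e ` {1..4})"
    unfolding independent_explicit
  proof (intro conjI allI impI ballI)
    fix c v assume 0: "(\<Sum>v\<in>e ` {1..4}. c v *\<^sub>R v) = 0" and "v \<in> e ` {1..4}"
    then obtain j where j: "j \<in> {1..4}" "v = e j" by blast
    show "c v = 0"
      using coeff[OF j(1), of "\<lambda>i. c (e i)"] 0 unfolding reindex by (simp add: p j)
  qed simp
  moreover have "card (e ` {1..4}) = 4" by (simp add: card_image[OF inj])
  ultimately have "UNIV \<subseteq> span (e ` {1..4})"
    by (intro card_ge_dim_independent) (auto simp: dim_UNIV)
  then have "X \<in> span (e ` {1..4})" by blast
  then obtain c where "X = (\<Sum>v\<in>e ` {1..4}. c v *\<^sub>R v)"
    by (auto simp: span_finite)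
  then have X: "X = (\<Sum>i\<in>{1..4}. c (e i) *\<^sub>R e i)" unfolding reindex .
  have "(\<Sum>i\<in>{1..4}. g p X (e i) *\<^sub>R e i) = (\<Sum>i\<in>{1..4}. c (e i) *\<^sub>R e i)"
    using coeff[of _ "\<lambda>i. c (e i)"] X by (intro sum.cong) auto
  then show ?thesis using X by simp
qed

lemma linear_frame:
  assumes p: "p \<in> U" and e: "orthonormal4 (g p) e" and f: "linear (f :: complex^2 \<Rightarrow> 'a::real_vector)"
  shows "f X = (\<Sum>i\<in>{1..4}. g p X (e i) *\<^sub>R f (e i))"
  by (subst orthonormal_expand[OF p e, of X]) (simp add: linear_sum[OF f] linear_scale[OF f])

lemma bilinear_frame_0:
  assumes p: "p \<in> U" and e: "orthonormal4 (g p) e" and B: "bilinear (B :: complex^2 \<Rightarrow> complex^2 \<Rightarrow> real)"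
  shows "(\<forall>X Y. B X Y = 0) \<longleftrightarrow> (\<forall>i\<in>{1..4}. \<forall>j\<in>{1..4}. B (e i) (e j) = 0)"
proof
  assume 0: "\<forall>i\<in>{1..4}. \<forall>j\<in>{1..4}. B (e i) (e j) = 0"
  have l: "linear (\<lambda>X. B X Y)" "linear (B X)" for X Y using B by (auto simp: bilinear_def)
  show "\<forall>X Y. B X Y = 0"
  proof (intro allI)
    fix X Y
    have "B (e i) Y = 0" if "i \<in> {1..4}" for i
      using linear_frame[OF p e l(2), of "e i" Y] 0 that by simp
    then show "B X Y = 0" using linear_frame[OF p e l(1), of X Y] by simp
  qed
qed simp

lemma endo_trace_frame:
  assumes p: "p \<in> U" and e: "orthonormal4 (g p) e" and f: "linear f"
  shows "endo_trace f = (\<Sum>i\<in>{1..4}. g p (f (e i)) (e i))"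
proof -
  have "endo_trace f = (\<Sum>b\<in>Basis. (\<Sum>i\<in>{1..4}. g p b (e i) *\<^sub>R f (e i)) \<bullet> b)"
    unfolding endo_trace_def
  proof (rule sum.cong)
    fix b :: "complex^2"
    show "f b \<bullet> b = (\<Sum>i\<in>{1..4}. g p b (e i) *\<^sub>R f (e i)) \<bullet> b"
      by (simp only: linear_frame[OF p e f, of b])
  qed simp
  also have "\<dots> = (\<Sum>i\<in>{1..4}. \<Sum>b\<in>Basis. (f (e i) \<bullet> b) * g p b (e i))"
    by (simp add: inner_sum_left mult.commute) (rule sum.swap)
  also have "\<dots> = (\<Sum>i\<in>{1..4}. g p (\<Sum>b\<in>Basis. (f (e i) \<bullet> b) *\<^sub>R b) (e i))"
    by (simp add: linear_sum[OF g_linear(1)[OF p]] p)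
  finally show ?thesis by (simp add: euclidean_representation)
qed

text \<open>Expand one argument in the frame \<open>e\<close> and contract with the frame \<open>f\<close>.\<close>

lemma metric_trace_frame:
  assumes p: "p \<in> U" and e: "orthonormal4 (g p) e" and f: "orthonormal4 (g p) f"
    and D: "bilinear (D :: complex^2 \<Rightarrow> complex^2 \<Rightarrow> real)"
  shows "(\<Sum>i\<in>{1..4}. D (f i) (f i)) = (\<Sum>i\<in>{1..4}. D (e i) (e i))"
proof -
  have l: "linear (\<lambda>X. D X Y)" "linear (D X)" for X Y using D by (auto simp: bilinear_def)
  have "(\<Sum>i\<in>{1..4}. D (f i) (f i)) = (\<Sum>i\<in>{1..4}. \<Sum>a\<in>{1..4}. g p (f i) (e a) *\<^sub>R D (e a) (f i))"
    by (intro sum.cong refl linear_frame[OF p e l(1)])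
  also have "\<dots> = (\<Sum>a\<in>{1..4}. \<Sum>i\<in>{1..4}. g p (e a) (f i) * D (e a) (f i))"
    by (subst sum.swap) (simp only: real_scaleR_def sym[OF p, of "f _" "e _"])
  also have "\<dots> = (\<Sum>a\<in>{1..4}. D (e a) (e a))"
  proof (rule sum.cong)
    fix a
    have "D (e a) (e a) = (\<Sum>i\<in>{1..4}. g p (e a) (f i) *\<^sub>R D (e a) (f i))"
      by (rule linear_frame[OF p f l(2)])
    then show "(\<Sum>i\<in>{1..4}. g p (e a) (f i) * D (e a) (f i)) = D (e a) (e a)" by simp
  qed simp
  finally show ?thesis .
qed

definition adapted :: "complex^2 \<Rightarrow> (nat \<Rightarrow> complex^2) \<Rightarrow> bool"
  where "adapted p e \<longleftrightarrow> orthonormal4 (g p) e \<and> e 2 = \<i> *s e 1 \<and> e 4 = \<i> *s e 3"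

lemma ex_adapted:
  assumes p: "p \<in> U" obtains e where "adapted p e"
proof -
  obtain u1 u2 where u: "H p u1 u1 = 1" "H p u2 u2 = 1" "H p u1 u2 = 0"
    using ex_unitary_frame[OF p] by blast
  have u': "H p u2 u1 = 0" using H_cnj[OF p, of u1 u2] u by simp
  define e where "e i = (if i = 1 then u1 else if i = 2 then \<i> *s u1 else if i = 3 then u2 else \<i> *s u2)" for i :: nat
  have G: "g p X Y = Re (H p X Y)" for X Y by simp
  have "orthonormal4 (g p) e"
    unfolding orthonormal4_def ball_4 G by (simp add: e_def p u u')
  then show thesis using that[of e] by (simp add: adapted_def e_def)
qed

lemma adapted_simps:
  assumes "adapted p e"
  shows "\<i> *s e 1 = e 2" "\<i> *s e 2 = - e 1" "\<i> *s e 3 = e 4" "\<i> *s e 4 = - e 3"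
  using assms by (simp_all add: adapted_def)

lemma adaptedD: "adapted p e \<Longrightarrow> orthonormal4 (g p) e"
  by (simp add: adapted_def)

subsection \<open>Components of the curvature\<close>

definition rc :: "complex^2 \<Rightarrow> (nat \<Rightarrow> complex^2) \<Rightarrow> nat \<Rightarrow> nat \<Rightarrow> nat \<Rightarrow> nat \<Rightarrow> real"
  where "rc p e i j k l = g p (R p (e i) (e j) (e k)) (e l)"

lemma curvature_components_rc:
  assumes p: "p \<in> U" shows "curvature_components (rc p e)"
proof
  fix i j k l
  show "rc p e i j k l = - rc p e j i k l"
    unfolding rc_def by (subst curvature_skew_left) (simp add: p)
  show "rc p e i j k l = - rc p e i j l k"
    unfolding rc_def by (subst curvature_skew_right[OF p]) (simp add: sym[OF p])
  show "rc p e i j k l + rc p e j k i l + rc p e k i j l = 0"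
    unfolding rc_def using bianchi[OF p, of "e i" "e j" "e k"]
    by (metis g_add(1)[OF p] g_zero(1)[OF p])
qed

lemma curvature_eq_0_frame:
  assumes p: "p \<in> U" and e: "orthonormal4 (g p) e"
    and 0: "\<forall>i\<in>{1..4}. \<forall>j\<in>{1..4}. \<forall>k\<in>{1..4}. \<forall>l\<in>{1..4}. rc p e i j k l = 0"
  shows "R p X Y Z = 0"
proof -
  note l = curvature_linear[OF p]
  have 1: "R p (e i) (e j) (e k) = 0" if "i \<in> {1..4}" "j \<in> {1..4}" "k \<in> {1..4}" for i j k
    using orthonormal_expand[OF p e, of "R p (e i) (e j) (e k)"] 0 that by (simp add: rc_def)
  have 2: "R p (e i) (e j) Z = 0" if "i \<in> {1..4}" "j \<in> {1..4}" for i j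
  proof -
    have "R p (e i) (e j) Z = (\<Sum>k\<in>{1..4}. g p Z (e k) *\<^sub>R R p (e i) (e j) (e k))"
      by (rule linear_frame[OF p e l(3)])
    then show ?thesis using 1 that by simp
  qed
  have 3: "R p (e i) Y Z = 0" if "i \<in> {1..4}" for i
  proof -
    have "R p (e i) Y Z = (\<Sum>j\<in>{1..4}. g p Y (e j) *\<^sub>R R p (e i) (e j) Z)"
      by (rule linear_frame[OF p e l(2)])
    then show ?thesis using 2 that by simp
  qed
  have "R p X Y Z = (\<Sum>i\<in>{1..4}. g p X (e i) *\<^sub>R R p (e i) Y Z)"
    by (rule linear_frame[OF p e l(1)])
  then show ?thesis using 3 by simp
qed

lemma ricci_frame:
  assumes p: "p \<in> U" and e: "orthonormal4 (g p) e"
  shows "ricci g p Y Z = (\<Sum>i\<in>{1..4}. g p (R p (e i) Y Z) (e i))"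
  unfolding ricci_def by (rule endo_trace_frame[OF p e curvature_linear(1)[OF p]])

lemma bilinear_ricci: assumes p: "p \<in> U" shows "bilinear (ricci g p)"
proof -
  note l = curvature_linear[OF p]
  show ?thesis
    unfolding bilinear_def ricci_def endo_trace_def
    by (auto intro!: linearI simp: linear_add[OF l(2)] linear_scale[OF l(2)] linear_add[OF l(3)] linear_scale[OF l(3)]
        inner_add_left sum.distrib sum_distrib_left)
qed

lemma scalar_curv_frame:
  assumes p: "p \<in> U" and e: "orthonormal4 (g p) e"
  shows "scalar_curv g p = (\<Sum>i\<in>{1..4}. ricci g p (e i) (e i))"
proof -
  have l: "linear (ricci g p Y)" "linear (\<lambda>Y. ricci g p Y Z)" for Y Z
    using bilinear_ricci[OF p] by (auto simp: bilinear_def)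
  have s: "g p (sharp (g p) (ricci g p Y)) W = ricci g p Y W" for Y W
    by (rule g_sharp[OF p l(1)])
  have "linear (\<lambda>Y. sharp (g p) (ricci g p Y))"
    by (rule linearI; rule g_nondegenerate[OF p])
       (simp_all add: p s linear_add[OF l(2)] linear_scale[OF l(2)])
  then show ?thesis
    unfolding scalar_curv_def by (subst endo_trace_frame[OF p e]) (simp_all add: s)
qed

context
  fixes p e assumes p: "p \<in> U" and e: "orthonormal4 (g p) e"
begin

interpretation cc: curvature_components "rc p e"
  by (rule curvature_components_rc[OF p])

lemma ricci_components: "ricci g p (e j) (e k) = cc.ric j k"
  by (simp add: ricci_frame[OF p e] cc.ric_def rc_def)

lemma scalar_components: "scalar_curv g p = cc.scal"
  by (simp add: scalar_curv_frame[OF p e] cc.scal_def ricci_components)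

lemma weyl_components:
  assumes "i \<in> {1..4}" "j \<in> {1..4}" "k \<in> {1..4}" "l \<in> {1..4}"
  shows "weyl4 g p (e i) (e j) (e k) (e l) = cc.w i j k l"
  unfolding weyl4_def cc.w_def schouten4_def cc.sch_def ricci_components scalar_components rc_def
  using assms by (simp add: orthonormal4D[OF e])

lemma tracefree_ricci_components:
  "(\<forall>Y Z. tracefree_ricci g p Y Z = 0) \<longleftrightarrow>
   (\<forall>j\<in>{1..4}. \<forall>k\<in>{1..4}. cc.ric j k - cc.scal / 4 * (if j = k then 1 else 0) = 0)"
proof -
  have "bilinear (tracefree_ricci g p)"
    unfolding tracefree_ricci_def using bilinear_ricci[OF p] bil[OF p]
    by (auto simp: bilinear_def linear_iff algebra_simps)
  then show ?thesis
    unfolding bilinear_frame_0[OF p e \<open>bilinear (tracefree_ricci g p)\<close>]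
    by (intro ball_cong refl)
       (simp only: tracefree_ricci_def ricci_components scalar_components orthonormal4D[OF e], simp)
qed

end

lemma bilinear_weyl:
  assumes p: "p \<in> U" shows "bilinear (\<lambda>X Y. weyl4 g p X Y Z V)" "bilinear (\<lambda>Z V. weyl4 g p X Y Z V)"
proof -
  have s: "linear (\<lambda>Y. schouten4 g p Y Z)" "linear (\<lambda>Z. schouten4 g p Y Z)" for Y Z
    unfolding schouten4_def using bilinear_ricci[OF p] bil[OF p]
    by (auto simp: bilinear_def linear_iff algebra_simps add_divide_distrib diff_divide_distrib)
  note l = curvature_linear[OF p]
  note rules = linear_add[OF s(1)] linear_scale[OF s(1)] linear_add[OF s(2)] linear_scale[OF s(2)]
    linear_add[OF l(1)] linear_scale[OF l(1)] linear_add[OF l(2)] linear_scale[OF l(2)]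
    linear_add[OF l(3)] linear_scale[OF l(3)] p
  show "bilinear (\<lambda>X Y. weyl4 g p X Y Z V)" "bilinear (\<lambda>Z V. weyl4 g p X Y Z V)"
    unfolding bilinear_def weyl4_def
    by (auto intro!: linearI simp: rules) (simp_all add: algebra_simps)
qed

end

context hermitian_metric
begin

subsection \<open>Anti-self-dual forms\<close>

lemma adapted_F:
  assumes p: "p \<in> U" and e: "adapted p e"
  shows "F p (e 1) (e 2) = 1" "F p (e 3) (e 4) = 1" "F p (e 1) (e 3) = 0" "F p (e 1) (e 4) = 0"
    "F p (e 2) (e 3) = 0" "F p (e 2) (e 4) = 0" "F p (e 2) (e 1) = -1" "F p (e 4) (e 3) = -1"
    "F p (e 3) (e 1) = 0" "F p (e 3) (e 2) = 0" "F p (e 4) (e 1) = 0" "F p (e 4) (e 2) = 0"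
  using orthonormal4D[OF adaptedD[OF e]] by (simp_all add: adapted_simps[OF e] p)

text \<open>The even permutations of a unitary frame are positively oriented, which gives one relation for
  each splitting of the frame into two pairs.\<close>

lemma asd_components:
  assumes p: "p \<in> U" and e: "adapted p e" and \<alpha>: "anti_self_dual_form (g p) (F p) \<alpha>"
  shows "\<alpha> (e 3) (e 4) = - \<alpha> (e 1) (e 2)" "\<alpha> (e 2) (e 4) = \<alpha> (e 1) (e 3)" "\<alpha> (e 2) (e 3) = - \<alpha> (e 1) (e 4)"
    "\<alpha> X Y = - \<alpha> Y X"
proof -
  have b: "bilinear \<alpha>" and d: "\<And>X. \<alpha> X X = 0"
    using \<alpha> by (auto simp: anti_self_dual_form_def two_form_def)
  show skew: "\<alpha> X Y = - \<alpha> Y X" for X Y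
    using d[of "X + Y"] d[of X] d[of Y] bilinear_ladd[OF b] bilinear_radd[OF b] by simp
  have star: "- \<alpha> (f 1) (f 2) = \<alpha> (f 3) (f 4)" if "oriented_orthonormal4 (g p) (F p) f" for f
    using \<alpha> that by (auto simp: anti_self_dual_form_def is_hodge_star_def)
  note o = orthonormal4D[OF adaptedD[OF e]]
  have perm: "- \<alpha> (e a) (e b) = \<alpha> (e c) (e d)"
    if "a \<in> {1..4}" "b \<in> {1..4}" "c \<in> {1..4}" "d \<in> {1..4}" "distinct [a, b, c, d]"
      "half_square (F p) (e a) (e b) (e c) (e d) > 0" for a b c d
  proof -
    define f where "f i = e (if i = 1 then a else if i = 2 then b else if i = 3 then c else d)" for i :: nat
    have "oriented_orthonormal4 (g p) (F p) f"
      unfolding oriented_orthonormal4_def orthonormal4_def ball_4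
      using that by (simp add: f_def o)
    from star[OF this] show ?thesis by (simp add: f_def)
  qed
  show "\<alpha> (e 3) (e 4) = - \<alpha> (e 1) (e 2)"
    using perm[of 1 2 3 4] by (simp add: half_square_def adapted_F[OF p e])
  have "- \<alpha> (e 1) (e 3) = \<alpha> (e 4) (e 2)"
    using perm[of 1 3 4 2] by (simp add: half_square_def adapted_F[OF p e])
  then show "\<alpha> (e 2) (e 4) = \<alpha> (e 1) (e 3)" using skew[of "e 4" "e 2"] by simp
  have "- \<alpha> (e 1) (e 4) = \<alpha> (e 2) (e 3)"
    using perm[of 1 4 2 3] by (simp add: half_square_def adapted_F[OF p e])
  then show "\<alpha> (e 2) (e 3) = - \<alpha> (e 1) (e 4)" by simp
qed

text \<open>The 2-form \<open>e\<^sup>i \<and> e\<^sup>j\<close> of the dual frame.\<close>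

definition minor :: "complex^2 \<Rightarrow> (nat \<Rightarrow> complex^2) \<Rightarrow> nat \<Rightarrow> nat \<Rightarrow> complex^2 \<Rightarrow> complex^2 \<Rightarrow> real"
  where "minor p e i j X Y = g p X (e i) * g p Y (e j) - g p X (e j) * g p Y (e i)"

lemma bilinear_minor: assumes p: "p \<in> U" shows "bilinear (minor p e i j)"
  unfolding bilinear_def minor_def by (auto intro!: linearI simp: p algebra_simps)

text \<open>In the frame \<open>f\<close> the form \<open>F\<close> is a skew orthogonal matrix, and the orientation makes its Pfaffian
  positive, hence equal to \<open>1\<close>. In terms of the frame \<open>e\<close> this Pfaffian is the determinant of the
  change of frame, so complementary minors agree.\<close>

lemma oriented_minors:
  assumes p: "p \<in> U" and e: "adapted p e" and f: "oriented_orthonormal4 (g p) (F p) f"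
  shows "minor p e 1 2 (f 1) (f 2) = minor p e 3 4 (f 3) (f 4)"
    "minor p e 3 4 (f 1) (f 2) = minor p e 1 2 (f 3) (f 4)"
    "minor p e 1 3 (f 1) (f 2) = - minor p e 2 4 (f 3) (f 4)"
    "minor p e 2 4 (f 1) (f 2) = - minor p e 1 3 (f 3) (f 4)"
    "minor p e 1 4 (f 1) (f 2) = minor p e 2 3 (f 3) (f 4)"
    "minor p e 2 3 (f 1) (f 2) = minor p e 1 4 (f 3) (f 4)"
proof -
  have fo: "orthonormal4 (g p) f" and pos: "half_square (F p) (f 1) (f 2) (f 3) (f 4) > 0"
    using f by (auto simp: oriented_orthonormal4_def)
  note o = orthonormal4D[OF fo]
  have parseval: "g p X Y = g p X (h 1) * g p Y (h 1) + g p X (h 2) * g p Y (h 2) + g p X (h 3) * g p Y (h 3)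
      + g p X (h 4) * g p Y (h 4)" if h: "orthonormal4 (g p) h" for X Y h
    using linear_frame[OF p h g_linear(1)[OF p], of X Y] by (simp add: sum_4 sym[OF p, of "h _" Y])
  have FJ: "F p X Y = - F p Y X" for X Y
    using g_i_right[OF p, of Y X] sym[OF p, of "\<i> *s X" Y] by simp
  have rows: "F p X (f 1) * F p Y (f 1) + F p X (f 2) * F p Y (f 2) + F p X (f 3) * F p Y (f 3)
      + F p X (f 4) * F p Y (f 4) = g p X Y" for X Y
    using parseval[OF fo, of "\<i> *s X" "\<i> *s Y"] by (simp add: J_inv[OF p])
  have F0: "F p X X = 0" for X using FJ[of X X] by simp
  define F12 F13 F14 F23 F24 F34 where Fd: "F12 = F p (f 1) (f 2)" "F13 = F p (f 1) (f 3)" "F14 = F p (f 1) (f 4)"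
    "F23 = F p (f 2) (f 3)" "F24 = F p (f 2) (f 4)" "F34 = F p (f 3) (f 4)"
  have Fs: "F p (f 2) (f 1) = - F12" "F p (f 3) (f 1) = - F13" "F p (f 4) (f 1) = - F14"
    "F p (f 3) (f 2) = - F23" "F p (f 4) (f 2) = - F24" "F p (f 4) (f 3) = - F34"
    unfolding Fd by (rule FJ)+
  have pf: "F12 * F34 - F13 * F24 + F14 * F23 = 1"
  proof (rule pfaffian_skew_orthogonal)
    show "F12\<^sup>2 + F13\<^sup>2 + F14\<^sup>2 = 1" using rows[of "f 1" "f 1"] by (simp add: F0 Fd[symmetric] o power2_eq_square)
    show "F12\<^sup>2 + F23\<^sup>2 + F24\<^sup>2 = 1" using rows[of "f 2" "f 2"] by (simp add: F0 Fs Fd[symmetric] o power2_eq_square)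
    show "F13\<^sup>2 + F23\<^sup>2 + F34\<^sup>2 = 1" using rows[of "f 3" "f 3"] by (simp add: F0 Fs Fd[symmetric] o power2_eq_square)
    show "F14\<^sup>2 + F24\<^sup>2 + F34\<^sup>2 = 1" using rows[of "f 4" "f 4"] by (simp add: F0 Fs Fd[symmetric] o power2_eq_square)
    show "F13 * F23 + F14 * F24 = 0" using rows[of "f 1" "f 2"] by (simp add: F0 Fs Fd[symmetric] o)
    show "F14 * F34 - F12 * F23 = 0" using rows[of "f 1" "f 3"] by (simp add: F0 Fs Fd[symmetric] o)
    show "F12 * F24 + F13 * F34 = 0" using rows[of "f 1" "f 4"] by (simp add: F0 Fs Fd[symmetric] o)
    show "F12 * F34 - F13 * F24 + F14 * F23 > 0" using pos by (simp add: half_square_def Fd[symmetric])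
  qed
  note eo = adaptedD[OF e]
  have Je: "g p (\<i> *s X) (e 1) = - g p X (e 2)" "g p (\<i> *s X) (e 2) = g p X (e 1)"
    "g p (\<i> *s X) (e 3) = - g p X (e 4)" "g p (\<i> *s X) (e 4) = g p X (e 3)" for X
    using g_i_right[OF p, of X "e 1"] g_i_right[OF p, of X "e 2"] g_i_right[OF p, of X "e 3"] g_i_right[OF p, of X "e 4"]
    by (simp_all add: adapted_simps[OF e] p)
  have Fe: "F p X Y = minor p e 1 2 X Y + minor p e 3 4 X Y" for X Y
    unfolding parseval[OF eo, of "\<i> *s X" Y] Je minor_def by simp
  have n: "g p (f i) (e 1) * g p (f j) (e 1) + g p (f i) (e 2) * g p (f j) (e 2) + g p (f i) (e 3) * g p (f j) (e 3)
      + g p (f i) (e 4) * g p (f j) (e 4) = (if i = j then 1 else 0)" if "i \<in> {1..4}" "j \<in> {1..4}" for i j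
    using parseval[OF eo, of "f i" "f j"] o[OF that] by simp
  note cm = complementary_minors[OF _ _ _ _ _ _ pf[unfolded Fd Fe minor_def],
      OF n[of 1 1, simplified] n[of 2 2, simplified] n[of 3 3, simplified] n[of 4 4, simplified]
        n[of 1 2, simplified] n[of 3 4, simplified]]
  show "minor p e 1 2 (f 1) (f 2) = minor p e 3 4 (f 3) (f 4)"
    "minor p e 3 4 (f 1) (f 2) = minor p e 1 2 (f 3) (f 4)"
    "minor p e 1 3 (f 1) (f 2) = - minor p e 2 4 (f 3) (f 4)"
    "minor p e 2 4 (f 1) (f 2) = - minor p e 1 3 (f 3) (f 4)"
    "minor p e 1 4 (f 1) (f 2) = minor p e 2 3 (f 3) (f 4)"
    "minor p e 2 3 (f 1) (f 2) = minor p e 1 4 (f 3) (f 4)"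
    using cm unfolding minor_def by (simp_all add: mult.commute)
qed

lemma asd_frame_forms:
  assumes p: "p \<in> U" and e: "adapted p e"
  shows "anti_self_dual_form (g p) (F p) (\<lambda>X Y. minor p e 1 2 X Y - minor p e 3 4 X Y)"
    "anti_self_dual_form (g p) (F p) (\<lambda>X Y. minor p e 1 3 X Y + minor p e 2 4 X Y)"
    "anti_self_dual_form (g p) (F p) (\<lambda>X Y. minor p e 1 4 X Y - minor p e 2 3 X Y)"
proof -
  have "bilinear (\<lambda>X Y. minor p e a b X Y - minor p e c d X Y)"
    "bilinear (\<lambda>X Y. minor p e a b X Y + minor p e c d X Y)" for a b c d
    using bilinear_minor[OF p, of e a b] bilinear_minor[OF p, of e c d]
    by (auto simp: bilinear_def intro!: linear_compose_sub linear_compose_add)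
  moreover have "minor p e a b X X = 0" for a b X by (simp add: minor_def)
  ultimately show "anti_self_dual_form (g p) (F p) (\<lambda>X Y. minor p e 1 2 X Y - minor p e 3 4 X Y)"
    "anti_self_dual_form (g p) (F p) (\<lambda>X Y. minor p e 1 3 X Y + minor p e 2 4 X Y)"
    "anti_self_dual_form (g p) (F p) (\<lambda>X Y. minor p e 1 4 X Y - minor p e 2 3 X Y)"
    using oriented_minors[OF p e]
    by (auto simp: anti_self_dual_form_def two_form_def is_hodge_star_def)
qed

lemma curv_operator_frame:
  assumes p: "p \<in> U" and e: "orthonormal4 (g p) e" and f: "orthonormal4 (g p) f"
    and \<alpha>: "bilinear \<alpha>" and W: "bilinear (\<lambda>X Y. W X Y Z V)"
  shows "curv_operator f W \<alpha> Z V = curv_operator e W \<alpha> Z V"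
proof -
  have l: "linear (\<lambda>X. \<alpha> X Y)" "linear (\<alpha> X)" "linear (\<lambda>X. W X Y Z V)" "linear (\<lambda>Y. W X Y Z V)" for X Y
    using \<alpha> W by (auto simp: bilinear_def)
  note s = linear_add[OF l(1)] linear_add[OF l(2)] linear_add[OF l(3)] linear_add[OF l(4)]
    linear_scale[OF l(1)] linear_scale[OF l(2)] linear_scale[OF l(3)] linear_scale[OF l(4)]
  have D1: "bilinear (\<lambda>X X'. \<Sum>j\<in>{1..4}. \<alpha> X (f j) * W X' (f j) Z V)"
    unfolding bilinear_def by (auto intro!: linearI simp: s sum.distrib sum_distrib_left algebra_simps)
  have D2: "bilinear (\<lambda>Y Y'. \<alpha> (e i) Y * W (e i) Y' Z V)" for i
    unfolding bilinear_def by (auto intro!: linearI simp: s algebra_simps)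
  have "(\<Sum>i\<in>{1..4}. \<Sum>j\<in>{1..4}. \<alpha> (f i) (f j) * W (f i) (f j) Z V)
      = (\<Sum>i\<in>{1..4}. \<Sum>j\<in>{1..4}. \<alpha> (e i) (f j) * W (e i) (f j) Z V)"
    using metric_trace_frame[OF p e f D1] by simp
  also have "\<dots> = (\<Sum>i\<in>{1..4}. \<Sum>j\<in>{1..4}. \<alpha> (e i) (e j) * W (e i) (e j) Z V)"
    by (intro sum.cong refl metric_trace_frame[OF p e f D2])
  finally show ?thesis by (simp add: curv_operator_def)
qed

lemma curv_operator_adapted:
  assumes p: "p \<in> U" and e: "adapted p e" and \<alpha>: "anti_self_dual_form (g p) (F p) \<alpha>"
    and W: "\<And>X Y. W X Y Z V = - W Y X Z V"
  shows "curv_operator e W \<alpha> Z V = \<alpha> (e 1) (e 2) * (W (e 1) (e 2) Z V - W (e 3) (e 4) Z V)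
    + \<alpha> (e 1) (e 3) * (W (e 1) (e 3) Z V + W (e 2) (e 4) Z V)
    + \<alpha> (e 1) (e 4) * (W (e 1) (e 4) Z V - W (e 2) (e 3) Z V)"
proof -
  note a = asd_components[OF p e \<alpha>]
  have z: "\<alpha> X X = 0" "W X X Z V = 0" for X using a(4)[of X X] W[of X X] by simp_all
  note sk = a(4)[of "e 2" "e 1"] a(4)[of "e 3" "e 1"] a(4)[of "e 4" "e 1"] a(4)[of "e 3" "e 2"] a(4)[of "e 4" "e 2"]
    a(4)[of "e 4" "e 3"] W[of "e 2" "e 1"] W[of "e 3" "e 1"] W[of "e 4" "e 1"] W[of "e 3" "e 2"] W[of "e 4" "e 2"]
    W[of "e 4" "e 3"]
  show ?thesis
    unfolding curv_operator_def sum_4 z sk a(1-3)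
    by (simp add: algebra_simps add_divide_distrib diff_divide_distrib)
qed

definition self_dual_at :: "complex^2 \<Rightarrow> bool"
  where "self_dual_at p \<longleftrightarrow> (\<forall>e \<alpha>. orthonormal4 (g p) e \<longrightarrow> anti_self_dual_form (g p) (F p) \<alpha> \<longrightarrow>
    (\<forall>Z V. curv_operator e (weyl4 g p) \<alpha> Z V = 0))"

lemma self_dual_at_iff:
  assumes p: "p \<in> U" and e: "adapted p e"
  shows "self_dual_at p \<longleftrightarrow> (\<forall>Z V. asd_null (\<lambda>i j. weyl4 g p (e i) (e j) Z V))"
proof -
  have skew: "weyl4 g p X Y Z V = - weyl4 g p Y X Z V" for X Y Z V
    unfolding weyl4_def by (subst curvature_skew_left) (simp add: p)
  note op = curv_operator_adapted[OF p e, where W = "weyl4 g p", OF _ skew]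
  note o = orthonormal4D[OF adaptedD[OF e]]
  show ?thesis
  proof
    assume sd: "self_dual_at p"
    have 0: "curv_operator e (weyl4 g p) \<alpha> Z V = 0" if "anti_self_dual_form (g p) (F p) \<alpha>" for \<alpha> Z V
      using sd that adaptedD[OF e] by (auto simp: self_dual_at_def)
    note f = asd_frame_forms[OF p e]
    show "\<forall>Z V. asd_null (\<lambda>i j. weyl4 g p (e i) (e j) Z V)"
    proof (intro allI)
      fix Z V
      show "asd_null (\<lambda>i j. weyl4 g p (e i) (e j) Z V)"
        using 0[OF f(1), of Z V] 0[OF f(2), of Z V] 0[OF f(3), of Z V]
        unfolding op[OF f(1)] op[OF f(2)] op[OF f(3)] by (simp add: minor_def o asd_null_def)
    qed
  next
    assume W: "\<forall>Z V. asd_null (\<lambda>i j. weyl4 g p (e i) (e j) Z V)"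
    show "self_dual_at p"
      unfolding self_dual_at_def
    proof (intro allI impI)
      fix f \<alpha> Z V assume f: "orthonormal4 (g p) f" and \<alpha>: "anti_self_dual_form (g p) (F p) \<alpha>"
      have "bilinear \<alpha>" using \<alpha> by (auto simp: anti_self_dual_form_def two_form_def)
      from curv_operator_frame[OF p adaptedD[OF e] f this, where W = "weyl4 g p", OF bilinear_weyl(1)[OF p]]
      show "curv_operator f (weyl4 g p) \<alpha> Z V = 0"
        using W[rule_format, of Z V] by (simp only: asd_null_def op[OF \<alpha>] mult_zero_right add_0)
    qed
  qed
qed

lemma self_dual_at_components:
  assumes p: "p \<in> U" and e: "adapted p e"
  shows "self_dual_at p \<longleftrightarrow>
    (\<forall>k\<in>{1..4}. \<forall>l\<in>{1..4}. asd_null (\<lambda>i j. weyl4 g p (e i) (e j) (e k) (e l)))"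
proof -
  note W = bilinear_weyl(2)[OF p]
  have B: "bilinear (\<lambda>Z V. weyl4 g p a b Z V - weyl4 g p c d Z V)"
    "bilinear (\<lambda>Z V. weyl4 g p a b Z V + weyl4 g p c d Z V)" for a b c d
    using W[of a b] W[of c d] by (auto simp: bilinear_def intro!: linear_compose_sub linear_compose_add)
  show ?thesis
    unfolding self_dual_at_iff[OF p e] asd_null_def
    using bilinear_frame_0[OF p adaptedD[OF e] B(1), of "e 1" "e 2" "e 3" "e 4"]
      bilinear_frame_0[OF p adaptedD[OF e] B(2), of "e 1" "e 3" "e 2" "e 4"]
      bilinear_frame_0[OF p adaptedD[OF e] B(1), of "e 1" "e 4" "e 2" "e 3"]
    by blast
qed

subsection \<open>The obstruction and the curvature conditions\<close>

lemma R_lin_i: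
  "p \<in> U \<Longrightarrow> R_lin p X Y (\<i> *s Z) = \<i> *s R_lin p X Y Z"
  using linear_neg[OF curvature_linear(3), of p X Y Z]
  by (simp add: R_lin_def smult_scaleR_commute vector_ssub_ldistrib)

lemma R_lin_skew:
  assumes p: "p \<in> U" shows "g p (R_lin p X Y Z) V = - g p Z (R_lin p X Y V)"
  using curvature_skew_right[OF p, of X Y Z V] curvature_skew_right[OF p, of X Y "\<i> *s Z" "\<i> *s V"]
    g_i_right[OF p, of "R p X Y (\<i> *s Z)" V] g_i_right[OF p, of Z "R p X Y (\<i> *s V)"]
  by (simp add: R_lin_def p add_divide_distrib diff_divide_distrib)

lemma R_lin_linear:
  assumes p: "p \<in> U"
  shows "linear (\<lambda>X. R_lin p X Y Z)" "linear (\<lambda>Y. R_lin p X Y Z)" "linear (\<lambda>Z. R_lin p X Y Z)"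
proof -
  note l = curvature_linear[OF p]
  note s = linear_add[OF l(1)] linear_scale[OF l(1)] linear_add[OF l(2)] linear_scale[OF l(2)]
    linear_add[OF l(3)] linear_scale[OF l(3)] vector_add_ldistrib smult_scaleR_commute scaleR_add_right scaleR_diff_right
  show "linear (\<lambda>X. R_lin p X Y Z)" "linear (\<lambda>Y. R_lin p X Y Z)" "linear (\<lambda>Z. R_lin p X Y Z)"
    unfolding R_lin_def by (rule linearI; simp add: s)+
qed

lemma R_lin_frame:
  assumes p: "p \<in> U" and e: "adapted p e"
  shows "g p (R_lin p X Y (e 1)) (e 3) = (g p (R p X Y (e 1)) (e 3) + g p (R p X Y (e 2)) (e 4)) / 2"
    "g p (R_lin p X Y (e 1)) (e 4) = (g p (R p X Y (e 1)) (e 4) - g p (R p X Y (e 2)) (e 3)) / 2"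
    "g p (R_lin p X Y (e 1)) (e 2) = g p (R p X Y (e 1)) (e 2)"
    "g p (R_lin p X Y (e 3)) (e 4) = g p (R p X Y (e 3)) (e 4)"
proof -
  have i: "g p (\<i> *s V) W = - g p V (\<i> *s W)" for V W using g_i_right[OF p, of V W] by simp
  have s: "g p (R p X Y (e 2)) (e 1) = - g p (R p X Y (e 1)) (e 2)"
    "g p (R p X Y (e 4)) (e 3) = - g p (R p X Y (e 3)) (e 4)"
    using curvature_skew_right[OF p] sym[OF p] by metis+
  show "g p (R_lin p X Y (e 1)) (e 3) = (g p (R p X Y (e 1)) (e 3) + g p (R p X Y (e 2)) (e 4)) / 2"
    "g p (R_lin p X Y (e 1)) (e 4) = (g p (R p X Y (e 1)) (e 4) - g p (R p X Y (e 2)) (e 3)) / 2"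
    "g p (R_lin p X Y (e 1)) (e 2) = g p (R p X Y (e 1)) (e 2)"
    "g p (R_lin p X Y (e 3)) (e 4) = g p (R p X Y (e 3)) (e 4)"
    unfolding R_lin_def adapted_simps[OF e] by (simp_all add: p i adapted_simps[OF e] s)
qed

text \<open>The conditions say that the skew-Hermitian matrix of \<open>S\<close> in the unitary basis \<open>e 1, e 3\<close> has no
  off-diagonal entries and equal diagonal entries.\<close>

lemma scalar_endomorphism_iff:
  assumes p: "p \<in> U" and e: "adapted p e"
    and S: "linear S" "\<And>v. S (\<i> *s v) = \<i> *s S v" "\<And>v w. g p (S v) w = - g p v (S w)"
  shows "(\<exists>c. \<forall>v. S v = c *s v) \<longleftrightarrow>
    g p (S (e 1)) (e 3) = 0 \<and> g p (S (e 1)) (e 4) = 0 \<and> g p (S (e 1)) (e 2) = g p (S (e 3)) (e 4)"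
proof -
  note o = orthonormal4D[OF adaptedD[OF e]]
  have H1: "H p (e 1) (e 1) = 1" "H p (e 3) (e 3) = 1" "H p (e 1) (e 3) = 0"
    by (simp_all add: complex_eq_iff Im_H adapted_simps[OF e] o)
  note span = frame_spans[OF p _ H1, simplified]
  have Sk: "S (k *s v) = k *s S v" for k v
    by (subst (1 2) smult_Re_Im) (simp add: linear_add[OF S(1)] linear_scale[OF S(1)] S(2))
  show ?thesis
  proof
    assume "\<exists>c. \<forall>v. S v = c *s v"
    then obtain c where c: "\<And>v. S v = c *s v" by blast
    have G: "g p X Y = Re (H p X Y)" for X Y by simp
    have H2: "H p (e 1) (e 4) = 0" "H p (e 1) (e 2) = - \<i>" "H p (e 3) (e 4) = - \<i>"
      unfolding adapted_simps(1,3)[OF e, symmetric] by (simp_all add: p H1)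
    show "g p (S (e 1)) (e 3) = 0 \<and> g p (S (e 1)) (e 4) = 0 \<and> g p (S (e 1)) (e 2) = g p (S (e 3)) (e 4)"
      unfolding c G by (simp add: p H1 H2)
  next
    assume 0: "g p (S (e 1)) (e 3) = 0 \<and> g p (S (e 1)) (e 4) = 0 \<and> g p (S (e 1)) (e 2) = g p (S (e 3)) (e 4)"
    have d: "g p (S v) v = 0" for v using S(3)[of v v] sym[OF p, of "S v" v] by simp
    define c where "c = Complex 0 (g p (S (e 1)) (e 2))"
    have "H p (S (e 1)) (e 1) = c" "H p (S (e 1)) (e 3) = 0"
      using 0 d[of "e 1"] by (simp_all add: complex_eq_iff Im_H adapted_simps[OF e] c_def)
    then have 1: "S (e 1) = c *s e 1" using span[of "S (e 1)"] by simp
    have "g p (S (e 3)) (e 1) = 0" using S(3)[of "e 3" "e 1"] 0 sym[OF p, of "e 3"] by simp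
    moreover have "g p (S (e 3)) (e 2) = 0"
      using S(3)[of "e 3" "e 2"] 0 sym[OF p, of "S (e 1)" "e 4"] g_i_right[OF p, of "e 3" "S (e 1)"]
      by (simp add: adapted_simps(1)[OF e, symmetric] S(2)) (simp add: adapted_simps[OF e])
    ultimately have "H p (S (e 3)) (e 1) = 0" "H p (S (e 3)) (e 3) = c"
      using 0 d[of "e 3"] by (simp_all add: complex_eq_iff Im_H adapted_simps[OF e] c_def)
    then have 3: "S (e 3) = c *s e 3" using span[of "S (e 3)"] by simp
    have "S v = c *s v" for v
    proof -
      define k1 k2 where "k1 = H p v (e 1)" and "k2 = H p v (e 3)"
      have v: "v = k1 *s e 1 + k2 *s e 3" unfolding k1_def k2_def by (rule span)
      show ?thesis
        unfolding v by (simp add: linear_add[OF S(1)] Sk 1 3 vec_eq_iff algebra_simps)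
    qed
    then show "\<exists>c. \<forall>v. S v = c *s v" by blast
  qed
qed

lemma model_curvature_g:
  assumes p: "p \<in> U"
  shows "g p (model_curvature p X Y v) w = g p v Y * g p X w - g p (\<i> *s v) Y * g p X (\<i> *s w) * (-1)
     - (g p v X * g p Y w - g p (\<i> *s v) X * g p Y (\<i> *s w) * (-1))"
proof -
  have "g p (model_curvature p X Y v) w = Re (H p (model_curvature p X Y v) w)" by simp
  also have "\<dots> = Re (H p v Y * H p X w - H p v X * H p Y w)"
    by (simp add: model_curvature_def p)
  finally show ?thesis
    by (simp add: Im_H g_i_right[OF p, of v])
qed

lemma model_curvature_linear:
  assumes p: "p \<in> U"
  shows "linear (\<lambda>X. model_curvature p X Y Z)" "linear (\<lambda>Y. model_curvature p X Y Z)" "linear (\<lambda>Z. model_curvature p X Y Z)"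
  unfolding model_curvature_def
  by (rule linearI; simp add: p vec_eq_iff scaleR_eq_smult algebra_simps)+

text \<open>In the obstruction the curvature of the Lichnerowicz connection may be replaced by the complex
  linear part of the Riemannian curvature. Then its trace-free part compares the anti-self-dual part
  of the Riemannian curvature with that of constant curvature \<open>2 / m\<close>.\<close>

lemma obstruction_scalar_iff:
  assumes p: "p \<in> U" and m: "m \<noteq> 0"
  shows "(\<forall>X Y. \<exists>c. \<forall>v. obstruction 1 m p X Y v = c *s v) \<longleftrightarrow>
    self_dual_at p \<and> (\<forall>Y Z. tracefree_ricci g p Y Z = 0) \<and> scalar_curv g p = 24 / m"
proof -
  obtain e where e: "adapted p e" using ex_adapted[OF p] .
  note eo = adaptedD[OF e]
  note o = orthonormal4D[OF eo]
  define S where "S X Y v = model_curvature p X Y v - m *\<^sub>R R_lin p X Y v" for X Y v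
  note lin = R_lin_linear[OF p] model_curvature_linear[OF p]
  have S_linear: "linear (\<lambda>X. S X Y v)" "linear (\<lambda>Y. S X Y v)" "linear (S X Y)" for X Y v
    unfolding S_def by (intro linear_compose_sub lin linear_compose_scale_right)+
  have S_i: "S X Y (\<i> *s v) = \<i> *s S X Y v" for X Y v
    by (simp add: S_def R_lin_i[OF p] model_curvature_def p scaleR_eq_smult vec_eq_iff algebra_simps)
  have S_skew: "g p (S X Y v) w = - g p v (S X Y w)" for X Y v w
    using R_lin_skew[OF p, of X Y v w] sym[OF p, of v "model_curvature p X Y w"]
    by (simp add: S_def p model_curvature_g[OF p]) (simp add: sym[OF p] algebra_simps)
  have "(\<exists>c. \<forall>v. obstruction 1 m p X Y v = c *s v) \<longleftrightarrow> (\<exists>c. \<forall>v. S X Y v = c *s v)" for X Y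
  proof -
    obtain c where c: "\<And>Z. R_lin p X Y Z = \<Omega> p X Y Z + c *s Z"
      using R_lin_lichnerowicz[OF p] by blast
    have eq: "obstruction 1 m p X Y v = S X Y v + (of_real m * c) *s v" for v
      by (simp add: obstruction_def S_def c scaleR_eq_smult vec_eq_iff algebra_simps)
    have "S X Y v + (of_real m * c) *s v = d *s v \<longleftrightarrow> S X Y v = (d - of_real m * c) *s v" for d v
      by (auto simp: vector_sub_rdistrib eq_diff_eq)
    then show ?thesis unfolding eq by (metis diff_add_cancel add_diff_cancel_right')
  qed
  then have "(\<forall>X Y. \<exists>c. \<forall>v. obstruction 1 m p X Y v = c *s v) \<longleftrightarrow>
    (\<forall>X Y. g p (S X Y (e 1)) (e 3) = 0) \<and> (\<forall>X Y. g p (S X Y (e 1)) (e 4) = 0) \<and>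
    (\<forall>X Y. g p (S X Y (e 1)) (e 2) - g p (S X Y (e 3)) (e 4) = 0)"
    using scalar_endomorphism_iff[OF p e S_linear(3) S_i S_skew] by auto
  also have "\<dots> \<longleftrightarrow> (\<forall>i\<in>{1..4}. \<forall>j\<in>{1..4}. g p (S (e i) (e j) (e 1)) (e 3) = 0 \<and>
     g p (S (e i) (e j) (e 1)) (e 4) = 0 \<and> g p (S (e i) (e j) (e 1)) (e 2) - g p (S (e i) (e j) (e 3)) (e 4) = 0)"
  proof -
    have B: "bilinear (\<lambda>X Y. g p (S X Y v) w)" for v w
      unfolding bilinear_def
      by (auto intro!: linearI simp: p linear_add[OF S_linear(1)] linear_scale[OF S_linear(1)]
          linear_add[OF S_linear(2)] linear_scale[OF S_linear(2)])
    have B2: "bilinear (\<lambda>X Y. g p (S X Y v) w - g p (S X Y v') w')" for v w v' w'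
      using B[of v w] B[of v' w'] by (auto simp: bilinear_def intro!: linear_compose_sub)
    show ?thesis
      unfolding bilinear_frame_0[OF p eo B] bilinear_frame_0[OF p eo B2] by blast
  qed
  also have "\<dots> \<longleftrightarrow> (\<forall>i\<in>{1..4}. \<forall>j\<in>{1..4}. asd_null (\<lambda>k l. rc p e i j k l - 2 / m * sphere_curv i j k l))"
  proof (intro ball_cong refl)
    fix i j assume ij: "i \<in> {1..4::nat}" "j \<in> {1..4::nat}"
    have M: "g p (model_curvature p (e i) (e j) (e 1)) (e 3) = sphere_curv i j 1 3 + sphere_curv i j 2 4"
      "g p (model_curvature p (e i) (e j) (e 1)) (e 4) = sphere_curv i j 1 4 - sphere_curv i j 2 3"
      "g p (model_curvature p (e i) (e j) (e 1)) (e 2) = 2 * sphere_curv i j 1 2"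
      "g p (model_curvature p (e i) (e j) (e 3)) (e 4) = 2 * sphere_curv i j 3 4"
      unfolding model_curvature_g[OF p] adapted_simps[OF e] using ij
      by (simp_all add: p o sphere_curv_def)
    have h: "x - m * (y / 2) = 0 \<longleftrightarrow> y - 2 / m * x = 0" "2 * x - m * y = 0 \<longleftrightarrow> y - 2 / m * x = 0" for x y
      using m by (auto simp: field_simps)
    have h2: "2 * x - m * y - (2 * x' - m * y') = 2 * (x - x') - m * (y - y')" for x y x' y'
      by (simp add: algebra_simps)
    show "(g p (S (e i) (e j) (e 1)) (e 3) = 0 \<and>
     g p (S (e i) (e j) (e 1)) (e 4) = 0 \<and> g p (S (e i) (e j) (e 1)) (e 2) - g p (S (e i) (e j) (e 3)) (e 4) = 0) \<longleftrightarrow>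
      asd_null (\<lambda>k l. rc p e i j k l - 2 / m * sphere_curv i j k l)"
      unfolding S_def g_diff(1)[OF p] g_scale(1)[OF p] M R_lin_frame[OF p e] h2 h asd_null_def rc_def
      by (auto simp: algebra_simps)
  qed
  also have "\<dots> \<longleftrightarrow> self_dual_at p \<and> (\<forall>Y Z. tracefree_ricci g p Y Z = 0) \<and> scalar_curv g p = 12 * (2 / m)"
    unfolding curvature_components.asd_curvature_iff[OF curvature_components_rc[OF p]]
      tracefree_ricci_components[OF p eo] scalar_components[OF p eo] self_dual_at_components[OF p e]
    by (simp add: weyl_components[OF p eo] asd_null_def)
  finally show ?thesis by simp
qed

subsection \<open>Flat Kaehler metrics\<close>

text \<open>As \<open>J\<close> is constant in the chart, the Koszul formula gives
  \<open>2 g((\<nabla>\<^sub>X J)Y, Z) = dF(X,Y,Z) - dF(X,JY,JZ)\<close>.\<close>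

lemma kaehler_christoffel_i:
  assumes p: "p \<in> U" and dF: "\<And>X Y Z. ext_deriv2 F p X Y Z = 0"
  shows "\<Gamma> p X (\<i> *s Y) = \<i> *s \<Gamma> p X Y"
proof (rule g_nondegenerate[OF p])
  fix Z
  have d: "dg p X (\<i> *s Y) Z - dg p Y (\<i> *s X) Z + dg p Z (\<i> *s X) Y = 0" for X Y Z
    using dF[of X Y Z] by (simp add: ext_deriv2_def dg_def)
  have "g p (\<i> *s \<Gamma> p X Y) Z = - g p (\<Gamma> p X Y) (\<i> *s Z)"
    using g_i_right[OF p, of "\<Gamma> p X Y" Z] by simp
  moreover have "dg p X Y (\<i> *s Z) = - dg p X (\<i> *s Y) Z" "dg p Y X (\<i> *s Z) = - dg p Y (\<i> *s X) Z"
    by (rule dg_i_right[OF p])+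
  moreover have "dg p Z X (\<i> *s Y) = - dg p Z (\<i> *s X) Y" by (rule dg_i_right[OF p])
  moreover have "dg p X (- Y) (\<i> *s Z) = dg p X (\<i> *s Y) Z"
    using dg_minus(2)[OF p, of X Y "\<i> *s Z"] dg_i_right[OF p, of X Y Z] by simp
  moreover have "dg p (\<i> *s Y) (\<i> *s X) (\<i> *s Z) = dg p (\<i> *s Y) X Z"
    "dg p (\<i> *s Z) (\<i> *s X) (\<i> *s Y) = dg p (\<i> *s Z) X Y"
    by (rule dg_J[OF p])+
  ultimately show "g p (\<Gamma> p X (\<i> *s Y)) Z = g p (\<i> *s \<Gamma> p X Y) Z"
    using d[of X Y Z] d[of X "\<i> *s Y" "\<i> *s Z"]
    by (simp add: koszul[OF p] add_divide_distrib diff_divide_distrib algebra_simps)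
qed

text \<open>For a Kaehler metric the Lichnerowicz and Levi-Civita connections agree, so that the obstruction
  is a multiple of the Riemannian curvature.\<close>

lemma kaehler_obstruction_iff_flat:
  assumes dF: "\<And>p X Y Z. p \<in> U \<Longrightarrow> ext_deriv2 F p X Y Z = 0" and m: "m \<noteq> 0"
  shows "(\<forall>p\<in>U. \<forall>X Y. \<exists>c. \<forall>v. obstruction 0 m p X Y v = c *s v) \<longleftrightarrow> (\<forall>p\<in>U. \<forall>X Y Z. R p X Y Z = 0)"
proof -
  have L: "L p X Y = \<Gamma> p X Y" if "p \<in> U" for p X Y
    using kaehler_christoffel_i[OF that dF[OF that], of X Y]
    by (simp add: lichnerowicz_christoffel scaleR_eq_smult vec_eq_iff)
  have \<Omega>: "\<Omega> p X Y Z = R p X Y Z" if p: "p \<in> U" for p X Y Z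
  proof -
    have "dir_deriv (\<lambda>q. L q Y Z) p X = dir_deriv (\<lambda>q. \<Gamma> q Y Z) p X" for X Y
      by (rule dir_deriv_cong[OF open_U p]) (rule L)
    then show ?thesis by (simp add: connection_curvature_def curvature_def L[OF p])
  qed
  have ob: "obstruction 0 m p X Y v = (- of_real m) *s R p X Y v" if "p \<in> U" for p X Y v
    by (simp add: obstruction_def \<Omega>[OF that] vec_eq_iff)
  show ?thesis
  proof
    assume sc: "\<forall>p\<in>U. \<forall>X Y. \<exists>c. \<forall>v. obstruction 0 m p X Y v = c *s v"
    show "\<forall>p\<in>U. \<forall>X Y Z. R p X Y Z = 0"
    proof (intro ballI allI)
      fix p X Y Z assume p: "p \<in> U"
      obtain e where e: "adapted p e" using ex_adapted[OF p] .
      note o = orthonormal4D[OF adaptedD[OF e]]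
      \<comment> \<open>a skew scalar endomorphism is a multiple of \<open>J\<close>\<close>
      have "rc p e i j 1 3 = 0 \<and> rc p e i j 1 4 = 0 \<and> rc p e i j 2 3 = 0 \<and> rc p e i j 2 4 = 0 \<and> rc p e i j 1 2 = rc p e i j 3 4" for i j
      proof -
        obtain c where c: "\<And>v. obstruction 0 m p (e i) (e j) v = c *s v" using sc p by blast
        define k where "k = - c / of_real m"
        have "R p (e i) (e j) v = k *s v" for v
        proof -
          have "of_real m * R p (e i) (e j) v $ n = - c * v $ n" for n
            using arg_cong[OF c[of v], of "\<lambda>x. x $ n"] unfolding ob[OF p]
            by (metis minus_minus mult_minus_left vector_smult_component)
          then show ?thesis using m by (simp add: k_def vec_eq_iff field_simps)
        qed
        then have k: "R p (e i) (e j) v = Re k *\<^sub>R v + Im k *\<^sub>R (\<i> *s v)" for v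
          by (simp only: smult_Re_Im[of k])
        show ?thesis unfolding rc_def k by (simp add: p o adapted_simps[OF e])
      qed
      then show "R p X Y Z = 0"
        by (intro curvature_eq_0_frame[OF p adaptedD[OF e]]
            curvature_components.eq_0_if_scalar[OF curvature_components_rc[OF p]]) blast
    qed
  next
    assume "\<forall>p\<in>U. \<forall>X Y Z. R p X Y Z = 0"
    then show "\<forall>p\<in>U. \<forall>X Y. \<exists>c. \<forall>v. obstruction 0 m p X Y v = c *s v"
      by (auto simp: ob intro!: exI[of _ 0])
  qed
qed

end

section \<open>Unitary frames along the twistor space\<close>

declare One_nat_def [simp]

lemma smooth_on_Pair:
  assumes "open S" "smooth_on S f" "smooth_on S g" shows "smooth_on S (\<lambda>x. (f x, g x))"
proof -
  have l: "bounded_linear (\<lambda>x::'b. (x, 0::'c))" "bounded_linear (\<lambda>x::'c. (0::'b, x))"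
    by (intro bounded_linear_Pair bounded_linear_ident bounded_linear_zero)+
  have "smooth_on S (\<lambda>x. (f x, 0) + (0, g x))"
    by (intro smooth_on_add assms(1) smooth_on_bounded_linear[OF assms(1) l(1) assms(2)]
        smooth_on_bounded_linear[OF assms(1) l(2) assms(3)])
  then show ?thesis by simp
qed

lemma smooth_on_vec2:
  fixes f :: "2 \<Rightarrow> 'a::real_normed_vector \<Rightarrow> complex^2"
  assumes "open S" "smooth_on S (f 1)" "smooth_on S (f 2)" shows "smooth_on S (\<lambda>x. \<chi> b. f b x)"
proof -
  have l: "bounded_linear (\<lambda>x::complex^2. (axis b x :: complex^2^2))" for b :: 2
    by (rule linear_conv_bounded_linear[THEN iffD1]) (rule linearI, auto simp: vec_eq_iff axis_def)
  have "smooth_on S (\<lambda>x. axis (1::2) (f 1 x) + axis 2 (f 2 x))"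
    by (intro smooth_on_add assms(1) smooth_on_bounded_linear[OF assms(1) l assms(2)]
        smooth_on_bounded_linear[OF assms(1) l assms(3)])
  moreover have "axis (1::2) (f 1 x) + axis 2 (f 2 x) = (\<chi> b. f b x)" for x
    by (simp add: vec_eq_iff forall_2 axis_def)
  ultimately show ?thesis by simp
qed

context hermitian_metric
begin

text \<open>The vectors have square norm \<open>2\<close> because \<open>(e - \<i> J e) / \<surd>2\<close> has \<open>\<surd>2\<close> times the components of the
  unit vector \<open>e\<close>.\<close>

definition unitary_at :: "complex^2 \<Rightarrow> complex^2^2 \<Rightarrow> bool"
  where "unitary_at p a \<longleftrightarrow> H p (a$1) (a$1) = 2 \<and> H p (a$2) (a$2) = 2 \<and> H p (a$1) (a$2) = 0"

definition real_frame_at :: "complex^2^2 \<Rightarrow> nat \<Rightarrow> complex^2"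
  where "real_frame_at a i =
    (if i = 1 then of_real (1 / sqrt 2) *s (a $ 1) else if i = 2 then (\<i> * of_real (1 / sqrt 2)) *s (a $ 1)
     else if i = 3 then of_real (1 / sqrt 2) *s (a $ 2) else (\<i> * of_real (1 / sqrt 2)) *s (a $ 2))"

lemma unitary_at_iff_orthonormal:
  assumes p: "p \<in> U" shows "orthonormal4 (g p) (real_frame_at a) \<longleftrightarrow> unitary_at p a"
proof -
  define s where "s = complex_of_real (1 / sqrt 2)"
  have s: "cnj s = s" "s * s = 1/2" "Im s = 0" "Re s \<noteq> 0" "Re s * (Re s * 2) = 1"
    by (simp_all add: s_def complex_eq_iff)
  have ss: "s * (s * z) = z / 2" for z using s(2) by (simp flip: mult.assoc)
  have e: "real_frame_at a 1 = s *s (a$1)" "real_frame_at a 2 = (\<i> * s) *s (a$1)"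
    "real_frame_at a 3 = s *s (a$2)" "real_frame_at a 4 = (\<i> * s) *s (a$2)"
    by (simp_all add: real_frame_at_def s_def)
  have G: "g p X Y = Re (H p X Y)" for X Y by simp
  show ?thesis
  proof
    assume o: "orthonormal4 (g p) (real_frame_at a)"
    have "g p (real_frame_at a 1) (real_frame_at a 1) = 1" "g p (real_frame_at a 3) (real_frame_at a 3) = 1"
      "g p (real_frame_at a 1) (real_frame_at a 3) = 0" "g p (real_frame_at a 1) (real_frame_at a 4) = 0"
      using orthonormal4D[OF o] by simp_all
    then have "Re (H p (a$1) (a$1)) = 2" "Re (H p (a$2) (a$2)) = 2" "H p (a$1) (a$2) = 0"
      unfolding e G by (simp_all add: p s ss complex_eq_iff del: Re_H)
    then show "unitary_at p a"
      unfolding unitary_at_def by (simp add: H_self[OF p])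
  next
    assume u: "unitary_at p a"
    have "H p (a$2) (a$1) = 0" using u H_cnj[OF p, of "a$1" "a$2"] by (simp add: unitary_at_def)
    then show "orthonormal4 (g p) (real_frame_at a)"
      unfolding orthonormal4_def ball_4 e G
      using u by (simp add: p s ss unitary_at_def del: Re_H)
  qed
qed

lemma frame_coeff_unitary:
  assumes p: "p \<in> U" and u: "unitary_at p a"
  shows "frame_coeff a x = (\<chi> b. H p x (a $ b) / 2)"
  unfolding frame_coeff_def
proof (rule the_equality)
  have u1: "H p (a$1) (a$1) = 2" "H p (a$2) (a$2) = 2" "H p (a$1) (a$2) = 0" using u by (simp_all add: unitary_at_def)
  have u2: "H p (a$2) (a$1) = 0" using u1 H_cnj[OF p, of "a$1" "a$2"] by simp
  have "x = (H p x (a$1) / 2) *s (a$1) + (H p x (a$2) / 2) *s (a$2)"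
    by (rule frame_spans[OF p _ u1]) simp
  then show "x = (\<Sum>b\<in>UNIV. ((\<chi> b. H p x (a $ b) / 2) $ b) *s (a $ b))"
    by (simp add: UNIV_2)
  show "k = (\<chi> b. H p x (a $ b) / 2)" if k: "x = (\<Sum>b\<in>UNIV. (k $ b) *s (a $ b))" for k
    unfolding k by (simp add: UNIV_2 vec_eq_iff forall_2 p u1 u2)
qed

text \<open>The left-hand sides are the products of a pulled-back form \<open>\<phi>\<^sup>k\<close> and of its conjugate. The
  phases of the frame vectors cancel in them, and the remaining data only depend on the line. The
  form \<open>\<phi>\<^sup>3\<close> is brought to this shape by differentiating the orthogonality of the frame.\<close>

lemma unitary_section_forms:
  assumes W: "open W" "w \<in> W" "W \<subseteq> U'" and a: "a differentiable (at w)"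
    and u: "\<And>w. w \<in> W \<Longrightarrow> unitary_at (fst w) (a w)"
    and line: "\<And>w. w \<in> W \<Longrightarrow> a w $ 1 = (a w $ 1 $ i) *s tautv i w"
  shows "(H (fst w) x (a w $ 1) / 2) * cnj (H (fst w) y (a w $ 1) / 2)
      = H (fst w) x (tautv i w) * H (fst w) (tautv i w) y / taut_norm i w / 2" (is ?first)
    and "(H (fst w) x (a w $ 2) / 2) * cnj (H (fst w) y (a w $ 2) / 2) = H (fst w) x y / 2
      - H (fst w) x (tautv i w) * H (fst w) (tautv i w) y / taut_norm i w / 2"
    and "(H (fst w) (cov (\<lambda>w. a w $ 2) w X) (a w $ 1) / 2) * cnj (H (fst w) (cov (\<lambda>w. a w $ 2) w Y) (a w $ 1) / 2)
      = fubini_study i w Y X"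
proof -
  define p v f N where "p = fst w" and "v = tautv i w" and "f = a w $ 1 $ i" and "N = taut_norm i w"
  have w': "w \<in> U'" using W by blast
  have p: "p \<in> U" using w' by (simp add: p_def mem_Times_iff)
  have a1: "a w $ 1 = f *s v" using line[OF W(2)] by (simp add: f_def v_def)
  have u1: "H p (a w$1) (a w$1) = 2" "H p (a w$2) (a w$2) = 2" "H p (a w$1) (a w$2) = 0"
    using u[OF W(2)] by (simp_all add: unitary_at_def p_def)
  have N: "N \<noteq> 0" "H p v v = N" using taut_norm_neq_0[of w i] p by (simp_all add: N_def p_def taut_norm_def v_def)
  have fN: "f * cnj f * N = 2" using u1(1) unfolding a1 by (simp add: p N mult_ac)
  have f0: "f \<noteq> 0" using fN by auto
  have ff: "f * cnj f = 2 / N" using fN N(1) by (simp add: field_simps)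
  have prod1: "H p x (a w$1) * cnj (H p y (a w$1)) = 2 * (H p x v * H p v y) / N" for x y
  proof -
    have "H p x (a w$1) * cnj (H p y (a w$1)) = (f * cnj f) * (H p x v * H p v y)"
      unfolding a1 by (simp add: p H_cnj[OF p])
    then show ?thesis by (simp add: ff)
  qed
  have prod2: "H p x (a w$2) * cnj (H p y (a w$2)) = 2 * H p x y - 2 * (H p x v * H p v y) / N" for x y
  proof -
    have "x = (H p x (a w$1) / 2) *s (a w$1) + (H p x (a w$2) / 2) *s (a w$2)"
      by (rule frame_spans[OF p _ u1]) simp
    then have "H p x y = H p ((H p x (a w$1) / 2) *s (a w$1) + (H p x (a w$2) / 2) *s (a w$2)) y"
      by simp
    also have "\<dots> = (H p x (a w$1) * cnj (H p y (a w$1)) + H p x (a w$2) * cnj (H p y (a w$2))) / 2"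
      by (simp add: p H_cnj[OF p] add_divide_distrib)
    finally show ?thesis unfolding prod1 by (simp add: algebra_simps)
  qed
  show ?first
    using prod1[of x y] by (simp add: p_def v_def N_def)
  show "(H (fst w) x (a w $ 2) / 2) * cnj (H (fst w) y (a w $ 2) / 2) = H (fst w) x y / 2
      - H (fst w) x (tautv i w) * H (fst w) (tautv i w) y / taut_norm i w / 2"
    using prod2[of x y] by (simp add: p_def v_def N_def diff_divide_distrib)
  define D where "D = cov (tautv i) w"
  have ad: "(\<lambda>w. a w $ b) differentiable (at w)" for b
    by (rule differentiable_bounded_linear[OF bounded_linear_vec_nth a])
  have fd: "(\<lambda>w. a w $ 1 $ i) differentiable (at w)"
    by (rule differentiable_bounded_linear[OF bounded_linear_vec_nth ad])
  \<comment> \<open>Differentiating \<open>H(a\<^sub>2, a\<^sub>1) = 0\<close> moves the derivative to the tautological line.\<close>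
  have phi3: "H p (cov (\<lambda>w. a w $ 2) w X) (a w $ 1) = - cnj f * H p (a w $ 2) (D X)" for X
  proof -
    have "dir_deriv (\<lambda>w. H (fst w) (a w $ 2) (a w $ 1)) w X = dir_deriv (\<lambda>w. 0) w X"
    proof (rule dir_deriv_cong[OF W(1,2)])
      fix q assume q: "q \<in> W"
      have "fst q \<in> U" using q W(3) by (auto simp: mem_Times_iff)
      from H_cnj[OF this, of "a q $ 1" "a q $ 2"] show "H (fst q) (a q $ 2) (a q $ 1) = 0"
        using u[OF q] by (simp add: unitary_at_def)
    qed
    then have 0: "H p (cov (\<lambda>w. a w $ 2) w X) (a w $ 1) + H p (a w $ 2) (cov (\<lambda>w. a w $ 1) w X) = 0"
      using H_along(2)[OF p[unfolded p_def] ad ad, of 2 1 X] by (simp add: p_def)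
    have "dir_deriv (\<lambda>w. a w $ 1) w X = dir_deriv (\<lambda>w. (a w $ 1 $ i) *s tautv i w) w X"
      by (rule dir_deriv_cong[OF W(1,2)]) (rule line)
    also have "\<dots> = dir_deriv (\<lambda>w. a w $ 1 $ i) w X *s v + f *s dir_deriv (tautv i) w X"
    proof -
      have bb: "bounded_bilinear (\<lambda>(k::complex) (x::complex^2). k *s x)"
        by (rule bilinear_conv_bounded_bilinear[THEN iffD1])
           (auto simp: bilinear_def vec_eq_iff intro!: linearI simp: algebra_simps)
      show ?thesis
        using dir_deriv_eqI[OF bounded_bilinear.FDERIV[OF bb fd[THEN differentiable_imp_dir_deriv]
              tautv_differentiable[THEN differentiable_imp_dir_deriv]], of i X]
        by (simp add: f_def v_def add.commute)
    qed
    finally have "cov (\<lambda>w. a w $ 1) w X = dir_deriv (\<lambda>w. a w $ 1 $ i) w X *s v + f *s D X"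
      unfolding cov_def D_def a1 using lichnerowicz_smult[OF p, of "fst X" f v]
      by (simp add: p_def v_def vector_add_ldistrib add.assoc)
    moreover have "H p (a w $ 2) v = 0"
      using u1(3) H_cnj[OF p, of "a w $ 1" "a w $ 2"] f0 unfolding a1 by (simp add: p)
    ultimately have "H p (a w $ 2) (cov (\<lambda>w. a w $ 1) w X) = cnj f * H p (a w $ 2) (D X)"
      by (simp add: p)
    with 0 show ?thesis by (simp add: eq_neg_iff_add_eq_0)
  qed
  have "(H p (cov (\<lambda>w. a w $ 2) w X) (a w $ 1) / 2) * cnj (H p (cov (\<lambda>w. a w $ 2) w Y) (a w $ 1) / 2)
      = (f * cnj f) * (H p (D Y) (a w $ 2) * cnj (H p (D X) (a w $ 2))) / 4"
    unfolding phi3 by (simp add: H_cnj[OF p])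
  also have "\<dots> = H p (D Y) (D X) / N - H p (D Y) v * H p v (D X) / N\<^sup>2"
    unfolding prod2 ff using N(1) by (simp add: field_simps power2_eq_square)
  finally show "(H (fst w) (cov (\<lambda>w. a w $ 2) w X) (a w $ 1) / 2) * cnj (H (fst w) (cov (\<lambda>w. a w $ 2) w Y) (a w $ 1) / 2)
      = fubini_study i w Y X"
    by (simp add: fubini_study_def D_def p_def v_def N_def)
qed

text \<open>A smooth unitary frame whose first vector spans the tautological line.\<close>

definition taut_frame :: "2 \<Rightarrow> (complex^2) \<times> complex \<Rightarrow> complex^2^2"
  where "taut_frame i w = (\<chi> b. let x = (if b = 1 then tautv i w else perp (fst w) (tautv i w)) in
     (sqrt 2 / sqrt (g (fst w) x x)) *\<^sub>R x)"

lemma taut_frame_unitary: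
  assumes w: "fst w \<in> U" shows "unitary_at (fst w) (taut_frame i w)"
proof -
  have v: "tautv i w \<noteq> 0" by (simp add: tautv_def affine_vec_neq_0)
  have "H (fst w) (tautv i w) (perp (fst w) (tautv i w)) = 0"
    using H_perp[OF w, of "tautv i w"] H_cnj[OF w, of "perp (fst w) (tautv i w)" "tautv i w"] by simp
  then show ?thesis
    using normalize_H[OF w v, of 2] normalize_H[OF w perp_neq_0[OF w v], of 2]
    by (simp add: unitary_at_def taut_frame_def Let_def w del: H_scaleR) (simp add: w)
qed

lemma smooth_taut_frame: "smooth_on U' (taut_frame i)"
proof -
  have sm: "smooth_on U' (\<lambda>w. (sqrt 2 / sqrt (g (fst w) (x w) (x w))) *\<^sub>R x w)"
    if x: "smooth_on U' x" and x0: "\<And>w. w \<in> U' \<Longrightarrow> x w \<noteq> 0" for x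
  proof -
    have "smooth_on U' (\<lambda>w. Re (H (fst w) (x w) (x w)))"
      by (rule smooth_on_bounded_linear[OF open_U' bounded_linear_Re smooth_H_along[OF x x]])
    then have gx: "smooth_on U' (\<lambda>w. g (fst w) (x w) (x w))" by simp
    have pos': "g (fst w) (x w) (x w) > 0" if "w \<in> U'" for w
      using pos[OF _ x0[OF that]] that by (auto simp: mem_Times_iff)
    have "smooth_on U' (\<lambda>w. (sqrt 2 * g (fst w) (x w) (x w) powr (-1/2)) *\<^sub>R x w)"
      by (intro smooth_on_scaleR smooth_on_mult smooth_on_const smooth_on_powr gx pos' x open_U')
    moreover have "sqrt 2 * g (fst w) (x w) (x w) powr (-1/2) = sqrt 2 / sqrt (g (fst w) (x w) (x w))" if "w \<in> U'" for w
      using pos'[OF that] by (simp add: powr_minus_divide powr_half_sqrt)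
    ultimately show ?thesis by (subst (asm) smooth_on_cong[OF open_U']) auto
  qed
  have ax: "smooth_on U' (\<lambda>w. f w *s axis j 1)" if "smooth_on U' f" for f :: "(complex^2) \<times> complex \<Rightarrow> complex" and j :: 2
  proof (rule smooth_on_bounded_linear[OF open_U' _ that])
    show "bounded_linear (\<lambda>k::complex. k *s axis j (1::complex))"
      by (rule linear_conv_bounded_linear[THEN iffD1]) (rule linearI, simp_all add: vec_eq_iff distrib_right)
  qed
  have perp: "smooth_on U' (\<lambda>w. perp (fst w) (tautv i w))"
    unfolding perp_def by (intro smooth_on_diff ax smooth_H_along smooth_on_const smooth_tautv open_U')
  have v: "tautv i w \<noteq> 0" for w by (simp add: tautv_def affine_vec_neq_0)
  show ?thesis
    unfolding taut_frame_def[abs_def] Let_def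
  proof (rule smooth_on_vec2[OF open_U'])
    show "smooth_on U' (\<lambda>w. (sqrt 2 / sqrt (g (fst w) (if 1 = (1::2) then tautv i w else perp (fst w) (tautv i w))
        (if 1 = (1::2) then tautv i w else perp (fst w) (tautv i w)))) *\<^sub>R (if 1 = (1::2) then tautv i w else perp (fst w) (tautv i w)))"
      using sm[OF smooth_tautv v] by simp
    show "smooth_on U' (\<lambda>w. (sqrt 2 / sqrt (g (fst w) (if 2 = (1::2) then tautv i w else perp (fst w) (tautv i w))
        (if 2 = (1::2) then tautv i w else perp (fst w) (tautv i w)))) *\<^sub>R (if 2 = (1::2) then tautv i w else perp (fst w) (tautv i w)))"
      using sm[OF perp] perp_neq_0[OF _ v] by (auto simp: mem_Times_iff)
  qed
qed

end

section \<open>Hermitian surfaces in charts\<close>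

locale hermitian_atlas =
  fixes A :: "('m::{t2_space,second_countable_topology}) cchart set" and h :: "'m metric"
  assumes hermitian: "hermitian_surface A h"
begin

lemma surface: "complex_surface A"
  using hermitian by (simp add: hermitian_surface_def)

lemma chart:
  assumes "c \<in> A"
  shows "open (chart_dom c)" "open (chart_image c)"
    "homeomorphism (chart_dom c) (chart_image c) (chart_map c) (chart_inv c)"
  using surface assms by (auto simp: complex_surface_def)

lemma chart_inv_map: "c \<in> A \<Longrightarrow> x \<in> chart_dom c \<Longrightarrow> chart_inv c (chart_map c x) = x"
  using chart(3) homeomorphism_apply1 by metis

lemma chart_map_inv: "c \<in> A \<Longrightarrow> p \<in> chart_image c \<Longrightarrow> chart_map c (chart_inv c p) = p"
  using chart(3) homeomorphism_apply2 by metis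

lemma chart_inv_in: "c \<in> A \<Longrightarrow> p \<in> chart_image c \<Longrightarrow> chart_inv c p \<in> chart_dom c"
  using homeomorphism_image2[OF chart(3)] by blast

lemma chart_map_in: "x \<in> chart_dom c \<Longrightarrow> chart_map c x \<in> chart_image c"
  by (simp add: chart_image_def)

lemma in_surface_points: "c \<in> A \<Longrightarrow> x \<in> chart_dom c \<Longrightarrow> x \<in> surface_points A"
  by (auto simp: surface_points_def)

abbreviation transition :: "'m cchart \<Rightarrow> 'm cchart \<Rightarrow> complex^2 \<Rightarrow> complex^2"
  where "transition c c' \<equiv> chart_map c' \<circ> chart_inv c"

lemma transition_derivative:
  assumes "c \<in> A" "c' \<in> A" "x \<in> chart_dom c" "x \<in> chart_dom c'"
  shows "transition c c' differentiable (at (chart_map c x))"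
    and "dir_deriv (transition c c') (chart_map c x) (k *s v) = k *s dir_deriv (transition c c') (chart_map c x) v"
proof -
  have "holomorphic2_on (transition c c') (chart_map c ` (chart_dom c \<inter> chart_dom c'))"
    using surface assms by (auto simp: complex_surface_def)
  moreover have "chart_map c x \<in> chart_map c ` (chart_dom c \<inter> chart_dom c')" using assms by blast
  ultimately obtain L where L: "(transition c c' has_derivative L) (at (chart_map c x))"
    "\<And>k v. L (k *s v) = k *s L v"
    unfolding holomorphic2_on_def by blast
  show "transition c c' differentiable (at (chart_map c x))"
    using L(1) by (auto simp: differentiable_def)
  show "dir_deriv (transition c c') (chart_map c x) (k *s v) = k *s dir_deriv (transition c c') (chart_map c x) v"
    using L(2) by (simp add: dir_deriv_eqI[OF L(1)])
qed

lemma open_chart_map_image: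
  assumes c: "c \<in> A" and V: "open V" "V \<subseteq> chart_dom c"
  shows "open (chart_map c ` V)"
proof -
  have "openin (top_of_set (chart_dom c)) V"
    using V by (simp add: open_subset)
  then have "openin (top_of_set (chart_image c)) (chart_map c ` V)"
    by (rule homeomorphism_imp_open_map[OF chart(3)[OF c]])
  then show ?thesis using chart(2)[OF c] by (meson openin_open_trans)
qed

lemma transition_self:
  assumes c: "c \<in> A" "x \<in> chart_dom c"
  shows "dir_deriv (transition c c) (chart_map c x) v = v"
proof -
  have "dir_deriv (transition c c) (chart_map c x) v = dir_deriv (\<lambda>p. p) (chart_map c x) v"
    by (rule dir_deriv_cong[OF chart(2)[OF c(1)] chart_map_in[OF c(2)]]) (simp add: chart_map_inv[OF c(1)])
  then show ?thesis by simp
qed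

lemma transition_cocycle:
  assumes A: "c \<in> A" "c' \<in> A" "c'' \<in> A" and x: "x \<in> chart_dom c" "x \<in> chart_dom c'" "x \<in> chart_dom c''"
  shows "dir_deriv (transition c c'') (chart_map c x) v
    = dir_deriv (transition c' c'') (chart_map c' x) (dir_deriv (transition c c') (chart_map c x) v)"
proof -
  let ?V = "chart_dom c \<inter> chart_dom c' \<inter> chart_dom c''"
  have "open ?V" using chart(1) A by (intro open_Int) auto
  then have op: "open (chart_map c ` ?V)" by (rule open_chart_map_image[OF A(1)]) auto
  have x': "chart_map c x \<in> chart_map c ` ?V" using x by blast
  have e: "transition c c' (chart_map c x) = chart_map c' x" by (simp add: chart_inv_map[OF A(1) x(1)])
  have "dir_deriv (transition c c'') (chart_map c x) v
      = dir_deriv (\<lambda>p. transition c' c'' (transition c c' p)) (chart_map c x) v"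
    by (rule dir_deriv_cong[OF op x']) (auto simp: chart_inv_map A)
  also have "\<dots> = dir_deriv (transition c' c'') (chart_map c' x) (dir_deriv (transition c c') (chart_map c x) v)"
  proof (rule dir_deriv_eqI)
    have 1: "(transition c c' has_derivative dir_deriv (transition c c') (chart_map c x)) (at (chart_map c x))"
      by (rule differentiable_imp_dir_deriv[OF transition_derivative(1)[OF A(1,2) x(1,2)]])
    have 2: "(transition c' c'' has_derivative dir_deriv (transition c' c'') (chart_map c' x)) (at (transition c c' (chart_map c x)))"
      unfolding e by (rule differentiable_imp_dir_deriv[OF transition_derivative(1)[OF A(2,3) x(2,3)]])
    show "((\<lambda>p. transition c' c'' (transition c c' p)) has_derivative
      (\<lambda>v. dir_deriv (transition c' c'') (chart_map c' x) (dir_deriv (transition c c') (chart_map c x) v))) (at (chart_map c x))"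
      by (rule has_derivative_compose[OF 1 2])
  qed
  finally show ?thesis .
qed

subsection \<open>Tangent vectors\<close>

lemma tangentD:
  assumes "v \<in> tangent_space A x"
  shows "\<not> (c \<in> A \<and> x \<in> chart_dom c) \<Longrightarrow> v c = 0"
    and "c \<in> A \<Longrightarrow> c' \<in> A \<Longrightarrow> x \<in> chart_dom c \<Longrightarrow> x \<in> chart_dom c' \<Longrightarrow>
      v c' = dir_deriv (transition c c') (chart_map c x) (v c)"
  using assms unfolding tangent_space_def by blast+

lemma tangentI:
  assumes "\<And>c. \<not> (c \<in> A \<and> x \<in> chart_dom c) \<Longrightarrow> v c = 0"
    and "\<And>c c'. c \<in> A \<Longrightarrow> c' \<in> A \<Longrightarrow> x \<in> chart_dom c \<Longrightarrow> x \<in> chart_dom c' \<Longrightarrow>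
      v c' = dir_deriv (transition c c') (chart_map c x) (v c)"
  shows "v \<in> tangent_space A x"
  using assms unfolding tangent_space_def by blast

lemma tangent_vector_eqI:
  assumes c: "c \<in> A" "x \<in> chart_dom c" and v: "v \<in> tangent_space A x" and w: "w \<in> tangent_space A x" and eq: "v c = w c"
  shows "v = w"
proof
  fix c'
  show "v c' = w c'"
  proof (cases "c' \<in> A \<and> x \<in> chart_dom c'")
    case True
    then show ?thesis
      using tangentD(2)[OF v c(1) _ c(2), of c'] tangentD(2)[OF w c(1) _ c(2), of c'] eq by simp
  next
    case False
    then show ?thesis using tangentD(1)[OF v False] tangentD(1)[OF w False] by simp
  qed
qed

lemma tvec_at_in:
  assumes c: "c \<in> A" "x \<in> chart_dom c"
  shows "tvec_at A c x a \<in> tangent_space A x" "tvec_at A c x a c = a"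
proof -
  define v where "v = (\<lambda>c'. if c' \<in> A \<and> x \<in> chart_dom c' then dir_deriv (transition c c') (chart_map c x) a else 0)"
  have "v \<in> tangent_space A x"
  proof (rule tangentI)
    fix c' c'' assume *: "c' \<in> A" "c'' \<in> A" "x \<in> chart_dom c'" "x \<in> chart_dom c''"
    then show "v c'' = dir_deriv (transition c' c'') (chart_map c' x) (v c')"
      using transition_cocycle[OF c(1) *(1,2) c(2) *(3,4), of a] by (simp add: v_def)
  qed (auto simp: v_def)
  moreover have "v c = a" using c by (simp add: v_def transition_self)
  ultimately have "tvec_at A c x a = v"
    unfolding tvec_at_def by (intro the_equality conjI tangent_vector_eqI[OF c]) simp_all
  then show "tvec_at A c x a \<in> tangent_space A x" "tvec_at A c x a c = a"
    using \<open>v \<in> tangent_space A x\<close> \<open>v c = a\<close> by simp_all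
qed

lemma tvec_at_eq:
  assumes c: "c \<in> A" "x \<in> chart_dom c" and v: "v \<in> tangent_space A x"
  shows "tvec_at A c x (v c) = v"
  by (rule tangent_vector_eqI[OF c tvec_at_in(1)[OF c] v]) (rule tvec_at_in(2)[OF c])

lemma zero_tangent: "(\<lambda>c. 0) \<in> tangent_space A x"
proof (rule tangentI)
  fix c c' assume "c \<in> A" "c' \<in> A" "x \<in> chart_dom c" "x \<in> chart_dom c'"
  from transition_derivative(2)[OF this, of 0 0]
  show "0 = dir_deriv (transition c c') (chart_map c x) 0" by simp
qed simp

lemma tvec_scale_tangent:
  assumes v: "v \<in> tangent_space A x" shows "tvec_scale k v \<in> tangent_space A x"
proof (rule tangentI)
  fix c c' assume c: "c \<in> A" "c' \<in> A" "x \<in> chart_dom c" "x \<in> chart_dom c'"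
  show "tvec_scale k v c' = dir_deriv (transition c c') (chart_map c x) (tvec_scale k v c)"
    unfolding tvec_scale_def transition_derivative(2)[OF c] tangentD(2)[OF v c] ..
qed (simp add: tvec_scale_def tangentD(1)[OF v])

lemma tvec_add_tangent:
  assumes v: "v \<in> tangent_space A x" and w: "w \<in> tangent_space A x"
  shows "tvec_add v w \<in> tangent_space A x"
proof (rule tangentI)
  fix c c' assume c: "c \<in> A" "c' \<in> A" "x \<in> chart_dom c" "x \<in> chart_dom c'"
  show "tvec_add v w c' = dir_deriv (transition c c') (chart_map c x) (tvec_add v w c)"
    unfolding tvec_add_def dir_deriv_vec_add[OF transition_derivative(1)[OF c]]
      tangentD(2)[OF v c] tangentD(2)[OF w c] ..
qed (simp add: tvec_add_def tangentD(1)[OF v] tangentD(1)[OF w])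

lemma tvec_at_scale:
  assumes c: "c \<in> A" "x \<in> chart_dom c"
  shows "tvec_at A c x (k *s a) = tvec_scale k (tvec_at A c x a)"
  by (rule tangent_vector_eqI[OF c tvec_at_in(1)[OF c] tvec_scale_tangent[OF tvec_at_in(1)[OF c]]])
     (simp add: tvec_scale_def tvec_at_in(2)[OF c])

lemma tvec_at_add:
  assumes c: "c \<in> A" "x \<in> chart_dom c"
  shows "tvec_at A c x (a + b) = tvec_add (tvec_at A c x a) (tvec_at A c x b)"
  by (rule tangent_vector_eqI[OF c tvec_at_in(1)[OF c] tvec_add_tangent[OF tvec_at_in(1)[OF c] tvec_at_in(1)[OF c]]])
     (simp add: tvec_add_def tvec_at_in(2)[OF c])

lemma tvec_at_eq_0_iff:
  assumes c: "c \<in> A" "x \<in> chart_dom c"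
  shows "tvec_at A c x a = (\<lambda>c. 0) \<longleftrightarrow> a = 0"
  using tvec_at_in(2)[OF c, of a] tangent_vector_eqI[OF c tvec_at_in(1)[OF c, of a] zero_tangent] by auto

lemma hermitian_metric_comp:
  assumes c: "c \<in> A" shows "hermitian_metric (chart_image c) (metric_comp A h c)"
proof -
  have h: "h x (tvec_add (tvec_scale (of_real r) u) v) w = r * h x u w + h x v w" "h x u v = h x v u"
      "u \<noteq> (\<lambda>c. 0) \<Longrightarrow> h x u u > 0" "h x (tvec_scale \<i> u) (tvec_scale \<i> v) = h x u v"
    if "x \<in> surface_points A" "u \<in> tangent_space A x" "v \<in> tangent_space A x" "w \<in> tangent_space A x" for x u v w r
    using hermitian that unfolding hermitian_surface_def by blast+
  show ?thesis
  proof
    show "open (chart_image c)" by (rule chart(2)[OF c])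
    show "smooth_on (chart_image c) (\<lambda>p. metric_comp A h c p X Y)" for X Y
      using hermitian c unfolding hermitian_surface_def by blast
    fix p assume p: "p \<in> chart_image c"
    define x where "x = chart_inv c p"
    have cx: "c \<in> A" "x \<in> chart_dom c" using c chart_inv_in[OF c p] by (auto simp: x_def)
    note s = in_surface_points[OF cx]
    note T = tvec_at_in(1)[OF cx]
    note m = metric_comp_def x_def[symmetric]
    show sym: "metric_comp A h c p X Y = metric_comp A h c p Y X" for X Y
      unfolding m by (rule h(2)[OF s T T T])
    show "metric_comp A h c p X X > 0" if "X \<noteq> 0" for X
      unfolding m using that by (intro h(3)[OF s T T T]) (simp add: tvec_at_eq_0_iff[OF cx])
    show "metric_comp A h c p (\<i> *s X) (\<i> *s Y) = metric_comp A h c p X Y" for X Y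
      unfolding m tvec_at_scale[OF cx] by (rule h(4)[OF s T T T])
    have l: "metric_comp A h c p (r *\<^sub>R X + Y) Z = r * metric_comp A h c p X Z + metric_comp A h c p Y Z" for r X Y Z
      unfolding m scaleR_eq_smult tvec_at_add[OF cx] tvec_at_scale[OF cx] by (rule h(1)[OF s T T T])
    have 0: "metric_comp A h c p 0 Z = 0" for Z using l[of 1 0 0 Z] by simp
    have lin: "linear (\<lambda>X. metric_comp A h c p X Z)" for Z
      using l[of 1 _ _ Z] l[of _ _ 0 Z] 0 by (intro linearI) (metis scaleR_one mult_1, metis add_0_right real_scaleR_def)
    have flip: "metric_comp A h c p X = (\<lambda>Y. metric_comp A h c p Y X)" for X
      by (rule ext) (rule sym)
    have "linear (metric_comp A h c p X)" for X by (subst flip) (rule lin)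
    then show "bilinear (metric_comp A h c p)"
      unfolding bilinear_def using lin by blast
  qed
qed

subsection \<open>Charts of the twistor space\<close>

lemma complex_line_scale:
  assumes k: "k \<noteq> 0" shows "complex_line (tvec_scale k u) = complex_line u"
proof (intro subset_antisym subsetI)
  fix y assume "y \<in> complex_line (tvec_scale k u)"
  then obtain l where "y = tvec_scale l (tvec_scale k u)" by (auto simp: complex_line_def)
  then have "y = tvec_scale (l * k) u" by (simp add: tvec_scale_def)
  then show "y \<in> complex_line u" unfolding complex_line_def by blast
next
  fix y assume "y \<in> complex_line u"
  then obtain l where "y = tvec_scale l u" by (auto simp: complex_line_def)
  then have "y = tvec_scale (l / k) (tvec_scale k u)" using k by (simp add: tvec_scale_def)
  then show "y \<in> complex_line (tvec_scale k u)" unfolding complex_line_def by blast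
qed

lemma twistor_chart_map:
  assumes c: "c \<in> A" "x \<in> chart_dom c"
  shows "(x, complex_line (tvec_at A c x (affine_vec i t))) \<in> chart_dom (twistor_chart A c i)"
    and "chart_map (twistor_chart A c i) (x, complex_line (tvec_at A c x (affine_vec i t))) = (chart_map c x, t)"
proof -
  define v where "v = tvec_at A c x (affine_vec i t)"
  have v: "v \<in> tangent_space A x" "v c = affine_vec i t" unfolding v_def by (rule tvec_at_in[OF c])+
  have i: "affine_vec i t $ i = 1" for t by (simp add: affine_vec_def)
  have "v \<noteq> (\<lambda>c. 0)" unfolding v_def by (simp add: tvec_at_eq_0_iff[OF c] affine_vec_neq_0)
  moreover have "tvec_scale 1 v \<in> complex_line v" unfolding complex_line_def by blast
  then have vl: "v \<in> complex_line v" by (simp add: tvec_scale_def)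
  moreover have "v c $ i \<noteq> 0" by (simp add: v(2) i)
  ultimately show "(x, complex_line v) \<in> chart_dom (twistor_chart A c i)"
    using v(1) c in_surface_points[OF c] by (auto simp: twistor_chart_def twistor_space_def)
  have "(THE s. \<exists>u\<in>complex_line v. u c = affine_vec i s) = t"
  proof (rule the_equality)
    show "\<exists>u\<in>complex_line v. u c = affine_vec i t" using vl v(2) by blast
    fix s assume "\<exists>u\<in>complex_line v. u c = affine_vec i s"
    then obtain k where k: "k *s affine_vec i t = affine_vec i s"
      by (auto simp: complex_line_def tvec_scale_def v(2))
    have "k = 1" using arg_cong[OF k, of "\<lambda>x. x $ i"] by (simp add: i)
    obtain j :: 2 where j: "j \<noteq> i" by (metis exhaust_2 zero_neq_one)
    have "t = affine_vec i t $ j" "s = affine_vec i s $ j" using j by (simp_all add: affine_vec_def)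
    then show "s = t" using k \<open>k = 1\<close> by simp
  qed
  then show "chart_map (twistor_chart A c i) (x, complex_line v) = (chart_map c x, t)"
    by (simp add: twistor_chart_def)
qed

lemma twistor_chart_dom:
  assumes c: "c \<in> A" and z: "z \<in> chart_dom (twistor_chart A c i)"
  obtains x t where "x \<in> chart_dom c" "z = (x, complex_line (tvec_at A c x (affine_vec i t)))"
proof -
  have "z \<in> twistor_space A" and zc: "fst z \<in> chart_dom c" "\<exists>u\<in>snd z. u c $ i \<noteq> 0"
    using z by (simp_all add: twistor_chart_def)
  then obtain x v where z': "z = (x, complex_line v)" "v \<in> tangent_space A x"
    unfolding twistor_space_def by blast
  then have z': "z = (x, complex_line v)" "v \<in> tangent_space A x" "x \<in> chart_dom c"
    and ex: "\<exists>u\<in>complex_line v. u c $ i \<noteq> 0"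
    using zc by simp_all
  have vi: "v c $ i \<noteq> 0" using ex by (auto simp: complex_line_def tvec_scale_def)
  obtain j :: 2 where j: "j \<noteq> i" by (metis exhaust_2 zero_neq_one)
  define t where "t = v c $ j / v c $ i"
  have ij: "n = i \<or> n = j" for n using j exhaust_2 by metis
  have "v c = (v c $ i) *s affine_vec i t"
    using vi ij j by (auto simp: vec_eq_iff affine_vec_def t_def)
  then have v: "v = tvec_scale (v c $ i) (tvec_at A c x (affine_vec i t))"
    using tvec_at_eq[OF c z'(3,2)] tvec_at_scale[OF c z'(3)] by metis
  from complex_line_scale[OF vi, of "tvec_at A c x (affine_vec i t)"]
  have "complex_line v = complex_line (tvec_at A c x (affine_vec i t))"
    unfolding v[symmetric] .
  then show thesis using that z' by blast
qed

lemma inj_twistor_chart: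
  assumes c: "c \<in> A" shows "inj_on (chart_map (twistor_chart A c i)) (chart_dom (twistor_chart A c i))"
proof (rule inj_onI)
  fix z z' assume z: "z \<in> chart_dom (twistor_chart A c i)" and z': "z' \<in> chart_dom (twistor_chart A c i)"
    and eq: "chart_map (twistor_chart A c i) z = chart_map (twistor_chart A c i) z'"
  obtain x t where x: "x \<in> chart_dom c" "z = (x, complex_line (tvec_at A c x (affine_vec i t)))"
    using twistor_chart_dom[OF c z] .
  obtain x' t' where x': "x' \<in> chart_dom c" "z' = (x', complex_line (tvec_at A c x' (affine_vec i t')))"
    using twistor_chart_dom[OF c z'] .
  have "chart_map c x = chart_map c x'" "t = t'"
    using eq unfolding x(2) x'(2) twistor_chart_map(2)[OF c x(1)] twistor_chart_map(2)[OF c x'(1)] by auto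
  moreover from this have "x = x'" using chart_inv_map[OF c x(1)] chart_inv_map[OF c x'(1)] by metis
  ultimately show "z = z'" using x x' by simp
qed

lemma twistor_chart_image:
  assumes c: "c \<in> A" shows "chart_image (twistor_chart A c i) = chart_image c \<times> UNIV"
proof (intro subset_antisym subsetI)
  fix w assume "w \<in> chart_image (twistor_chart A c i)"
  then obtain z where z: "z \<in> chart_dom (twistor_chart A c i)" "w = chart_map (twistor_chart A c i) z"
    unfolding chart_image_def by blast
  obtain x t where x: "x \<in> chart_dom c" "z = (x, complex_line (tvec_at A c x (affine_vec i t)))"
    using twistor_chart_dom[OF c z(1)] .
  then show "w \<in> chart_image c \<times> UNIV" using z(2) twistor_chart_map(2)[OF c x(1)] chart_map_in by simp
next
  fix w assume "w \<in> chart_image c \<times> (UNIV :: complex set)"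
  then have p: "fst w \<in> chart_image c" by (simp add: mem_Times_iff)
  note x = chart_inv_in[OF c p]
  have "chart_map (twistor_chart A c i) (chart_inv c (fst w), complex_line (tvec_at A c (chart_inv c (fst w)) (affine_vec i (snd w)))) = w"
    using twistor_chart_map(2)[OF c x] chart_map_inv[OF c p] by simp
  then show "w \<in> chart_image (twistor_chart A c i)"
    unfolding chart_image_def using twistor_chart_map(1)[OF c x] by (metis imageI)
qed

lemma twistor_chart_inv:
  assumes c: "c \<in> A" and p: "p \<in> chart_image c"
  shows "chart_inv (twistor_chart A c i) (p, t)
    = (chart_inv c p, complex_line (tvec_at A c (chart_inv c p) (affine_vec i t)))"
  unfolding chart_inv_def[of "twistor_chart A c i"]
  using twistor_chart_map[OF c chart_inv_in[OF c p], of i t] chart_map_inv[OF c p]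
  by (intro inv_into_f_eq[OF inj_twistor_chart[OF c]]) simp_all

end

section \<open>The fundamental forms in twistor charts\<close>

text \<open>The coefficients \<open>(a, b, m)\<close> for which the n-th fundamental form is \<open>twistor_form i a b m\<close>. As
  \<open>\<phi>\<^sup>2\<close> enters the first two forms with the opposite sign, these are twice the \<open>\<phi>\<^sup>1\<close>-term minus the sum
  of the first two terms.\<close>

definition form_coeffs :: "nat \<Rightarrow> real \<Rightarrow> real \<times> real \<times> real"
  where "form_coeffs n lam = (if n = 1 then (1, -1, lam\<^sup>2) else if n = 2 then (1, -1, - lam\<^sup>2)
    else if n = 3 then (0, 1, lam\<^sup>2) else (0, 1, - lam\<^sup>2))"

context hermitian_atlas
begin

definition section_frame :: "'m cchart \<Rightarrow> 2 \<Rightarrow> ('m zpoint \<Rightarrow> 'm frame) \<Rightarrow> (complex^2) \<times> complex \<Rightarrow> complex^2^2"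
  where "section_frame c i u w = (\<chi> b. (snd (u (chart_inv (twistor_chart A c i) w)) $ b) c)"

context
  fixes c assumes c: "c \<in> A"
begin

interpretation M: hermitian_metric "chart_image c" "metric_comp A h c"
  by (rule hermitian_metric_comp[OF c])

lemma metric_at:
  assumes p: "p \<in> chart_image c" and u: "u \<in> tangent_space A (chart_inv c p)" "v \<in> tangent_space A (chart_inv c p)"
  shows "h (chart_inv c p) u v = metric_comp A h c p (u c) (v c)"
  unfolding metric_comp_def tvec_at_eq[OF c chart_inv_in[OF c p] u(1)] tvec_at_eq[OF c chart_inv_in[OF c p] u(2)] ..

lemma orthonormal_real_frame_iff:
  assumes p: "p \<in> chart_image c" and u: "\<And>b. u $ b \<in> tangent_space A (chart_inv c p)"
  shows "orthonormal4 (h (chart_inv c p)) (real_frame u) \<longleftrightarrow> M.unitary_at p (\<chi> b. (u $ b) c)"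
proof -
  have "real_frame u i \<in> tangent_space A (chart_inv c p)" for i
    unfolding real_frame_def by (simp add: tvec_scale_tangent u)
  then have "h (chart_inv c p) (real_frame u i) (real_frame u j)
      = metric_comp A h c p (M.real_frame_at (\<chi> b. (u $ b) c) i) (M.real_frame_at (\<chi> b. (u $ b) c) j)" for i j
    by (subst metric_at[OF p]) (simp_all add: real_frame_def M.real_frame_at_def tvec_scale_def)
  then show ?thesis
    unfolding M.unitary_at_iff_orthonormal[OF p, symmetric] orthonormal4_def by simp
qed

lemma section_frame:
  assumes u: "local_section A h c i W u"
  shows "\<And>w. w \<in> W \<Longrightarrow> (frame_coords c \<circ> u \<circ> chart_inv (twistor_chart A c i)) w = (fst w, section_frame c i u w)"
    and "\<And>w. w \<in> W \<Longrightarrow> M.unitary_at (fst w) (section_frame c i u w)"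
    and "\<And>w. w \<in> W \<Longrightarrow> section_frame c i u w $ 1 = (section_frame c i u w $ 1 $ i) *s M.tautv i w"
proof -
  fix w assume w: "w \<in> W"
  have "W \<subseteq> chart_image c \<times> UNIV"
    using u unfolding local_section_def twistor_chart_image[OF c] by blast
  then have p: "fst w \<in> chart_image c" using w by (auto simp: mem_Times_iff)
  define x z where "x = chart_inv c (fst w)" and "z = chart_inv (twistor_chart A c i) w"
  have cx: "c \<in> A" "x \<in> chart_dom c" using c chart_inv_in[OF c p] by (auto simp: x_def)
  have z: "z = (x, complex_line (tvec_at A c x (affine_vec i (snd w))))"
    using twistor_chart_inv[OF c p, of i "snd w"] by (simp add: z_def x_def)
  have uz: "u z \<in> unitary_frames A h" "twistor_proj (u z) = z"
    using u w unfolding local_section_def z_def by blast+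
  have fst_u: "fst (u z) = x" and line: "complex_line (snd (u z) $ 1) = complex_line (tvec_at A c x (affine_vec i (snd w)))"
    using uz(2) unfolding twistor_proj_def z by auto
  have tan: "snd (u z) $ b \<in> tangent_space A x" for b
    using uz(1) fst_u unfolding unitary_frames_def by (cases "u z") auto
  have orth: "orthonormal4 (h x) (real_frame (snd (u z)))"
    using uz(1) fst_u unfolding unitary_frames_def by (cases "u z") auto
  show "(frame_coords c \<circ> u \<circ> chart_inv (twistor_chart A c i)) w = (fst w, section_frame c i u w)"
    unfolding frame_coords_def section_frame_def z_def[symmetric] comp_def fst_u
    by (simp add: x_def chart_map_inv[OF c p])
  show "M.unitary_at (fst w) (section_frame c i u w)"
    using orthonormal_real_frame_iff[OF p tan[unfolded x_def]] orth
    unfolding section_frame_def z_def[symmetric] x_def by blast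
  have "tvec_scale 1 (snd (u z) $ 1) \<in> complex_line (snd (u z) $ 1)"
    unfolding complex_line_def by blast
  then have "snd (u z) $ 1 \<in> complex_line (tvec_at A c x (affine_vec i (snd w)))"
    unfolding line by (simp add: tvec_scale_def)
  then obtain k where "snd (u z) $ 1 = tvec_scale k (tvec_at A c x (affine_vec i (snd w)))"
    by (auto simp: complex_line_def)
  then have a1: "section_frame c i u w $ 1 = k *s M.tautv i w"
    by (simp add: section_frame_def z_def[symmetric] tvec_scale_def tvec_at_in(2)[OF cx] M.tautv_def)
  moreover have "M.tautv i w $ i = 1" by (simp add: M.tautv_def affine_vec_def)
  ultimately show "section_frame c i u w $ 1 = (section_frame c i u w $ 1 $ i) *s M.tautv i w"
    by simp
qed

lemma pulled_back_forms_section: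
  assumes u: "local_section A h c i W u" and w: "w \<in> W"
  defines "a \<equiv> section_frame c i u"
  shows "a differentiable (at w)"
    and "pulled_back_forms A h c i u w 1 X = M.H (fst w) (fst X) (a w $ 1) / 2"
    and "pulled_back_forms A h c i u w 2 X = M.H (fst w) (fst X) (a w $ 2) / 2"
    and "pulled_back_forms A h c i u w 3 X = M.H (fst w) (M.cov (\<lambda>w. a w $ 2) w X) (a w $ 1) / 2"
proof -
  define \<sigma> where "\<sigma> = frame_coords c \<circ> u \<circ> chart_inv (twistor_chart A c i)"
  have W: "open W" "W \<subseteq> chart_image c \<times> UNIV" and sm: "smooth_on W \<sigma>"
    using u unfolding local_section_def twistor_chart_image[OF c] \<sigma>_def by blast+
  have p: "fst w \<in> chart_image c" using w W(2) by (auto simp: mem_Times_iff)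
  have \<sigma>: "\<sigma> w = (fst w, a w)" if "w \<in> W" for w
    using section_frame(1)[OF u that] by (simp add: \<sigma>_def a_def)
  have d: "\<sigma> differentiable (at w)" by (rule smooth_on_differentiable[OF sm w])
  have "(\<lambda>w. snd (\<sigma> w)) differentiable (at w)"
    by (rule differentiable_bounded_linear[OF bounded_linear_snd d])
  then show ad: "a differentiable (at w)"
    using differentiable_cong_open[OF W(1) w, of a "\<lambda>w. snd (\<sigma> w)"] \<sigma> by simp
  have f: "fst (dir_deriv \<sigma> w X) = fst X"
  proof -
    have "fst (dir_deriv \<sigma> w X) = dir_deriv (\<lambda>w. fst (\<sigma> w)) w X"
      by (rule dir_deriv_bounded_linear[OF bounded_linear_fst d, symmetric])
    also have "\<dots> = dir_deriv fst w X"
      by (rule dir_deriv_cong[OF W(1) w]) (simp add: \<sigma>)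
    also have "\<dots> = fst X" by (rule dir_deriv_eqI[OF bounded_linear_imp_has_derivative[OF bounded_linear_fst]])
    finally show ?thesis .
  qed
  have s: "snd (dir_deriv \<sigma> w X) $ 2 = dir_deriv (\<lambda>w. a w $ 2) w X"
  proof -
    have "snd (dir_deriv \<sigma> w X) = dir_deriv (\<lambda>w. snd (\<sigma> w)) w X"
      by (rule dir_deriv_bounded_linear[OF bounded_linear_snd d, symmetric])
    also have "\<dots> = dir_deriv a w X"
      by (rule dir_deriv_cong[OF W(1) w]) (simp add: \<sigma>)
    finally show ?thesis
      using dir_deriv_bounded_linear[OF bounded_linear_vec_nth ad, of 2 X] by simp
  qed
  have un: "M.unitary_at (fst w) (a w)" unfolding a_def by (rule section_frame(2)[OF u w])
  show "pulled_back_forms A h c i u w 1 X = M.H (fst w) (fst X) (a w $ 1) / 2"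
    "pulled_back_forms A h c i u w 2 X = M.H (fst w) (fst X) (a w $ 2) / 2"
    "pulled_back_forms A h c i u w 3 X = M.H (fst w) (M.cov (\<lambda>w. a w $ 2) w X) (a w $ 1) / 2"
    unfolding pulled_back_forms_def Let_def \<sigma>_def[symmetric] \<sigma>[OF w] canonical_form_def connection_form_def
    by (simp_all add: f s M.frame_coeff_unitary[OF p un] M.cov_def)
qed

lemma fundamental_expr_section:
  assumes u: "local_section A h c i W u" and w: "w \<in> W" and n: "n \<in> {1..4}"
    and co: "form_coeffs n lam = (a, b, m)"
  shows "fundamental_expr n lam (pulled_back_forms A h c i u w) X Y = M.twistor_form i a b m w X Y"
proof -
  have W: "open W" "W \<subseteq> chart_image c \<times> UNIV"
    using u unfolding local_section_def twistor_chart_image[OF c] by blast+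
  note pb = pulled_back_forms_section[OF u w]
  note F = M.unitary_section_forms[OF W(1) w W(2) pb(1) section_frame(2)[OF u] section_frame(3)[OF u]]
  define \<phi> where "\<phi> = pulled_back_forms A h c i u w"
  define B where "B X Y = M.H (fst w) (fst X) (M.tautv i w) * M.H (fst w) (M.tautv i w) (fst Y) / M.taut_norm i w / 2"
    for X Y :: "(complex^2) \<times> complex"
  have 1: "\<phi> 1 X * cnj (\<phi> 1 Y) = B X Y" for X Y
    unfolding \<phi>_def pb B_def by (rule F(1))
  have 2: "\<phi> 2 X * cnj (\<phi> 2 Y) = M.H (fst w) (fst X) (fst Y) / 2 - B X Y" for X Y
    unfolding \<phi>_def pb B_def by (rule F(2))
  have 3: "\<phi> 3 X * cnj (\<phi> 3 Y) = M.fubini_study i w Y X" for X Y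
    unfolding \<phi>_def pb by (rule F(3))
  have h1: "wedge (\<phi> 1) (conj_form (\<phi> 1)) X Y = B X Y - B Y X"
    and h2: "wedge (\<phi> 2) (conj_form (\<phi> 2)) X Y = M.herm_form (fst w) (fst X) (fst Y) - (B X Y - B Y X)"
    and h3: "wedge (\<phi> 3) (conj_form (\<phi> 3)) X Y = M.fubini_study i w Y X - M.fubini_study i w X Y"
    unfolding wedge_def conj_form_def 1 2 3 by (simp_all add: M.herm_form_def diff_divide_distrib)
  have anti: "wedge (conj_form \<alpha>) \<alpha> X Y = - wedge \<alpha> (conj_form \<alpha>) X Y" for \<alpha> :: "(complex^2) \<times> complex \<Rightarrow> complex"
    by (simp add: wedge_def)
  have tw: "M.twistor_form i a b m w X Y = \<i> * (complex_of_real a * (2 * (B X Y - B Y X))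
    + complex_of_real b * M.herm_form (fst w) (fst X) (fst Y)
    + complex_of_real m * (M.fubini_study i w Y X - M.fubini_study i w X Y))"
    unfolding M.twistor_form_def B_def by (simp add: diff_divide_distrib)
  have "n = 1 \<or> n = 2 \<or> n = 3 \<or> n = 4" using n by auto
  then show ?thesis
    unfolding \<phi>_def[symmetric] tw fundamental_expr_def Let_def anti h1 h2 h3
    using co by (elim disjE) (auto simp: form_coeffs_def algebra_simps)
qed

text \<open>The unitary frame obtained by normalizing \<open>v\<close> and a vector orthogonal to it is smooth over the
  whole twistor chart.\<close>

lemma ex_local_section: "\<exists>u. local_section A h c i (chart_image c \<times> UNIV) u"
proof -
  let ?tc = "twistor_chart A c i"
  define u where "u z = (fst z, \<chi> b. tvec_at A c (fst z) (M.taut_frame i (chart_map ?tc z) $ b))" for z :: "'m zpoint"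
  have z: "chart_inv ?tc w = (chart_inv c (fst w), complex_line (tvec_at A c (chart_inv c (fst w)) (affine_vec i (snd w))))"
    "chart_map ?tc (chart_inv ?tc w) = w" if "w \<in> chart_image c \<times> UNIV" for w
  proof -
    have p: "fst w \<in> chart_image c" using that by (auto simp: mem_Times_iff)
    show z: "chart_inv ?tc w = (chart_inv c (fst w), complex_line (tvec_at A c (chart_inv c (fst w)) (affine_vec i (snd w))))"
      using twistor_chart_inv[OF c p, of i "snd w"] by simp
    show "chart_map ?tc (chart_inv ?tc w) = w"
      unfolding z using twistor_chart_map(2)[OF c chart_inv_in[OF c p]] by (simp add: chart_map_inv[OF c p])
  qed
  have uf: "u (chart_inv ?tc w) \<in> unitary_frames A h \<and> twistor_proj (u (chart_inv ?tc w)) = chart_inv ?tc w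
      \<and> frame_coords c (u (chart_inv ?tc w)) = (fst w, M.taut_frame i w)"
    if w: "w \<in> chart_image c \<times> UNIV" for w
  proof -
    have p: "fst w \<in> chart_image c" using w by (auto simp: mem_Times_iff)
    define x where "x = chart_inv c (fst w)"
    have cx: "c \<in> A" "x \<in> chart_dom c" using c chart_inv_in[OF c p] by (auto simp: x_def)
    define f where "f = (\<chi> b. tvec_at A c x (M.taut_frame i w $ b))"
    have u: "u (chart_inv ?tc w) = (x, f)"
      unfolding u_def z(2)[OF w] by (simp add: z(1)[OF w] x_def f_def)
    have ft: "f $ b \<in> tangent_space A x" for b by (simp add: f_def tvec_at_in(1)[OF cx])
    have fc: "(\<chi> b. (f $ b) c) = M.taut_frame i w"
      by (simp add: f_def tvec_at_in(2)[OF cx] vec_eq_iff)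
    have "orthonormal4 (h x) (real_frame f)"
      unfolding x_def orthonormal_real_frame_iff[OF p ft[unfolded x_def]] fc
      by (rule M.taut_frame_unitary[OF p])
    then have "u (chart_inv ?tc w) \<in> unitary_frames A h"
      unfolding u unitary_frames_def using ft in_surface_points[OF cx] by simp
    moreover have "complex_line (f $ 1) = complex_line (tvec_at A c x (affine_vec i (snd w)))"
    proof -
      define k where "k = complex_of_real (sqrt 2 / sqrt (metric_comp A h c (fst w) (M.tautv i w) (M.tautv i w)))"
      have "metric_comp A h c (fst w) (M.tautv i w) (M.tautv i w) > 0"
        by (rule M.pos[OF p]) (simp add: M.tautv_def affine_vec_neq_0)
      then have k: "k \<noteq> 0" by (simp add: k_def)
      have "f $ 1 = tvec_scale k (tvec_at A c x (affine_vec i (snd w)))"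
        unfolding f_def M.taut_frame_def k_def tvec_at_scale[OF cx, symmetric]
        by (simp add: Let_def scaleR_eq_smult M.tautv_def)
      then show ?thesis by (simp add: complex_line_scale[OF k])
    qed
    then have "twistor_proj (u (chart_inv ?tc w)) = chart_inv ?tc w"
      unfolding twistor_proj_def u fst_conv snd_conv by (simp add: z(1)[OF w] x_def)
    moreover have "frame_coords c (u (chart_inv ?tc w)) = (fst w, M.taut_frame i w)"
      unfolding u frame_coords_def fst_conv snd_conv fc by (simp add: x_def chart_map_inv[OF c p])
    ultimately show ?thesis by blast
  qed
  have "smooth_on (chart_image c \<times> UNIV) (\<lambda>w. (fst w, M.taut_frame i w))"
    by (intro smooth_on_Pair M.open_U' M.smooth_taut_frame smooth_on_linear bounded_linear_fst)
  then have "smooth_on (chart_image c \<times> UNIV) (frame_coords c \<circ> u \<circ> chart_inv ?tc)"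
    by (subst smooth_on_cong[OF M.open_U']) (use uf in auto)
  then have "local_section A h c i (chart_image c \<times> UNIV) u"
    unfolding local_section_def twistor_chart_image[OF c] using M.open_U' uf by blast
  then show ?thesis by blast
qed

text \<open>Local sections exist, and each of them gives the same value.\<close>

lemma K_form_eq:
  assumes w: "w \<in> chart_image c \<times> UNIV" and n: "n \<in> {1..4}" and co: "form_coeffs n lam = (a, b, m)"
  shows "K_form A h n lam c i w X Y = M.twistor_form i a b m w X Y"
  unfolding K_form_def
proof (rule the_equality)
  show "\<exists>W u. local_section A h c i W u \<and> w \<in> W \<and>
      M.twistor_form i a b m w X Y = fundamental_expr n lam (pulled_back_forms A h c i u w) X Y"
    using ex_local_section[of i] fundamental_expr_section[OF _ w n co] w by metis
  show "k = M.twistor_form i a b m w X Y" if "\<exists>W u. local_section A h c i W u \<and> w \<in> W \<and>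
      k = fundamental_expr n lam (pulled_back_forms A h c i u w) X Y" for k
  proof -
    from that obtain W u where u: "local_section A h c i W u" "w \<in> W"
      and k: "k = fundamental_expr n lam (pulled_back_forms A h c i u w) X Y" by blast
    show ?thesis unfolding k by (rule fundamental_expr_section[OF u n co])
  qed
qed

lemma K_closed_in_chart:
  assumes n: "n \<in> {1..4}" and co: "form_coeffs n lam = (a, b, m)"
  shows "(\<forall>w\<in>chart_image (twistor_chart A c i). \<forall>X Y Z. ext_deriv2 (K_form A h n lam c i) w X Y Z = 0) \<longleftrightarrow>
    (\<forall>p\<in>chart_image c. \<forall>X Y. \<exists>k. \<forall>v. M.obstruction a m p X Y v = k *s v) \<and>
    (a + b = 0 \<or> (\<forall>p\<in>chart_image c. \<forall>X Y Z. ext_deriv2 (kaehler_form_comp A h c) p X Y Z = 0))"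
proof -
  have "ext_deriv2 (K_form A h n lam c i) w X Y Z = ext_deriv2 (M.twistor_form i a b m) w X Y Z"
    if "w \<in> chart_image c \<times> UNIV" for w X Y Z
    by (rule ext_deriv2_cong[OF M.open_U' that]) (rule K_form_eq[OF _ n co])
  moreover have "ext_deriv2 M.herm_form p X Y Z = 0 \<longleftrightarrow> ext_deriv2 (kaehler_form_comp A h c) p X Y Z = 0"
    if "p \<in> chart_image c" for p X Y Z
    unfolding M.ext_deriv2_herm_form[OF that] by (simp add: kaehler_form_comp_def[abs_def])
  ultimately show ?thesis
    using M.twistor_form_closed_iff[of i a b m] unfolding twistor_chart_image[OF c] by simp
qed

lemma space_form_condition_in_chart:
  assumes "m \<noteq> 0"
  shows "(\<forall>p\<in>chart_image c. \<forall>X Y. \<exists>k. \<forall>v. M.obstruction 1 m p X Y v = k *s v) \<longleftrightarrow>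
    (\<forall>p\<in>chart_image c. M.self_dual_at p \<and> (\<forall>Y Z. tracefree_ricci (metric_comp A h c) p Y Z = 0)
      \<and> scalar_curv (metric_comp A h c) p = 24 / m)"
  using M.obstruction_scalar_iff[OF _ assms] by blast

lemma self_dual_at_eq:
  "M.self_dual_at p \<longleftrightarrow> (\<forall>e \<alpha>. orthonormal4 (metric_comp A h c p) e \<longrightarrow>
       anti_self_dual_form (metric_comp A h c p) (kaehler_form_comp A h c p) \<alpha> \<longrightarrow>
       (\<forall>Z V. curv_operator e (weyl4 (metric_comp A h c) p) \<alpha> Z V = 0))"
  by (simp add: M.self_dual_at_def kaehler_form_comp_def[abs_def])

lemma K_closed_space_form_in_chart:
  assumes n: "n \<in> {1..4}" and co: "form_coeffs n lam = (1, -1, m)" and m: "m \<noteq> 0"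
  shows "(\<forall>w\<in>chart_image (twistor_chart A c i). \<forall>X Y Z. ext_deriv2 (K_form A h n lam c i) w X Y Z = 0) \<longleftrightarrow>
    (\<forall>p\<in>chart_image c. (\<forall>e \<alpha>. orthonormal4 (metric_comp A h c p) e \<longrightarrow>
       anti_self_dual_form (metric_comp A h c p) (kaehler_form_comp A h c p) \<alpha> \<longrightarrow>
       (\<forall>Z V. curv_operator e (weyl4 (metric_comp A h c) p) \<alpha> Z V = 0))
     \<and> (\<forall>Y Z. tracefree_ricci (metric_comp A h c) p Y Z = 0) \<and> scalar_curv (metric_comp A h c) p = 24 / m)"
  using K_closed_in_chart[OF n co] space_form_condition_in_chart[OF m] unfolding self_dual_at_eq by simp

lemma K_closed_flat_in_chart:
  assumes n: "n \<in> {1..4}" and co: "form_coeffs n lam = (0, 1, m)" and m: "m \<noteq> 0"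
  shows "(\<forall>w\<in>chart_image (twistor_chart A c i). \<forall>X Y Z. ext_deriv2 (K_form A h n lam c i) w X Y Z = 0) \<longleftrightarrow>
    (\<forall>p\<in>chart_image c. \<forall>X Y Z. curvature (metric_comp A h c) p X Y Z = 0) \<and>
    (\<forall>p\<in>chart_image c. \<forall>X Y Z. ext_deriv2 (kaehler_form_comp A h c) p X Y Z = 0)"
proof -
  have "(\<forall>p\<in>chart_image c. \<forall>X Y. \<exists>k. \<forall>v. M.obstruction 0 m p X Y v = k *s v)
      \<longleftrightarrow> (\<forall>p\<in>chart_image c. \<forall>X Y Z. curvature (metric_comp A h c) p X Y Z = 0)"
    if "\<forall>p\<in>chart_image c. \<forall>X Y Z. ext_deriv2 (kaehler_form_comp A h c) p X Y Z = 0"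
    by (rule M.kaehler_obstruction_iff_flat[OF _ m]) (use that in \<open>simp add: kaehler_form_comp_def[abs_def]\<close>)
  then show ?thesis using K_closed_in_chart[OF n co] by auto
qed

end

theorem K_closed_space_form_iff:
  assumes n: "n \<in> {1..4}" and co: "form_coeffs n lam = (1, -1, m)" and m: "m \<noteq> 0"
  shows "K_closed A h n lam \<longleftrightarrow> self_dual A h \<and> einstein A h \<and> has_scalar_curvature A h (24 / m)"
  unfolding K_closed_def self_dual_def einstein_def has_scalar_curvature_def
  by (simp only: K_closed_space_form_in_chart[OF _ n co m] ball_conj_distrib simp_thms cong: ball_cong)

theorem K_closed_flat_iff:
  assumes n: "n \<in> {1..4}" and co: "form_coeffs n lam = (0, 1, m)" and m: "m \<noteq> 0"
  shows "K_closed A h n lam \<longleftrightarrow> flat A h \<and> kaehler A h"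
  unfolding K_closed_def flat_def kaehler_def
  by (simp only: K_closed_flat_in_chart[OF _ n co m] ball_conj_distrib simp_thms cong: ball_cong)

end

theorem theorem3p4:
  fixes A :: "('m::{t2_space,second_countable_topology}) cchart set"
    and h :: "'m metric"
    and lam :: real
  assumes "hermitian_surface A h" and "lam > 0"
  shows "(K_closed A h 1 lam \<longleftrightarrow>
            self_dual A h \<and> einstein A h \<and> has_scalar_curvature A h (24 / lam\<^sup>2)) \<and>
         (K_closed A h 2 lam \<longleftrightarrow>
            self_dual A h \<and> einstein A h \<and> has_scalar_curvature A h (- 24 / lam\<^sup>2)) \<and>
         (K_closed A h 3 lam \<longleftrightarrow> K_closed A h 4 lam) \<and>
         (K_closed A h 4 lam \<longleftrightarrow> flat A h \<and> kaehler A h)"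
proof -
  interpret hermitian_atlas A h by unfold_locales (rule assms(1))
  have lam: "lam\<^sup>2 \<noteq> 0" "- lam\<^sup>2 \<noteq> 0" using assms(2) by simp_all
  have 1: "K_closed A h 1 lam \<longleftrightarrow> self_dual A h \<and> einstein A h \<and> has_scalar_curvature A h (24 / lam\<^sup>2)"
    by (rule K_closed_space_form_iff[OF _ _ lam(1)]) (simp_all add: form_coeffs_def)
  have 2: "K_closed A h 2 lam \<longleftrightarrow> self_dual A h \<and> einstein A h \<and> has_scalar_curvature A h (24 / - lam\<^sup>2)"
    by (rule K_closed_space_form_iff[OF _ _ lam(2)]) (simp_all add: form_coeffs_def)
  have 3: "K_closed A h 3 lam \<longleftrightarrow> flat A h \<and> kaehler A h"
    by (rule K_closed_flat_iff[OF _ _ lam(1)]) (simp_all add: form_coeffs_def)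
  have 4: "K_closed A h 4 lam \<longleftrightarrow> flat A h \<and> kaehler A h"
    by (rule K_closed_flat_iff[OF _ _ lam(2)]) (simp_all add: form_coeffs_def)
  from 1 2 3 4 show ?thesis by simp
qed

end
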